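(* Let $F$ be a real quadratic field with ring of integers $\mathcal{O}_F$ and class group $C(F)$. There is a well defined action of $C(F)$ on $\mathcal{QT}(\mathcal{O}_F)$, and this action is simply transitive.
   Context: Fix a nonstandard model ${}^*:V(\mathbb{R})\to V({}^*\mathbb{R})$ of the superstructure over $\mathbb{R}$ (with transfer and saturation); internal sets are elements of ${}^*B$ for $B\in V(\mathbb{R})$. ${}^*\mathbb{R}^{\mathrm{nst}}$ is the set of near-standard elements of ${}^*\mathbb{R}$, $\mathrm{st}$ the standard part. A pseudolattice is a dense additive subgroup of $\mathbb{R}$ of rank two. $Z_L=\mathbb{R}/L$ (Quantum Torus), $T_L={}^*\mathbb{R}^{\mathrm{nst}}/L$ (Hyper Quantum Torus) with projection $\pi_L$, and $p_L:T_L\to Z_L$, $\pi_L(x)\mapsto\mathrm{st}(x)+L$. A morphism $T_L\to T_M$ is the map $x+L\mapsto\phi(x)+M$ induced by an internal additive homomorphism $\phi:{}^*\mathbb{R}\to{}^*\mathbb{R}$ mapping ${}^*\mathbb{R}^{\mathrm{nst}}$ into itself with $\phi(r)+M=\phi(r+L)$ for all $r\in{}^*\mathbb{R}^{\mathrm{nst}}$. A morphism $Z_L\to Z_M$ of Quantum Tori is a map $f$ such that some such morphism $\tilde f:T_L\to T_M$ satisfies $p_M\circ\tilde f=f\circ p_L$; isomorphisms and endomorphism rings $\mathrm{End}(Z_L)$ are taken with respect to these. $F$ is viewed inside $\mathbb{R}$ via a fixed real embedding. $C(F)=I_F/\iota(F^\times)$, where $I_F$ is the group of fractional ideals and $\iota(x)=(x)$.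 $\mathcal{QT}(\mathcal{O}_F)$ is the set of isomorphism classes of Quantum Tori $Z$ with $\mathrm{End}(Z)\cong\mathcal{O}_F$. *)

theory Defs
  imports
    "HOL-Algebra.Algebra"
    "HOL-Algebra.Algebraic_Closure_Type"
    "HOL-Analysis.Elementary_Topology"
    "HOL-Library.Extended_Nat"
begin

section \<open>Superstructures\<close>

text \<open>
  A superstructure \<open>V(X)\<close> over a set \<open>X\<close> of individuals is given by a type \<open>'v\<close> of elements with a
  membership relation; \<open>X\<close> is the type \<open>'a\<close>, embedded by \<open>indiv\<close>.
\<close>

record ('a, 'v) universe =
  indiv :: "'a \<Rightarrow> 'v"
  elem :: "'v \<Rightarrow> 'v \<Rightarrow> bool"

text \<open>\<open>V\<^sub>0 = X\<close> and \<open>V\<^bsub>n+1\<^esub> = V\<^sub>n \<union> Pow V\<^sub>n\<close>.\<close>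

primrec level :: "('a, 'v) universe \<Rightarrow> nat \<Rightarrow> 'v set" where
  "level U 0 = range (indiv U)"
| "level U (Suc n) = level U n \<union>
     {v. v \<notin> range (indiv U) \<and> (\<forall>z. elem U z v \<longrightarrow> z \<in> level U n)}"

text \<open>
  The full superstructure is the case \<open>N = \<infinity>\<close>; for finite \<open>N\<close> this describes \<open>V\<^sub>N(X)\<close>. No type that
  HOL can construct is large enough to carry \<open>V\<^sub>n(\<real>)\<close> for all \<open>n\<close> simultaneously, whereas each
  \<open>V\<^sub>n(\<real>)\<close> with finite \<open>n\<close> is constructible. Admitting both keeps the usual notion and makes sure
  that the theory also has instances inside HOL.
\<close>

definition superstructure :: "enat \<Rightarrow> ('a, 'v) universe \<Rightarrow> bool" where
  "superstructure N U \<longleftrightarrow>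
     inj (indiv U) \<and>
     (\<forall>a z. \<not> elem U z (indiv U a)) \<and>
     (\<forall>v. \<exists>n. enat n \<le> N \<and> v \<in> level U n) \<and>
     (\<forall>u v. u \<notin> range (indiv U) \<longrightarrow> v \<notin> range (indiv U) \<longrightarrow>
        (\<forall>z. elem U z u \<longleftrightarrow> elem U z v) \<longrightarrow> u = v) \<and>
     (\<forall>n A. enat n < N \<longrightarrow> A \<subseteq> level U n \<longrightarrow>
        (\<exists>v. v \<notin> range (indiv U) \<and> (\<forall>z. elem U z v \<longleftrightarrow> z \<in> A)))"

definition set_code :: "('a, 'v) universe \<Rightarrow> 'v set \<Rightarrow> 'v" where
  "set_code U A = (THE v. v \<notin> range (indiv U) \<and> (\<forall>z. elem U z v \<longleftrightarrow> z \<in> A))"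

definition pair_code :: "('a, 'v) universe \<Rightarrow> 'v \<Rightarrow> 'v \<Rightarrow> 'v" where
  "pair_code U u v = set_code U {set_code U {u}, set_code U {u, v}}"

definition fun_code :: "('a, 'v) universe \<Rightarrow> ('a \<Rightarrow> 'a) \<Rightarrow> 'v" where
  "fun_code U f = set_code U {pair_code U (indiv U x) (indiv U (f x)) | x. True}"

definition binop_code :: "('a, 'v) universe \<Rightarrow> ('a \<Rightarrow> 'a \<Rightarrow> 'a) \<Rightarrow> 'v" where
  "binop_code U f = set_code U
     {pair_code U (pair_code U (indiv U x) (indiv U y)) (indiv U (f x y)) | x y. True}"


section \<open>Nonstandard models\<close>

text \<open>Bounded formulas over variables \<open>x\<^sub>0, x\<^sub>1, \<dots>\<close>; \<open>BEx i j P\<close> stands for \<open>\<exists>x\<^sub>i \<in> x\<^sub>j. P\<close>.\<close>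

datatype bformula =
    Eq nat nat
  | Mem nat nat
  | Neg bformula
  | Conj bformula bformula
  | BEx nat nat bformula

primrec sat :: "('a, 'v) universe \<Rightarrow> (nat \<Rightarrow> 'v) \<Rightarrow> bformula \<Rightarrow> bool" where
  "sat U e (Eq i j) \<longleftrightarrow> e i = e j"
| "sat U e (Mem i j) \<longleftrightarrow> elem U (e i) (e j)"
| "sat U e (Neg P) \<longleftrightarrow> \<not> sat U e P"
| "sat U e (Conj P Q) \<longleftrightarrow> sat U e P \<and> sat U e Q"
| "sat U e (BEx i j P) \<longleftrightarrow> (\<exists>z. elem U z (e j) \<and> sat U (e(i := z)) P)"

text \<open>The data of a map \<open>* : V(\<real>) \<rightarrow> V(*\<real>)\<close>; the set \<open>*\<real>\<close> is the type \<open>'h\<close>.\<close>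

record ('v, 'h, 'w) extension =
  base :: "(real, 'v) universe"
  target :: "('h, 'w) universe"
  star :: "'v \<Rightarrow> 'w"

definition internal :: "('v, 'h, 'w) extension \<Rightarrow> 'w \<Rightarrow> bool" where
  "internal E u \<longleftrightarrow> (\<exists>B. elem (target E) u (star E B))"

text \<open>
  Saturation is required for countable families only; every stronger form of saturation implies it.
  The bound \<open>5 \<le> N\<close> guarantees that the graph of the addition of \<open>\<real>\<close>, a set of Kuratowski pairs
  \<open>((x, y), x + y)\<close>, belongs to the superstructure.
\<close>

definition nonstandard_model :: "enat \<Rightarrow> ('v, 'h, 'w) extension \<Rightarrow> bool" where
  "nonstandard_model N E \<longleftrightarrow>
     5 \<le> N \<and>
     superstructure N (base E) \<and>
     superstructure N (target E) \<and>
     star E (set_code (base E) (range (indiv (base E)))) =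
       set_code (target E) (range (indiv (target E))) \<and>
     (\<forall>P e. sat (base E) e P \<longleftrightarrow> sat (target E) (star E \<circ> e) P) \<and>
     (\<forall>A :: nat \<Rightarrow> 'w. (\<forall>n. internal E (A n)) \<longrightarrow>
        (\<forall>n. \<exists>z. \<forall>i\<le>n. elem (target E) z (A i)) \<longrightarrow>
        (\<exists>z. \<forall>i. elem (target E) z (A i)))"

definition hyper_of_real :: "('v, 'h, 'w) extension \<Rightarrow> real \<Rightarrow> 'h" where
  "hyper_of_real E r = (THE x. indiv (target E) x = star E (indiv (base E) r))"

definition star_set :: "('v, 'h, 'w) extension \<Rightarrow> real set \<Rightarrow> 'h set" where
  "star_set E A =
     {x. elem (target E) (indiv (target E) x) (star E (set_code (base E) (indiv (base E) ` A)))}"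

definition hyper_plus :: "('v, 'h, 'w) extension \<Rightarrow> 'h \<Rightarrow> 'h \<Rightarrow> 'h" where
  "hyper_plus E x y =
     (let T = target E in
      THE z. elem T (pair_code T (pair_code T (indiv T x) (indiv T y)) (indiv T z))
               (star E (binop_code (base E) (+))))"

definition hyper_group :: "('v, 'h, 'w) extension \<Rightarrow> 'h monoid" where
  "hyper_group E = \<lparr>carrier = UNIV, monoid.mult = hyper_plus E, one = hyper_of_real E 0\<rparr>"

definition internal_fun :: "('v, 'h, 'w) extension \<Rightarrow> ('h \<Rightarrow> 'h) \<Rightarrow> bool" where
  "internal_fun E f \<longleftrightarrow> internal E (fun_code (target E) f)"

text \<open>\<open>x\<close> lies in the monad of \<open>r\<close>, that is, \<open>x\<close> is infinitely close to \<open>r\<close>.\<close>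

definition near :: "('v, 'h, 'w) extension \<Rightarrow> 'h \<Rightarrow> real \<Rightarrow> bool" where
  "near E x r \<longleftrightarrow> (\<forall>U. open U \<longrightarrow> r \<in> U \<longrightarrow> x \<in> star_set E U)"

definition nearstandard :: "('v, 'h, 'w) extension \<Rightarrow> 'h set" where
  "nearstandard E = {x. \<exists>r. near E x r}"

definition st :: "('v, 'h, 'w) extension \<Rightarrow> 'h \<Rightarrow> real" where
  "st E x = (THE r. near E x r)"


section \<open>Quantum tori\<close>

abbreviation real_ring :: "real ring" where
  "real_ring \<equiv> ring_of_type_algebra"

text \<open>Rank two means free of rank two: \<open>L\<close> has a \<open>\<int>\<close>-basis \<open>a, b\<close>.\<close>

definition pseudolattice :: "real set \<Rightarrow> bool" where
  "pseudolattice L \<longleftrightarrow>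
     (\<exists>a b. (\<forall>m n :: int. of_int m * a + of_int n * b = 0 \<longrightarrow> m = 0 \<and> n = 0) \<and>
            L = {of_int m * a + of_int n * b | m n :: int. True}) \<and>
     closure L = UNIV"

definition quantum_torus :: "real set \<Rightarrow> real set set" where
  "quantum_torus L = a_rcosets\<^bsub>real_ring\<^esub> L"

definition hyper_coset :: "('v, 'h, 'w) extension \<Rightarrow> real set \<Rightarrow> 'h \<Rightarrow> 'h set" where
  "hyper_coset E L x = (hyper_of_real E ` L) #>\<^bsub>hyper_group E\<^esub> x"

definition hyper_torus :: "('v, 'h, 'w) extension \<Rightarrow> real set \<Rightarrow> 'h set set" where
  "hyper_torus E L = hyper_coset E L ` nearstandard E"

definition torus_proj :: "('v, 'h, 'w) extension \<Rightarrow> real set \<Rightarrow> 'h set \<Rightarrow> real set" where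
  "torus_proj E L C =
     (THE Z. \<exists>x\<in>nearstandard E. C = hyper_coset E L x \<and> Z = L +>\<^bsub>real_ring\<^esub> st E x)"

text \<open>
  The condition \<open>\<phi>(r) + M = \<phi>(r + L)\<close> is read as an identity in \<open>T\<^sub>M\<close>: all elements of \<open>r + L\<close> are
  mapped to the class of \<open>\<phi>(r)\<close>, so that \<open>x + L \<mapsto> \<phi>(x) + M\<close> is well defined. As an equality of
  subsets it would force \<open>\<phi>(L) = M\<close>, which excludes the zero map, and \<open>End\<close> would not be a ring.
\<close>

definition hyper_torus_hom ::
  "('v, 'h, 'w) extension \<Rightarrow> real set \<Rightarrow> real set \<Rightarrow> ('h set \<Rightarrow> 'h set) set" where
  "hyper_torus_hom E L M =
     {F \<in> extensional (hyper_torus E L). \<exists>\<phi>.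
        internal_fun E \<phi> \<and> \<phi> \<in> hom (hyper_group E) (hyper_group E) \<and>
        \<phi> ` nearstandard E \<subseteq> nearstandard E \<and>
        (\<forall>r\<in>nearstandard E. \<forall>x\<in>hyper_coset E L r. hyper_coset E M (\<phi> x) = hyper_coset E M (\<phi> r)) \<and>
        (\<forall>x\<in>nearstandard E. F (hyper_coset E L x) = hyper_coset E M (\<phi> x))}"

definition torus_hom ::
  "('v, 'h, 'w) extension \<Rightarrow> real set \<Rightarrow> real set \<Rightarrow> (real set \<Rightarrow> real set) set" where
  "torus_hom E L M =
     {f \<in> quantum_torus L \<rightarrow>\<^sub>E quantum_torus M. \<exists>F\<in>hyper_torus_hom E L M.
        \<forall>C\<in>hyper_torus E L. torus_proj E M (F C) = f (torus_proj E L C)}"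

definition torus_isomorphic :: "('v, 'h, 'w) extension \<Rightarrow> real set \<Rightarrow> real set \<Rightarrow> bool" where
  "torus_isomorphic E L M \<longleftrightarrow>
     (\<exists>f\<in>torus_hom E L M. \<exists>g\<in>torus_hom E M L.
        (\<forall>Z\<in>quantum_torus L. g (f Z) = Z) \<and> (\<forall>Z\<in>quantum_torus M. f (g Z) = Z))"

definition torus_End :: "('v, 'h, 'w) extension \<Rightarrow> real set \<Rightarrow> (real set \<Rightarrow> real set) ring" where
  "torus_End E L =
     \<lparr>carrier = torus_hom E L L,
      monoid.mult = compose (quantum_torus L),
      monoid.one = (\<lambda>Z\<in>quantum_torus L. Z),
      ring.zero = (\<lambda>Z\<in>quantum_torus L. L),
      ring.add = (\<lambda>f g. \<lambda>Z\<in>quantum_torus L. f Z <+>\<^bsub>real_ring\<^esub> g Z)\<rparr>"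


section \<open>Real quadratic fields and the class group\<close>

definition real_quadratic_field :: "real set \<Rightarrow> bool" where
  "real_quadratic_field F \<longleftrightarrow> subfield F real_ring \<and> ring.dimension real_ring 2 \<rat> F"

definition integers_of :: "real set \<Rightarrow> real set" where
  "integers_of F = {x \<in> F. algebraic_int x}"

definition integer_ring :: "real set \<Rightarrow> real ring" where
  "integer_ring F = real_ring\<lparr>carrier := integers_of F\<rparr>"

definition fractional_ideal :: "real set \<Rightarrow> real set \<Rightarrow> bool" where
  "fractional_ideal F I \<longleftrightarrow>
     subgroup I (add_monoid real_ring) \<and> I \<subseteq> F \<and> I \<noteq> {0} \<and>
     (\<forall>c\<in>integers_of F. \<forall>x\<in>I. c * x \<in> I) \<and>
     (\<exists>d\<in>integers_of F - {0}. \<forall>x\<in>I. d * x \<in> integers_of F)"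

text \<open>\<open>ideal_prod real_ring A B\<close> is the set of all finite sums of products \<open>a * b\<close>.\<close>

definition ideal_group :: "real set \<Rightarrow> real set monoid" where
  "ideal_group F =
     \<lparr>carrier = {I. fractional_ideal F I}, monoid.mult = ideal_prod real_ring, one = integers_of F\<rparr>"

definition principal_ideal :: "real set \<Rightarrow> real \<Rightarrow> real set" where
  "principal_ideal F x = x <#\<^bsub>real_ring\<^esub> integers_of F"

definition principal_ideals :: "real set \<Rightarrow> real set set" where
  "principal_ideals F = principal_ideal F ` (F - {0})"

definition class_group :: "real set \<Rightarrow> real set set monoid" where
  "class_group F = ideal_group F Mod principal_ideals F"

definition ideal_class :: "real set \<Rightarrow> real set \<Rightarrow> real set set" where
  "ideal_class F I = principal_ideals F #>\<^bsub>ideal_group F\<^esub> I"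


section \<open>Isomorphism classes of quantum tori with real multiplication\<close>

definition torus_iso_rel :: "('v, 'h, 'w) extension \<Rightarrow> (real set set \<times> real set set) set" where
  "torus_iso_rel E = {(quantum_torus L, quantum_torus M) | L M.
     pseudolattice L \<and> pseudolattice M \<and> torus_isomorphic E L M}"

definition torus_class :: "('v, 'h, 'w) extension \<Rightarrow> real set set \<Rightarrow> real set set set" where
  "torus_class E Z = torus_iso_rel E `` {Z}"

definition has_mult_by :: "('v, 'h, 'w) extension \<Rightarrow> real set \<Rightarrow> real set \<Rightarrow> bool" where
  "has_mult_by E F L \<longleftrightarrow> pseudolattice L \<and> torus_End E L \<simeq> integer_ring F"

definition QT :: "('v, 'h, 'w) extension \<Rightarrow> real set \<Rightarrow> real set set set set" where
  "QT E F = {quantum_torus L | L. has_mult_by E F L} // torus_iso_rel E"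

definition simply_transitive_action ::
  "('g, 'm) monoid_scheme \<Rightarrow> 'x set \<Rightarrow> ('g \<Rightarrow> 'x \<Rightarrow> 'x) \<Rightarrow> bool" where
  "simply_transitive_action G C act \<longleftrightarrow>
     group_action G C act \<and> C \<noteq> {} \<and> (\<forall>x\<in>C. \<forall>y\<in>C. \<exists>!g. g \<in> carrier G \<and> act g x = y)"

end

theory Submission
  imports Defs "HOL-Analysis.Kronecker_Approximation_Theorem"
begin

text \<open>
  A morphism of quantum tori is induced by an internal additive \<open>\<phi>\<close> that preserves near-standardness.
  By saturation \<open>\<phi>\<close> is bounded by a standard number on some standard interval around 0, for
  otherwise an infinitesimal would be mapped to an infinite number. Halving shows that \<open>\<phi>\<close> preserves
  infinitesimals, and \<open>r \<mapsto> st (\<phi> r)\<close> is additive and bounded near 0, hence linear: on standard parts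
  \<open>\<phi>\<close> is multiplication by a real number \<open>c\<close>, and the compatibility condition says \<open>c L \<subseteq> M\<close>. Conversely
  every such \<open>c\<close> occurs. So \<open>Z\<^sub>L \<cong> Z\<^sub>M\<close> iff \<open>M = c L\<close> for some \<open>c \<noteq> 0\<close>, and \<open>End(Z\<^sub>L)\<close> is the multiplier
  ring of \<open>L\<close>.

  If this ring is isomorphic to \<open>\<O>\<^sub>F\<close>, it is equal to \<open>\<O>\<^sub>F\<close>, since \<open>\<O>\<^sub>F\<close> is stable under conjugation; then \<open>L\<close> is a
  multiple of a fractional ideal. Fractional ideals are invertible because of the identity
  \<open>(\<int> + \<int>\<tau>) (a\<int> + a\<int>\<tau>') = \<int> + \<int>a\<tau>\<close> for a primitive equation \<open>a\<tau>\<^sup>2 + b\<tau> + c = 0\<close> with roots \<open>\<tau>, \<tau>'\<close>,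
  whose right hand side is the multiplier ring of \<open>\<int> + \<int>\<tau>\<close>.
\<close>

section \<open>Codes in superstructures\<close>

text \<open>Hyperreals enter only through their addition and through the extensions
  \<open>star_set E A\<close> of standard sets: no order and no product of two hyperreals is set up,
  so bounds are memberships in extended intervals and halving is a statement about
  \<open>x \<oplus>\<^sub>h x\<close>. Transfer acts on an explicit syntax of bounded formulas, and
  N may be as small as 5. This is why graphs are handled as codes of small rank, and why the
  internal sets fed to saturation come from a comprehension principle that is itself transferred.
  The number c of a morphism is unique because a pseudolattice contains no real line. It is an
  arbitrary real, whereas ideal classes allow only scalars from F. The two notions agree because a
  real scalar that takes one fractional ideal to another is a quotient of elements of F; the
  freeness of the action rests on this. Transitivity rests on inverses of ideals, which the
  quadratic identity supplies without factorization into primes. It applies because the ring of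
  integers contains every integral element of F and so is the full multiplier ring of each lattice
  in F that it stabilises.\<close>

locale universe_locale =
  fixes U :: "('a, 'v) universe" and N :: enat
  assumes ss: "superstructure N U" and N5: "5 \<le> N"
begin

lemma inj_indiv: "inj (indiv U)"
  using ss by (simp add: superstructure_def)

lemma indiv_eq_iff [simp]: "indiv U x = indiv U y \<longleftrightarrow> x = y"
  using inj_indiv by (simp add: inj_eq)

lemma indiv_no_elem [simp]: "\<not> elem U z (indiv U a)"
  using ss by (simp add: superstructure_def)

lemma elem_not_indiv: "elem U z v \<Longrightarrow> v \<notin> range (indiv U)"
  by auto

lemma code_ext: "\<lbrakk>u \<notin> range (indiv U); v \<notin> range (indiv U); \<And>z. elem U z u \<longleftrightarrow> elem U z v\<rbrakk> \<Longrightarrow> u = v"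
  using ss unfolding superstructure_def by (elim conjE) (metis (full_types))

lemma comprehension:
  "\<lbrakk>A \<subseteq> level U n; enat n < N\<rbrakk> \<Longrightarrow> \<exists>v. v \<notin> range (indiv U) \<and> (\<forall>z. elem U z v \<longleftrightarrow> z \<in> A)"
  using ss unfolding superstructure_def by (elim conjE) (erule allE, erule allE, erule impE, assumption, erule impE, assumption)

lemma level_mono: "m \<le> n \<Longrightarrow> level U m \<subseteq> level U n"
  by (rule lift_Suc_mono_le[of "level U"]) auto

lemma less_N: "n < 5 \<Longrightarrow> enat n < N"
  using N5 by (metis enat_ord_simps(2) less_le_trans numeral_eq_enat)

text \<open>\<open>set_code\<close> is a definite description, so nothing can be said about it
  before the set is known to exist. Comprehension for subsets of level n requires n < N, which
  \<open>5 \<le> N\<close> provides for the levels 0 to 4.\<close>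

lemma set_code:
  assumes "A \<subseteq> level U n" "n < 5"
  shows set_code_not_indiv: "set_code U A \<notin> range (indiv U)"
    and elem_set_code: "elem U z (set_code U A) \<longleftrightarrow> z \<in> A"
    and set_code_level: "set_code U A \<in> level U (Suc n)"
proof -
  obtain v where v: "v \<notin> range (indiv U)" "\<forall>z. elem U z v \<longleftrightarrow> z \<in> A"
    using comprehension[OF assms(1) less_N[OF assms(2)]] by auto
  have "set_code U A = v"
    unfolding set_code_def using v by (intro the_equality) (auto intro!: code_ext)
  with v assms(1) show "set_code U A \<notin> range (indiv U)" "elem U z (set_code U A) \<longleftrightarrow> z \<in> A"
    "set_code U A \<in> level U (Suc n)" by auto
qed

lemma set_code_eqI:
  assumes "A \<subseteq> level U n" "n < 5" "v \<notin> range (indiv U)" "\<And>z. elem U z v \<longleftrightarrow> z \<in> A"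
  shows "v = set_code U A"
  by (rule code_ext) (use assms set_code[OF assms(1,2)] in auto)

lemma indiv_level [simp]: "indiv U x \<in> level U n"
  using level_mono[of 0 n] by auto

lemma elem_reals [simp]: "elem U z (set_code U (range (indiv U))) \<longleftrightarrow> z \<in> range (indiv U)"
  by (rule elem_set_code[of _ 0]) auto

lemma elem_image [simp]: "elem U z (set_code U (indiv U ` A)) \<longleftrightarrow> z \<in> indiv U ` A"
  by (rule elem_set_code[of _ 0]) auto

text \<open>Transfer cannot see \<open>pair_code\<close>, a description in the metalanguage. This
  version quantifies only over members of p and members of those, as a bounded formula must, and
  makes sense for arbitrary elements.\<close>

definition is_pair :: "'v \<Rightarrow> 'v \<Rightarrow> 'v \<Rightarrow> bool" where
  "is_pair p x y \<longleftrightarrow> (\<exists>s. elem U s p \<and> (\<exists>t. elem U t p \<and>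
     elem U x s \<and> (\<forall>w. elem U w s \<longrightarrow> w = x) \<and>
     elem U x t \<and> elem U y t \<and> (\<forall>w. elem U w t \<longrightarrow> w = x \<or> w = y) \<and>
     (\<forall>w. elem U w p \<longrightarrow> w = s \<or> w = t)))"

lemma elem_pair_code:
  assumes "x \<in> level U n" "y \<in> level U n" "n < 4"
  shows "elem U z (pair_code U x y) \<longleftrightarrow> z = set_code U {x} \<or> z = set_code U {x, y}"
    and "pair_code U x y \<in> level U (n + 2)" "pair_code U x y \<notin> range (indiv U)"
proof -
  have "{set_code U {x}, set_code U {x, y}} \<subseteq> level U (Suc n)"
    using set_code_level[of "{x}" n] set_code_level[of "{x, y}" n] assms by auto
  note * = set_code[OF this, folded pair_code_def]
  show "elem U z (pair_code U x y) \<longleftrightarrow> z = set_code U {x} \<or> z = set_code U {x, y}"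
    using *(2) assms(3) by simp
  show "pair_code U x y \<in> level U (n + 2)"
    using *(3) assms(3) by simp
  show "pair_code U x y \<notin> range (indiv U)"
    using *(1) assms(3) by simp
qed

lemma is_pair_iff:
  assumes "x \<in> level U n" "y \<in> level U n" "n < 4"
  shows "is_pair p x y \<longleftrightarrow> p = pair_code U x y"
proof
  have s: "{x} \<subseteq> level U n" and d: "{x, y} \<subseteq> level U n" and n: "n < 5" using assms by auto
  note [simp] = elem_pair_code(1)[OF assms] elem_set_code[OF s n] elem_set_code[OF d n]
  show "p = pair_code U x y" if p: "is_pair p x y"
  proof -
    from p obtain s' t where st: "elem U s' p" "elem U t p" "elem U x s'"
      "\<forall>w. elem U w s' \<longrightarrow> w = x" "elem U x t" "elem U y t" "\<forall>w. elem U w t \<longrightarrow> w = x \<or> w = y"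
      "\<forall>w. elem U w p \<longrightarrow> w = s' \<or> w = t"
      unfolding is_pair_def by blast
    have "s' = set_code U {x}"
    proof (rule set_code_eqI[OF s n])
      show "s' \<notin> range (indiv U)" using st(3) by (rule elem_not_indiv)
      show "elem U z s' \<longleftrightarrow> z \<in> {x}" for z using st(3,4) by blast
    qed
    moreover have "t = set_code U {x, y}"
    proof (rule set_code_eqI[OF d n])
      show "t \<notin> range (indiv U)" using st(5) by (rule elem_not_indiv)
      show "elem U z t \<longleftrightarrow> z \<in> {x, y}" for z using st(5-7) by blast
    qed
    moreover have "p = pair_code U x y" if "s' = set_code U {x}" "t = set_code U {x, y}"
    proof (rule code_ext)
      show "p \<notin> range (indiv U)" using st(1) by (rule elem_not_indiv)
      show "pair_code U x y \<notin> range (indiv U)" by (rule elem_pair_code(3)[OF assms])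
      show "elem U z p \<longleftrightarrow> elem U z (pair_code U x y)" for z
        unfolding elem_pair_code(1)[OF assms] using st(1,2,8) that by blast
    qed
    ultimately show ?thesis by blast
  qed
  show "is_pair p x y" if "p = pair_code U x y"
    unfolding that is_pair_def
    by (rule exI[of _ "set_code U {x}"], simp, rule exI[of _ "set_code U {x, y}"], simp)
qed

lemma pair_code_inject:
  assumes "x \<in> level U n" "y \<in> level U n" "x' \<in> level U n" "y' \<in> level U n" "n < 4"
  shows "pair_code U x y = pair_code U x' y' \<longleftrightarrow> x = x' \<and> y = y'"
proof
  assume eq: "pair_code U x y = pair_code U x' y'"
  have n: "n < 5" using assms by simp
  have *: "set_code U A = set_code U B \<longleftrightarrow> A = B" if "A \<subseteq> level U n" "B \<subseteq> level U n" for A B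
    using elem_set_code[OF that(1) n] elem_set_code[OF that(2) n] by (metis subsetI subset_antisym)
  have "{set_code U {x}, set_code U {x, y}} = {set_code U {x'}, set_code U {x', y'}}"
    using elem_pair_code(1)[OF assms(1,2,5)] elem_pair_code(1)[OF assms(3,4,5)] eq by auto
  then have "{{x}, {x, y}} = {{x'}, {x', y'}}"
    using assms *[of "{x}" "{x'}"] *[of "{x}" "{x', y'}"] *[of "{x, y}" "{x'}"] *[of "{x, y}" "{x', y'}"]
    unfolding doubleton_eq_iff by auto
  then show "x = x' \<and> y = y'"
    by (auto simp: doubleton_eq_iff)
qed auto

lemma pair_indiv_inject [simp]:
  "pair_code U (indiv U x) (indiv U y) = pair_code U (indiv U x') (indiv U y') \<longleftrightarrow> x = x' \<and> y = y'"
  using pair_code_inject[of "indiv U x" 0] by simp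

lemma pair_indiv_level: "pair_code U (indiv U x) (indiv U y) \<in> level U 2"
  using elem_pair_code(2)[of "indiv U x" 0] by (simp add: numeral_2_eq_2)

lemma triple_indiv_level: "pair_code U (pair_code U (indiv U x) (indiv U y)) (indiv U z) \<in> level U 4"
  using elem_pair_code(2)[OF pair_indiv_level, of "indiv U z"] by simp

lemma is_pair_indiv [simp]: "is_pair p (indiv U x) (indiv U y) \<longleftrightarrow> p = pair_code U (indiv U x) (indiv U y)"
  by (rule is_pair_iff[of _ 0]) auto

text \<open>Here g is any element, not necessarily the graph of a function: it will also stand for
  unknown members of a standard set of candidates.\<close>

definition fun_rel :: "'v \<Rightarrow> 'v \<Rightarrow> 'v \<Rightarrow> bool" where
  "fun_rel g x y \<longleftrightarrow> (\<exists>p. elem U p g \<and> is_pair p x y)"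

text \<open>The inner pair q is not a member of g, so bounded quantifiers reach it only by
  descending from p through a member s of p.\<close>

definition plus_rel :: "'v \<Rightarrow> 'v \<Rightarrow> 'v \<Rightarrow> 'v \<Rightarrow> bool" where
  "plus_rel g x y z \<longleftrightarrow> (\<exists>p. elem U p g \<and> (\<exists>s. elem U s p \<and> (\<exists>q. elem U q s \<and> is_pair q x y \<and> is_pair p q z)))"

lemma elem_fun_code: "elem U p (fun_code U f) \<longleftrightarrow> (\<exists>x. p = pair_code U (indiv U x) (indiv U (f x)))"
proof -
  have "{pair_code U (indiv U x) (indiv U (f x)) | x. True} \<subseteq> level U 2"
    using pair_indiv_level by auto
  from elem_set_code[OF this] show ?thesis unfolding fun_code_def by auto
qed

lemma fun_code_not_indiv: "fun_code U f \<notin> range (indiv U)"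
  using elem_fun_code[of _ f] elem_not_indiv by blast

lemma fun_code_level: "fun_code U f \<in> level U 3"
proof -
  have "{pair_code U (indiv U x) (indiv U (f x)) | x. True} \<subseteq> level U 2"
    using pair_indiv_level by auto
  from set_code_level[OF this] show ?thesis unfolding fun_code_def by (simp add: eval_nat_numeral)
qed

lemma fun_rel_fun_code [simp]: "fun_rel (fun_code U f) (indiv U x) (indiv U y) \<longleftrightarrow> y = f x"
  unfolding fun_rel_def elem_fun_code by auto

lemma plus_rel_iff:
  "plus_rel g (indiv U x) (indiv U y) (indiv U z) \<longleftrightarrow>
     elem U (pair_code U (pair_code U (indiv U x) (indiv U y)) (indiv U z)) g"
proof -
  let ?q = "pair_code U (indiv U x) (indiv U y)"
  have ip: "is_pair p ?q (indiv U z) \<longleftrightarrow> p = pair_code U ?q (indiv U z)" for p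
    by (rule is_pair_iff[of _ 2]) (auto simp: pair_indiv_level)
  have 1: "elem U (set_code U {?q}) (pair_code U ?q (indiv U z))"
    by (subst elem_pair_code[of _ 2]) (auto simp: pair_indiv_level)
  have 2: "elem U ?q (set_code U {?q})"
    by (subst elem_set_code[of _ 2]) (auto simp: pair_indiv_level)
  show ?thesis
    unfolding plus_rel_def using ip 1 2 by auto
qed

text \<open>Coded triples lie in level 4, so collecting them into one set is the instance of
  comprehension that uses the bound 5 to the full.\<close>

lemma plus_rel_binop_code [simp]:
  "plus_rel (binop_code U f) (indiv U x) (indiv U y) (indiv U z) \<longleftrightarrow> z = f x y"
proof -
  have "{pair_code U (pair_code U (indiv U x) (indiv U y)) (indiv U (f x y)) | x y. True} \<subseteq> level U 4"
    using triple_indiv_level by auto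
  from elem_set_code[OF this] show ?thesis
    unfolding plus_rel_iff binop_code_def
    using pair_code_inject[OF pair_indiv_level _ pair_indiv_level] by auto
qed

end


section \<open>Bounded formulas\<close>

abbreviation Imp :: "bformula \<Rightarrow> bformula \<Rightarrow> bformula" where
  "Imp P Q \<equiv> Neg (Conj P (Neg Q))"

abbreviation Disj :: "bformula \<Rightarrow> bformula \<Rightarrow> bformula" where
  "Disj P Q \<equiv> Neg (Conj (Neg P) (Neg Q))"

abbreviation BAll :: "nat \<Rightarrow> nat \<Rightarrow> bformula \<Rightarrow> bformula" where
  "BAll i j P \<equiv> Neg (BEx i j (Neg P))"

text \<open>The formulas below bind the variables from 80 on, so their arguments have to be smaller.\<close>

definition Pair_fm :: "nat \<Rightarrow> nat \<Rightarrow> nat \<Rightarrow> bformula" where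
  "Pair_fm p x y = BEx 90 p (BEx 91 p (Conj (Mem x 90) (Conj (BAll 92 90 (Eq 92 x))
     (Conj (Mem x 91) (Conj (Mem y 91) (Conj (BAll 92 91 (Disj (Eq 92 x) (Eq 92 y)))
       (BAll 92 p (Disj (Eq 92 90) (Eq 92 91)))))))))"

definition Fun_fm :: "nat \<Rightarrow> nat \<Rightarrow> nat \<Rightarrow> bformula" where
  "Fun_fm g x y = BEx 80 g (Pair_fm 80 x y)"

definition Plus_fm :: "nat \<Rightarrow> nat \<Rightarrow> nat \<Rightarrow> nat \<Rightarrow> bformula" where
  "Plus_fm g x y z = BEx 80 g (BEx 81 80 (BEx 82 81 (Conj (Pair_fm 82 x y) (Pair_fm 80 82 z))))"

context universe_locale
begin

lemma sat_Pair_fm [simp]: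
  assumes "p < 90" "x < 90" "y < 90"
  shows "sat U e (Pair_fm p x y) \<longleftrightarrow> is_pair (e p) (e x) (e y)"
proof -
  have "p \<noteq> 90" "p \<noteq> 91" "p \<noteq> 92" "x \<noteq> 90" "x \<noteq> 91" "x \<noteq> 92" "y \<noteq> 90" "y \<noteq> 91" "y \<noteq> 92"
    using assms by auto
  then show ?thesis
    unfolding Pair_fm_def is_pair_def by simp
qed

lemma sat_Fun_fm [simp]:
  assumes "g < 80" "x < 80" "y < 80"
  shows "sat U e (Fun_fm g x y) \<longleftrightarrow> fun_rel (e g) (e x) (e y)"
  using assms unfolding Fun_fm_def fun_rel_def by auto

lemma sat_Plus_fm [simp]:
  assumes "g < 80" "x < 80" "y < 80" "z < 80"
  shows "sat U e (Plus_fm g x y z) \<longleftrightarrow> plus_rel (e g) (e x) (e y) (e z)"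
  using assms unfolding Plus_fm_def plus_rel_def by auto

end


section \<open>Transfer\<close>

text \<open>Bounded quantifiers over the set of reals turn into quantifiers over a type, in the base
  and in the target alike. Rewriting with this on both sides makes a transferred sentence
  readable.\<close>

lemma ex_range: "(\<exists>z. z \<in> range f \<and> P z) \<longleftrightarrow> (\<exists>x. P (f x))"
  by auto

locale nonstandard_model_locale =
  fixes E :: "('v, 'h, 'w) extension" and N :: enat
  assumes nsm: "nonstandard_model N E"
begin

sublocale B: universe_locale "base E" N
  using nsm by unfold_locales (auto simp: nonstandard_model_def)

sublocale T: universe_locale "target E" N
  using nsm by unfold_locales (auto simp: nonstandard_model_def)

abbreviation hyp :: "real \<Rightarrow> 'h" where "hyp \<equiv> hyper_of_real E"
abbreviation hadd :: "'h \<Rightarrow> 'h \<Rightarrow> 'h" (infixl \<open>\<oplus>\<^sub>h\<close> 65) where "hadd \<equiv> hyper_plus E"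
abbreviation reals_code :: 'v where "reals_code \<equiv> set_code (base E) (range (indiv (base E)))"
abbreviation plus_code :: 'v where "plus_code \<equiv> binop_code (base E) (+)"
abbreviation code :: "real set \<Rightarrow> 'v" where "code A \<equiv> set_code (base E) (indiv (base E) ` A)"

text \<open>This direction loses nothing: the converse is the same statement for
  \<open>Neg P\<close>.\<close>

lemma transfer: "sat (base E) e P \<Longrightarrow> sat (target E) (star E \<circ> e) P"
  using nsm unfolding nonstandard_model_def by blast

lemma star_reals [simp]: "star E reals_code = set_code (target E) (range (indiv (target E)))"
  using nsm unfolding nonstandard_model_def by blast

lemma saturation:
  fixes A :: "nat \<Rightarrow> 'w"
  assumes "\<And>n. internal E (A n)" "\<And>n. \<exists>z. \<forall>i\<le>n. elem (target E) z (A i)"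
  shows "\<exists>z. \<forall>i. elem (target E) z (A i)"
  using nsm assms unfolding nonstandard_model_def by blast

lemma star_elem_iff: "elem (target E) (star E u) (star E v) \<longleftrightarrow> elem (base E) u v"
  using transfer[of "(\<lambda>_. u)(1 := v)" "Mem 0 1"] transfer[of "(\<lambda>_. u)(1 := v)" "Neg (Mem 0 1)"]
  by (auto simp: fun_upd_comp)

text \<open>The extension of the set of reals consists exactly of the individuals of the target, so
  the image of a real is an individual and the description in \<open>hyper_of_real\<close> denotes
  it.\<close>

lemma star_indiv [simp]: "star E (indiv (base E) r) = indiv (target E) (hyp r)"
proof -
  have "elem (target E) (star E (indiv (base E) r)) (star E reals_code)"
    unfolding star_elem_iff by simp
  then obtain x where "star E (indiv (base E) r) = indiv (target E) x"
    by auto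
  then show ?thesis
    unfolding hyper_of_real_def by simp
qed

lemma elem_code [simp]: "elem (target E) (indiv (target E) x) (star E (code A)) \<longleftrightarrow> x \<in> star_set E A"
  by (simp add: star_set_def)

lemma code_indiv [simp]: "indiv (base E) x \<in> indiv (base E) ` A \<longleftrightarrow> x \<in> A"
  by (auto simp: B.inj_indiv)

lemma hyp_star_set [simp]: "hyp r \<in> star_set E A \<longleftrightarrow> r \<in> A"
  using star_elem_iff[of "indiv (base E) r" "code A"] by simp

lemma star_set_mono:
  assumes "A \<subseteq> B" shows "star_set E A \<subseteq> star_set E B"
proof -
  have "sat (base E) ((\<lambda>_. reals_code)(3 := code A, 4 := code B)) (BAll 10 0 (Imp (Mem 10 3) (Mem 10 4)))"
    using assms by (auto simp: ex_range)
  from transfer[OF this] show ?thesis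
    by (auto simp: ex_range fun_upd_comp)
qed

lemma star_set_disjoint:
  assumes "A \<inter> B = {}" shows "star_set E A \<inter> star_set E B = {}"
proof -
  have "sat (base E) ((\<lambda>_. reals_code)(3 := code A, 4 := code B)) (BAll 10 0 (Neg (Conj (Mem 10 3) (Mem 10 4))))"
    using assms by (auto simp: ex_range)
  from transfer[OF this] show ?thesis
    by (auto simp: ex_range fun_upd_comp)
qed

text \<open>Existence and uniqueness of sums are two bounded sentences about the code of addition;
  their transfers justify the description in \<open>hyper_plus\<close>. As a rewrite rule this turns
  every transferred \<open>Plus_fm\<close> into an equation.\<close>

lemma plus_rel_star [simp]:
  "T.plus_rel (star E plus_code) (indiv (target E) x) (indiv (target E) y) (indiv (target E) z) \<longleftrightarrow> z = x \<oplus>\<^sub>h y"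
proof -
  let ?P = "\<lambda>z. T.plus_rel (star E plus_code) (indiv (target E) x) (indiv (target E) y) (indiv (target E) z)"
  let ?e = "(\<lambda>_. reals_code)(1 := plus_code)"
  have "sat (base E) ?e (BAll 10 0 (BAll 11 0 (BEx 12 0 (Plus_fm 1 10 11 12))))"
    by (auto simp: ex_range)
  from transfer[OF this] have ex: "\<exists>z. ?P z"
    by (auto simp: ex_range fun_upd_comp)
  have "sat (base E) ?e (BAll 10 0 (BAll 11 0 (BAll 12 0 (BAll 13 0
          (Imp (Conj (Plus_fm 1 10 11 12) (Plus_fm 1 10 11 13)) (Eq 12 13))))))"
    by (auto simp: ex_range)
  from transfer[OF this] have uniq: "\<And>z z'. ?P z \<Longrightarrow> ?P z' \<Longrightarrow> z = z'"
    by (auto simp: ex_range fun_upd_comp)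
  have "x \<oplus>\<^sub>h y = (THE z. ?P z)"
    unfolding hyper_plus_def Let_def T.plus_rel_iff ..
  with ex uniq show ?thesis
    by (metis the_equality)
qed

lemma hadd_assoc: "(x \<oplus>\<^sub>h y) \<oplus>\<^sub>h z = x \<oplus>\<^sub>h (y \<oplus>\<^sub>h z)"
proof -
  have "sat (base E) ((\<lambda>_. reals_code)(1 := plus_code))
     (BAll 10 0 (BAll 11 0 (BAll 12 0 (BAll 13 0 (BAll 14 0 (BAll 15 0
        (Imp (Conj (Plus_fm 1 10 11 13) (Conj (Plus_fm 1 11 12 14) (Plus_fm 1 13 12 15)))
           (Plus_fm 1 10 14 15))))))))"
    by (simp add: ex_range)
  from transfer[OF this] show ?thesis
    by (simp add: ex_range fun_upd_comp)
qed

lemma hadd_commute: "x \<oplus>\<^sub>h y = y \<oplus>\<^sub>h x"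
proof -
  have "sat (base E) ((\<lambda>_. reals_code)(1 := plus_code))
     (BAll 10 0 (BAll 11 0 (BAll 12 0 (Imp (Plus_fm 1 10 11 12) (Plus_fm 1 11 10 12)))))"
    by (simp add: ex_range)
  from transfer[OF this] show ?thesis
    by (simp add: ex_range fun_upd_comp)
qed

lemma hyp_add: "hyp (r + s) = hyp r \<oplus>\<^sub>h hyp s"
proof -
  have "sat (base E) ((\<lambda>_. reals_code)(1 := plus_code, 10 := indiv (base E) r, 11 := indiv (base E) s,
      12 := indiv (base E) (r + s))) (Plus_fm 1 10 11 12)"
    by simp
  from transfer[OF this] show ?thesis
    by (simp add: fun_upd_comp)
qed

lemma hadd_zero [simp]: "hyp 0 \<oplus>\<^sub>h x = x"
proof -
  have "sat (base E) ((\<lambda>_. reals_code)(1 := plus_code, 10 := indiv (base E) 0))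
     (BAll 11 0 (Plus_fm 1 10 11 11))"
    by (simp add: ex_range)
  from transfer[OF this] have "\<And>x. x = hyp 0 \<oplus>\<^sub>h x"
    by (simp add: ex_range fun_upd_comp)
  from this[of x] show ?thesis ..
qed

lemma hadd_inverse: "\<exists>y. y \<oplus>\<^sub>h x = hyp 0"
proof -
  have "\<forall>r :: real. \<exists>s. 0 = s + r"
  proof
    fix r :: real
    show "\<exists>s. 0 = s + r" by (rule exI[of _ "- r"]) simp
  qed
  then have "sat (base E) ((\<lambda>_. reals_code)(1 := plus_code, 10 := indiv (base E) 0))
     (BAll 11 0 (BEx 12 0 (Plus_fm 1 12 11 10)))"
    by (simp add: ex_range)
  from transfer[OF this] show ?thesis
    by (simp add: ex_range fun_upd_comp eq_commute)
qed

lemma star_set_add: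
  assumes "\<And>x y. x \<in> A \<Longrightarrow> y \<in> B \<Longrightarrow> x + y \<in> C" "x \<in> star_set E A" "y \<in> star_set E B"
  shows "x \<oplus>\<^sub>h y \<in> star_set E C"
proof -
  have "sat (base E) ((\<lambda>_. reals_code)(1 := plus_code, 3 := code A, 4 := code B, 5 := code C))
     (BAll 10 0 (BAll 11 0 (BAll 12 0 (Imp (Conj (Mem 10 3) (Conj (Mem 11 4) (Plus_fm 1 10 11 12))) (Mem 12 5)))))"
    using assms(1) by (simp add: ex_range)
  from transfer[OF this] show ?thesis
    using assms(2,3) by (simp add: ex_range fun_upd_comp)
qed

text \<open>Division by two, phrased without a halving operation on the hyperreals.\<close>

lemma star_set_halve:
  assumes "\<And>x. x + x \<in> A \<Longrightarrow> x \<in> B" "x \<oplus>\<^sub>h x \<in> star_set E A"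
  shows "x \<in> star_set E B"
proof -
  have "sat (base E) ((\<lambda>_. reals_code)(1 := plus_code, 3 := code A, 4 := code B))
     (BAll 10 0 (BAll 11 0 (Imp (Conj (Mem 11 3) (Plus_fm 1 10 10 11)) (Mem 10 4))))"
    using assms(1) by (simp add: ex_range)
  from transfer[OF this] show ?thesis
    using assms(2) by (simp add: ex_range fun_upd_comp)
qed

sublocale H: comm_group "hyper_group E"
  by (intro comm_groupI)
    (auto simp: hyper_group_def hadd_assoc hadd_inverse intro: hadd_commute)


section \<open>Standard functions\<close>

definition star_fun :: "(real \<Rightarrow> real) \<Rightarrow> 'h \<Rightarrow> 'h" where
  "star_fun f x = (THE y. T.fun_rel (star E (fun_code (base E) f)) (indiv (target E) x) (indiv (target E) y))"

lemma fun_rel_star [simp]: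
  "T.fun_rel (star E (fun_code (base E) f)) (indiv (target E) x) (indiv (target E) y) \<longleftrightarrow> y = star_fun f x"
proof -
  let ?P = "\<lambda>y. T.fun_rel (star E (fun_code (base E) f)) (indiv (target E) x) (indiv (target E) y)"
  let ?e = "(\<lambda>_. reals_code)(2 := fun_code (base E) f)"
  have "sat (base E) ?e (BAll 10 0 (BEx 11 0 (Fun_fm 2 10 11)))"
    by (auto simp: ex_range)
  from transfer[OF this] have ex: "\<exists>z. ?P z"
    by (auto simp: ex_range fun_upd_comp)
  have "sat (base E) ?e (BAll 10 0 (BAll 11 0 (BAll 12 0 (Imp (Conj (Fun_fm 2 10 11) (Fun_fm 2 10 12)) (Eq 11 12)))))"
    by (auto simp: ex_range)
  from transfer[OF this] have uniq: "\<And>z z'. ?P z \<Longrightarrow> ?P z' \<Longrightarrow> z = z'"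
    by (auto simp: ex_range fun_upd_comp)
  from ex uniq show ?thesis
    unfolding star_fun_def by (metis the_equality)
qed

text \<open>\<open>internal_fun\<close> speaks of the code of the graph of a map on the type of
  hyperreals, so the extended graph has to be recognised as such a code. Its members are pairs of
  individuals by transfer, and \<open>fun_rel_star\<close> decides which pairs occur.\<close>

lemma star_fun_code: "star E (fun_code (base E) f) = fun_code (target E) (star_fun f)"
proof (rule T.code_ext)
  let ?g = "star E (fun_code (base E) f)"
  have eq: "?g = star E v \<longleftrightarrow> fun_code (base E) f = v" for v
    using transfer[of "(\<lambda>_. fun_code (base E) f)(1 := v)" "Eq 0 1"]
      transfer[of "(\<lambda>_. fun_code (base E) f)(1 := v)" "Neg (Eq 0 1)"]
    by (auto simp: fun_upd_comp)
  have "sat (base E) ((\<lambda>_. reals_code)(2 := fun_code (base E) f))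
    (BAll 12 2 (BEx 10 0 (BEx 11 0 (Pair_fm 12 10 11))))"
    by (auto simp: ex_range B.elem_fun_code)
  from transfer[OF this]
  have pairs: "\<And>p. elem (target E) p ?g \<Longrightarrow> \<exists>x y. p = pair_code (target E) (indiv (target E) x) (indiv (target E) y)"
    by (simp add: ex_range fun_upd_comp)
  have 1: "elem (target E) (pair_code (target E) (indiv (target E) x) (indiv (target E) y)) ?g \<longleftrightarrow> y = star_fun f x" for x y
    using fun_rel_star[of f x y] unfolding T.fun_rel_def by simp
  show "?g \<notin> range (indiv (target E))"
    using 1[of undefined "star_fun f undefined"] T.elem_not_indiv by blast
  show "fun_code (target E) (star_fun f) \<notin> range (indiv (target E))"
    by (rule T.fun_code_not_indiv)
  show "elem (target E) p ?g \<longleftrightarrow> elem (target E) p (fun_code (target E) (star_fun f))" for p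
    unfolding T.elem_fun_code by (metis pairs 1)
qed

text \<open>A graph is a member of its own singleton, so its image is a member of the extension of
  that singleton. The singleton exists because graphs lie in level 3.\<close>

lemma internal_star_fun: "internal_fun E (star_fun f)"
proof -
  have "elem (base E) (fun_code (base E) f) (set_code (base E) {fun_code (base E) f})"
    by (subst B.elem_set_code[of _ 3]) (auto simp: B.fun_code_level)
  then show ?thesis
    unfolding internal_fun_def internal_def star_fun_code[symmetric] star_elem_iff[symmetric] by blast
qed

lemma star_fun_hyp: "star_fun f (hyp r) = hyp (f r)"
proof -
  have "sat (base E) ((\<lambda>_. reals_code)(2 := fun_code (base E) f, 10 := indiv (base E) r, 11 := indiv (base E) (f r)))
     (Fun_fm 2 10 11)"
    by simp
  from transfer[OF this] show ?thesis
    by (simp add: fun_upd_comp)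
qed

lemma star_fun_image:
  assumes "\<And>x. x \<in> A \<Longrightarrow> f x \<in> B" "x \<in> star_set E A"
  shows "star_fun f x \<in> star_set E B"
proof -
  have "sat (base E) ((\<lambda>_. reals_code)(2 := fun_code (base E) f, 3 := code A, 4 := code B))
     (BAll 10 0 (BAll 11 0 (Imp (Conj (Mem 10 3) (Fun_fm 2 10 11)) (Mem 11 4))))"
    using assms(1) by (simp add: ex_range)
  from transfer[OF this] show ?thesis
    using assms(2) by (simp add: ex_range fun_upd_comp)
qed

lemma star_fun_additive:
  assumes "\<And>x y. f (x + y) = f x + f y"
  shows "star_fun f (x \<oplus>\<^sub>h y) = star_fun f x \<oplus>\<^sub>h star_fun f y"
proof -
  have "sat (base E) ((\<lambda>_. reals_code)(1 := plus_code, 2 := fun_code (base E) f))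
     (BAll 10 0 (BAll 11 0 (BAll 12 0 (BAll 13 0 (BAll 14 0 (BAll 15 0 (Imp
       (Conj (Plus_fm 1 10 11 12) (Conj (Fun_fm 2 10 13) (Conj (Fun_fm 2 11 14) (Fun_fm 2 12 15))))
       (Plus_fm 1 13 14 15))))))))"
    using assms by (simp add: ex_range)
  from transfer[OF this] show ?thesis
    by (simp add: ex_range fun_upd_comp)
qed


section \<open>Internal functions\<close>

text \<open>The instance of the internal definition principle that saturation requires.
  Comprehension becomes a bounded sentence once the sets sought range over the power set of the
  reals and the functions over a standard set; its transfer yields an internal set.\<close>

lemma internal_preimage:
  assumes "internal_fun E \<phi>"
  obtains A where "internal E A" "\<And>z. elem (target E) z A \<longleftrightarrow>
    (\<exists>x. z = indiv (target E) x \<and> x \<in> star_set E C \<and> \<phi> x \<notin> star_set E D)"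
proof -
  obtain W where W: "elem (target E) (fun_code (target E) \<phi>) (star E W)"
    using assms unfolding internal_fun_def internal_def by blast
  let ?pow = "set_code (base E) (set_code (base E) ` Pow (range (indiv (base E))))"
  have "set_code (base E) ` Pow (range (indiv (base E))) \<subseteq> level (base E) (Suc 0)"
    using B.set_code_level[of _ 0] by auto
  then have pow [simp]: "elem (base E) v ?pow \<longleftrightarrow> v \<in> set_code (base E) ` Pow (range (indiv (base E)))" for v
    by (rule B.elem_set_code) simp
  \<comment> \<open>Members of members of the extended power set are individuals. This allows A to
    be described by all of its members z, not only by those known to be individuals.\<close>
  have "sat (base E) ((\<lambda>_. reals_code)(2 := ?pow)) (BAll 10 2 (BAll 11 10 (Mem 11 0)))"
    using B.elem_set_code[of _ 0] by auto
  from transfer[OF this]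
  have sub: "\<And>A z. elem (target E) A (star E ?pow) \<Longrightarrow> elem (target E) z A \<Longrightarrow> z \<in> range (indiv (target E))"
    by (auto simp: fun_upd_comp)
  have compr: "\<exists>A\<in>Pow (range (indiv (base E))). \<forall>x. elem (base E) (indiv (base E) x) (set_code (base E) A) \<longleftrightarrow> Q x" for Q
    using B.elem_set_code[of _ 0] by (intro bexI[of _ "indiv (base E) ` {x. Q x}"]) auto
  \<comment> \<open>Since \<phi> is not standard, it cannot be a parameter. The sentence quantifies
    over all g in W, as variable 20, and is instantiated with the graph of \<phi> only after
    transfer.\<close>
  have "sat (base E) ((\<lambda>_. reals_code)(2 := ?pow, 3 := code C, 4 := code D, 5 := W))
    (BAll 20 5 (BEx 10 2 (BAll 11 0 (Conj
      (Imp (Mem 11 10) (Conj (Mem 11 3) (BEx 12 0 (Conj (Fun_fm 20 11 12) (Neg (Mem 12 4))))))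
      (Imp (Conj (Mem 11 3) (BEx 12 0 (Conj (Fun_fm 20 11 12) (Neg (Mem 12 4))))) (Mem 11 10))))))"
    (is "sat _ _ ?fm")
  proof -
    have "\<exists>A. elem (base E) A ?pow \<and> (\<forall>x. elem (base E) (indiv (base E) x) A \<longleftrightarrow>
      x \<in> C \<and> (\<exists>y. B.fun_rel g (indiv (base E) x) (indiv (base E) y) \<and> y \<notin> D))" for g
      using compr[of "\<lambda>x. x \<in> C \<and> (\<exists>y. B.fun_rel g (indiv (base E) x) (indiv (base E) y) \<and> y \<notin> D)"]
      unfolding pow by blast
    then show ?thesis
      by (simp add: ex_range) metis
  qed
  from transfer[OF this] have "\<exists>A. elem (target E) A (star E ?pow) \<and>
      (\<forall>x. elem (target E) (indiv (target E) x) A \<longleftrightarrow>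
        x \<in> star_set E C \<and> (\<exists>y. T.fun_rel g (indiv (target E) x) (indiv (target E) y) \<and> y \<notin> star_set E D))"
    if "elem (target E) g (star E W)" for g
    using that by (simp add: ex_range fun_upd_comp) metis
  from this[OF W] obtain A where A: "elem (target E) A (star E ?pow)"
    "\<And>x. elem (target E) (indiv (target E) x) A \<longleftrightarrow>
      x \<in> star_set E C \<and> \<phi> x \<notin> star_set E D"
    by auto
  show thesis
  proof (rule that)
    show "internal E A" using A(1) unfolding internal_def by blast
    show "elem (target E) z A \<longleftrightarrow>
      (\<exists>x. z = indiv (target E) x \<and> x \<in> star_set E C \<and> \<phi> x \<notin> star_set E D)" for z
      using sub[OF A(1), of z] A(2) by auto
  qed
qed

end


section \<open>Subgroups of the reals\<close>

definition zmodule :: "real set \<Rightarrow> bool" where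
  "zmodule A \<longleftrightarrow> 0 \<in> A \<and> (\<forall>x\<in>A. \<forall>y\<in>A. x - y \<in> A)"

lemma zmodule_0: "zmodule A \<Longrightarrow> 0 \<in> A"
  by (simp add: zmodule_def)

lemma zmodule_diff: "zmodule A \<Longrightarrow> x \<in> A \<Longrightarrow> y \<in> A \<Longrightarrow> x - y \<in> A"
  by (simp add: zmodule_def)

lemma zmodule_uminus: "zmodule A \<Longrightarrow> x \<in> A \<Longrightarrow> - x \<in> A"
  using zmodule_diff[of A 0 x] zmodule_0[of A] by simp

lemma zmodule_add: "zmodule A \<Longrightarrow> x \<in> A \<Longrightarrow> y \<in> A \<Longrightarrow> x + y \<in> A"
  using zmodule_diff[of A x "- y"] zmodule_uminus[of A y] by simp

lemma zmodule_of_nat_mult: "zmodule A \<Longrightarrow> x \<in> A \<Longrightarrow> of_nat n * x \<in> A"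
  by (induction n) (auto simp: distrib_right intro: zmodule_0 zmodule_add)

lemma zmodule_of_int_mult:
  assumes "zmodule A" "x \<in> A" shows "of_int k * x \<in> A"
  using zmodule_of_nat_mult[OF assms] zmodule_uminus[OF assms(1)]
  by (cases k rule: int_cases2) fastforce+

section \<open>Cosets of a subgroup of the reals\<close>

lemma real_coset: "L +>\<^bsub>real_ring\<^esub> x = (\<lambda>l. l + x) ` L"
  by (auto simp: a_r_coset_def r_coset_def ring_of_type_algebra_def)

lemma quantum_torus_eq: "quantum_torus L = range (\<lambda>x. L +>\<^bsub>real_ring\<^esub> x)"
  by (auto simp: quantum_torus_def A_RCOSETS_def RCOSETS_def a_r_coset_def ring_of_type_algebra_def)

lemma real_coset_eq_iff:
  assumes "zmodule L"
  shows "L +>\<^bsub>real_ring\<^esub> x = L +>\<^bsub>real_ring\<^esub> y \<longleftrightarrow> x - y \<in> L"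
proof
  assume "L +>\<^bsub>real_ring\<^esub> x = L +>\<^bsub>real_ring\<^esub> y"
  moreover have "x \<in> L +>\<^bsub>real_ring\<^esub> x"
    unfolding real_coset using zmodule_0[OF assms] by force
  ultimately show "x - y \<in> L"
    unfolding real_coset by auto
next
  have sub: "L +>\<^bsub>real_ring\<^esub> u \<subseteq> L +>\<^bsub>real_ring\<^esub> v" if "u - v \<in> L" for u v
  proof
    fix z assume "z \<in> L +>\<^bsub>real_ring\<^esub> u"
    then obtain l where "l \<in> L" "z = l + u" unfolding real_coset by auto
    then show "z \<in> L +>\<^bsub>real_ring\<^esub> v"
      unfolding real_coset using zmodule_add[OF assms \<open>l \<in> L\<close> that] by (intro image_eqI[of _ _ "l + (u - v)"]) auto
  qed
  assume "x - y \<in> L"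
  moreover from this have "y - x \<in> L" using zmodule_uminus[OF assms] by fastforce
  ultimately show "L +>\<^bsub>real_ring\<^esub> x = L +>\<^bsub>real_ring\<^esub> y"
    using sub by blast
qed


section \<open>Bounded additive functions\<close>

text \<open>The bound near 0 extends to the unit interval after division by p. The deviation d from
  linearity at x is multiplied by n at the point n x, yet there it equals the deviation at the
  fractional part of n x, which stays bounded; so d = 0 by the Archimedean property.\<close>

lemma additive_bounded_imp_linear:
  fixes g :: "real \<Rightarrow> real"
  assumes add: "\<And>x y. g (x + y) = g x + g y" and "\<delta> > 0" and bound: "\<And>x. \<bar>x\<bar> < \<delta> \<Longrightarrow> \<bar>g x\<bar> \<le> c"
  shows "g x = g 1 * x"
proof -
  have g0: "g 0 = 0" using add[of 0 0] by simp
  have gneg: "g (- x) = - g x" for x using add[of x "- x"] g0 by simp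
  have gnat: "g (of_nat n * x) = of_nat n * g x" for n x
    by (induction n) (simp_all add: g0 add distrib_right)
  have gint: "g (of_int k) = of_int k * g 1" for k
    using gnat[of _ 1] gneg by (cases k rule: int_cases2) auto
  obtain p :: nat where p: "1 / \<delta> < p" using reals_Archimedean2 by blast
  with \<open>\<delta> > 0\<close> have "p > 0" by (metis divide_pos_pos less_trans of_nat_0_less_iff zero_less_one)
  have unit: "\<bar>g y\<bar> \<le> p * c" if "0 \<le> y" "y < 1" for y
  proof -
    have "y / p < 1 / p" using that \<open>p > 0\<close> by (simp add: divide_strict_right_mono)
    also have "1 / p < \<delta>" using p \<open>\<delta> > 0\<close> \<open>p > 0\<close> by (simp add: field_simps)
    finally have "\<bar>y / p\<bar> < \<delta>" using that by simp
    from bound[OF this] have "p * \<bar>g (y / p)\<bar> \<le> p * c" by (simp add: mult_left_mono)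
    then show ?thesis using gnat[of p "y / p"] \<open>p > 0\<close> by (simp add: abs_mult)
  qed
  define d where "d = g x - g 1 * x"
  have "of_nat n * \<bar>d\<bar> \<le> p * c + \<bar>g 1\<bar>" for n
  proof -
    define m where "m = \<lfloor>of_nat n * x\<rfloor>"
    define y where "y = of_nat n * x - of_int m"
    have y: "0 \<le> y" "y < 1" unfolding y_def m_def by linarith+
    have "of_nat n * g x = g (of_int m + y)" unfolding y_def by (simp add: gnat)
    then have "of_nat n * d = g y - g 1 * y"
      unfolding d_def add gint y_def by (simp add: algebra_simps)
    moreover have "\<bar>g 1 * y\<bar> \<le> \<bar>g 1\<bar>"
      using y by (simp add: abs_mult mult_left_le)
    ultimately have "\<bar>of_nat n * d\<bar> \<le> p * c + \<bar>g 1\<bar>"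
      using unit[OF y] by linarith
    then show ?thesis by (simp add: abs_mult)
  qed
  then have "\<not> 0 < \<bar>d\<bar>"
    using reals_Archimedean3 by (metis linorder_not_le)
  then show ?thesis by (simp add: d_def)
qed


section \<open>Near-standard points\<close>

context nonstandard_model_locale
begin

lemma near_hyp: "near E (hyp r) r"
  by (simp add: near_def)

lemma near_unique: "near E x r \<Longrightarrow> near E x s \<Longrightarrow> r = s"
proof (rule ccontr)
  assume "near E x r" "near E x s" "r \<noteq> s"
  moreover obtain U V where "open U" "open V" "r \<in> U" "s \<in> V" "U \<inter> V = {}"
    using hausdorff[OF \<open>r \<noteq> s\<close>] by blast
  ultimately show False
    using star_set_disjoint[of U V] unfolding near_def by blast
qed

lemma st_eq: "near E x r \<Longrightarrow> st E x = r"
  unfolding st_def using near_unique by blast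

lemma near_add:
  assumes "near E x r" "near E y s" shows "near E (x \<oplus>\<^sub>h y) (r + s)"
  unfolding near_def
proof (intro allI impI)
  fix U :: "real set" assume "open U" "r + s \<in> U"
  then obtain e where e: "e > 0" "\<And>z. dist z (r + s) < e \<Longrightarrow> z \<in> U"
    unfolding open_dist by blast
  have "x \<in> star_set E ({r - e / 2<..<r + e / 2})" "y \<in> star_set E ({s - e / 2<..<s + e / 2})"
    using assms e(1) unfolding near_def by simp_all
  then show "x \<oplus>\<^sub>h y \<in> star_set E U"
  proof (rule star_set_add[rotated])
    fix a b assume "a \<in> {r - e / 2<..<r + e / 2}" "b \<in> {s - e / 2<..<s + e / 2}"
    then have "dist (a + b) (r + s) < e" unfolding greaterThanLessThan_iff dist_real_def by linarith
    then show "a + b \<in> U" by (rule e(2))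
  qed
qed

text \<open>Bounds on \<phi> reach its standard part this way, strict inequalities becoming weak
  ones. If r had a neighbourhood missing A, then x would lie in the extensions of two disjoint
  sets.\<close>

lemma near_closure:
  assumes "near E x r" "x \<in> star_set E A" shows "r \<in> closure A"
proof (rule ccontr)
  assume "r \<notin> closure A"
  then have "x \<in> star_set E (- closure A)"
    using assms(1) unfolding near_def by (simp add: open_Compl)
  with assms(2) star_set_disjoint[of A "- closure A"] closure_subset[of A] show False
    by blast
qed

lemma near_zeroI:
  assumes "\<And>e. e > 0 \<Longrightarrow> \<exists>d\<le>e. x \<in> star_set E {- d<..<d}"
  shows "near E x 0"
  unfolding near_def
proof (intro allI impI)
  fix U :: "real set" assume "open U" "0 \<in> U"
  then obtain e where e: "e > 0" "\<And>z. dist z 0 < e \<Longrightarrow> z \<in> U"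
    unfolding open_dist by blast
  from assms[OF e(1)] obtain d where "d \<le> e" "x \<in> star_set E {- d<..<d}" by blast
  moreover have "{- d<..<d} \<subseteq> U" using e(2) \<open>d \<le> e\<close> by (auto simp: dist_real_def)
  ultimately show "x \<in> star_set E U" using star_set_mono by blast
qed

lemma hadd_zero_right [simp]: "x \<oplus>\<^sub>h hyp 0 = x"
  using hadd_zero hadd_commute by metis

lemma near_decompose:
  assumes "near E x r" obtains \<epsilon> where "near E \<epsilon> 0" "x = \<epsilon> \<oplus>\<^sub>h hyp r"
proof
  show "near E (x \<oplus>\<^sub>h hyp (- r)) 0" using near_add[OF assms near_hyp[of "- r"]] by simp
  show "x = x \<oplus>\<^sub>h hyp (- r) \<oplus>\<^sub>h hyp r"
    unfolding hadd_assoc hyp_add[symmetric] by simp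
qed

text \<open>One index n both shrinks the interval and enlarges the bound. The sets of
  counterexamples therefore decrease, and their finite intersections are non-empty as soon as each
  set is.\<close>

lemma internal_bounded_near_zero:
  assumes int: "internal_fun E \<phi>" and nst: "\<And>x. x \<in> nearstandard E \<Longrightarrow> \<phi> x \<in> nearstandard E"
  obtains n where "\<And>x. x \<in> star_set E {- 1 / real (Suc n)<..<1 / real (Suc n)} \<Longrightarrow> \<phi> x \<in> star_set E {- real n<..<real n}"
proof -
  let ?I = "\<lambda>n. star_set E {- (1 / real (Suc n))<..<1 / real (Suc n)}"
  let ?J = "\<lambda>n. star_set E {- real n<..<real n}"
  have "\<exists>n. \<forall>x\<in>?I n. \<phi> x \<in> ?J n"
  proof (rule ccontr)
    assume "\<not> ?thesis"
    then have ne: "\<exists>x. x \<in> ?I n \<and> \<phi> x \<notin> ?J n" for n by blast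
    have "\<exists>A. internal E A \<and> (\<forall>z. elem (target E) z A \<longleftrightarrow>
        (\<exists>x. z = indiv (target E) x \<and> x \<in> ?I n \<and> \<phi> x \<notin> ?J n))" for n
      by (rule internal_preimage[OF int]) blast
    then obtain A where A: "\<And>n. internal E (A n)"
      "\<And>n z. elem (target E) z (A n) \<longleftrightarrow> (\<exists>x. z = indiv (target E) x \<and> x \<in> ?I n \<and> \<phi> x \<notin> ?J n)"
      by metis
    have "?I n \<subseteq> ?I i" "?J i \<subseteq> ?J n" if "i \<le> n" for i n
    proof -
      have "1 / real (Suc n) \<le> 1 / real (Suc i)" using that by (simp add: field_simps)
      then show "?I n \<subseteq> ?I i" by (intro star_set_mono) auto
      show "?J i \<subseteq> ?J n" using that by (intro star_set_mono) auto
    qed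
    then have "\<exists>z. \<forall>i\<le>n. elem (target E) z (A i)" for n
      unfolding A(2) using ne[of n] by blast
    from saturation[of A, OF A(1) this]
    obtain x where x: "\<And>n. x \<in> ?I n" "\<And>n. \<phi> x \<notin> ?J n"
      unfolding A(2) by (metis T.indiv_eq_iff)
    have "near E x 0"
    proof (rule near_zeroI)
      fix e :: real assume "e > 0"
      then obtain n where "1 / real (Suc n) < e"
        using reals_Archimedean[of e] by (auto simp: inverse_eq_divide)
      with x(1)[of n] show "\<exists>d\<le>e. x \<in> star_set E {- d<..<d}"
        by (intro exI[of _ "1 / real (Suc n)"]) auto
    qed
    with nst obtain s where s: "near E (\<phi> x) s" unfolding nearstandard_def by blast
    obtain n where "\<bar>s\<bar> < real n" using reals_Archimedean2 by blast
    with s have "\<phi> x \<in> ?J n" unfolding near_def by (simp add: abs_less_iff)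
    with x(2) show False by blast
  qed
  with that show thesis by auto
qed

lemma internal_additive_standard_part:
  assumes int: "internal_fun E \<phi>" and nst: "\<And>x. x \<in> nearstandard E \<Longrightarrow> \<phi> x \<in> nearstandard E"
    and add: "\<And>x y. \<phi> (x \<oplus>\<^sub>h y) = \<phi> x \<oplus>\<^sub>h \<phi> y"
  obtains c where "\<And>x r. near E x r \<Longrightarrow> near E (\<phi> x) (c * r)"
proof -
  obtain n where n: "\<And>x. x \<in> star_set E {- 1 / real (Suc n)<..<1 / real (Suc n)} \<Longrightarrow> \<phi> x \<in> star_set E {- real n<..<real n}"
    using internal_bounded_near_zero[OF int nst] by blast
  \<comment> \<open>Halving acts on argument and value together: x in the k-th interval forces
    \<phi> x into the k-th bound, because \<open>\<phi> (x \<oplus>\<^sub>h x) = \<phi> x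
    \<oplus>\<^sub>h \<phi> x\<close>. An infinitesimal lies in all of these intervals.\<close>
  let ?I = "\<lambda>k. {- (1 / real (Suc n) / 2 ^ k)<..<1 / real (Suc n) / 2 ^ k}"
  let ?J = "\<lambda>k. {- (real n / 2 ^ k)<..<real n / 2 ^ k}"
  have halve: "x \<in> star_set E (?I k) \<Longrightarrow> \<phi> x \<in> star_set E (?J k)" for x k
  proof (induction k arbitrary: x)
    case 0
    then show ?case using n[of x] by simp
  next
    case (Suc k)
    have "x \<oplus>\<^sub>h x \<in> star_set E (?I k)"
    proof (rule star_set_add[OF _ Suc.prems Suc.prems])
      have half: "1 / real (Suc n) / 2 ^ Suc k = 1 / real (Suc n) / 2 ^ k / 2" by simp
      show "x + y \<in> ?I k" if "x \<in> ?I (Suc k)" "y \<in> ?I (Suc k)" for x y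
        using that unfolding greaterThanLessThan_iff half by linarith
    qed
    then have "\<phi> x \<oplus>\<^sub>h \<phi> x \<in> star_set E (?J k)"
      unfolding add[symmetric] by (rule Suc.IH)
    then show ?case
      by (rule star_set_halve[rotated]) (auto simp: field_simps)
  qed
  have zero: "near E (\<phi> x) 0" if "near E x 0" for x
  proof (rule near_zeroI)
    fix e :: real assume "e > 0"
    then obtain k where "real n / e < 2 ^ k"
      using real_arch_pow[of 2 "real n / e"] by auto
    then have "real n / 2 ^ k \<le> e" using \<open>e > 0\<close> by (simp add: field_simps)
    moreover have "x \<in> star_set E (?I k)"
      using that unfolding near_def by simp
    ultimately show "\<exists>d\<le>e. \<phi> x \<in> star_set E {- d<..<d}"
      using halve by blast
  qed
  \<comment> \<open>Standard points suffice for g: a near-standard point is a standard one plus an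
    infinitesimal, and \<open>zero\<close> disposes of the latter.\<close>
  define g where "g r = st E (\<phi> (hyp r))" for r
  have near_g: "near E (\<phi> (hyp r)) (g r)" for r
  proof -
    have "hyp r \<in> nearstandard E" using near_hyp unfolding nearstandard_def by blast
    then obtain s where "near E (\<phi> (hyp r)) s" using nst unfolding nearstandard_def by blast
    then show ?thesis unfolding g_def by (simp add: st_eq)
  qed
  have "g r = g 1 * r" for r
  proof (rule additive_bounded_imp_linear)
    show "g (x + y) = g x + g y" for x y
      using near_unique[OF near_g] near_add[OF near_g near_g] by (simp add: hyp_add add)
    show "1 / real (Suc n) > 0" by simp
    show "\<bar>g x\<bar> \<le> real n" if "\<bar>x\<bar> < 1 / real (Suc n)" for x
    proof -
      have "hyp x \<in> star_set E (?I 0)" using that by (simp add: abs_less_iff)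
      from near_closure[OF near_g halve[OF this]] have "g x \<in> closure {- real n..real n}"
        by (rule subsetD[OF closure_mono, rotated]) auto
      then show ?thesis by auto
    qed
  qed
  then have g: "near E (\<phi> (hyp r)) (g 1 * r)" for r
    using near_g by metis
  show thesis
  proof (rule that)
    fix x r assume "near E x r"
    then obtain \<epsilon> where "near E \<epsilon> 0" "x = \<epsilon> \<oplus>\<^sub>h hyp r" by (rule near_decompose)
    then show "near E (\<phi> x) (g 1 * r)"
      using near_add[OF zero g] by (simp add: add)
  qed
qed


section \<open>Morphisms of quantum tori\<close>

lemma hyper_coset_eq: "hyper_coset E L x = (\<lambda>l. hyp l \<oplus>\<^sub>h x) ` L"
  by (auto simp: hyper_coset_def r_coset_def hyper_group_def)

lemma hyper_coset_self: "zmodule L \<Longrightarrow> x \<in> hyper_coset E L x"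
  unfolding hyper_coset_eq by (rule image_eqI[of _ _ 0]) (auto simp: zmodule_0)

lemma hyper_coset_shift:
  assumes "zmodule L" "l \<in> L" shows "hyper_coset E L (hyp l \<oplus>\<^sub>h x) = hyper_coset E L x"
proof -
  have sub: "hyper_coset E L (hyp l \<oplus>\<^sub>h x) \<subseteq> hyper_coset E L x" if "l \<in> L" for l x
    unfolding hyper_coset_eq hadd_assoc[symmetric] hyp_add[symmetric]
    using zmodule_add[OF assms(1) _ that] by blast
  have "hyp (- l) \<oplus>\<^sub>h (hyp l \<oplus>\<^sub>h x) = x"
    unfolding hadd_assoc[symmetric] hyp_add[symmetric] by simp
  with sub[of "- l" "hyp l \<oplus>\<^sub>h x"] sub[OF assms(2)] zmodule_uminus[OF assms] show ?thesis
    by auto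
qed

text \<open>Two representatives differ by \<open>hyp l\<close> with l in L, so their standard parts
  differ by l and the description in \<open>torus_proj\<close> is unambiguous.\<close>

lemma torus_proj_hyper_coset:
  assumes "zmodule L" "near E x r"
  shows "torus_proj E L (hyper_coset E L x) = L +>\<^bsub>real_ring\<^esub> r"
  unfolding torus_proj_def
proof (rule the_equality)
  show "\<exists>y\<in>nearstandard E. hyper_coset E L x = hyper_coset E L y \<and> L +>\<^bsub>real_ring\<^esub> r = L +>\<^bsub>real_ring\<^esub> st E y"
    using assms(2) st_eq unfolding nearstandard_def by blast
next
  fix Z assume "\<exists>y\<in>nearstandard E. hyper_coset E L x = hyper_coset E L y \<and> Z = L +>\<^bsub>real_ring\<^esub> st E y"
  then obtain y s where y: "near E y s" "hyper_coset E L x = hyper_coset E L y" "Z = L +>\<^bsub>real_ring\<^esub> s"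
    unfolding nearstandard_def using st_eq by blast
  then obtain l where "l \<in> L" "x = hyp l \<oplus>\<^sub>h y"
    using hyper_coset_self[OF assms(1), of x] unfolding hyper_coset_eq by auto
  then have "r = l + s"
    using near_unique[OF assms(2)] near_add[OF near_hyp y(1)] by blast
  with y(3) \<open>l \<in> L\<close> show "Z = L +>\<^bsub>real_ring\<^esub> r"
    using real_coset_eq_iff[OF assms(1), of r s] by simp
qed

text \<open>A morphism remembers nothing of \<phi> beyond the number c, because
  \<open>torus_proj\<close> forgets infinitesimals.\<close>

theorem torus_hom_iff:
  assumes L: "zmodule L" and M: "zmodule M"
  shows "f \<in> torus_hom E L M \<longleftrightarrow> f \<in> extensional (quantum_torus L) \<and>
    (\<exists>c. (\<forall>l\<in>L. c * l \<in> M) \<and> (\<forall>x. f (L +>\<^bsub>real_ring\<^esub> x) = M +>\<^bsub>real_ring\<^esub> (c * x)))"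
proof
  assume "f \<in> torus_hom E L M"
  then obtain F where f: "f \<in> quantum_torus L \<rightarrow>\<^sub>E quantum_torus M" "F \<in> hyper_torus_hom E L M"
    "\<And>C. C \<in> hyper_torus E L \<Longrightarrow> torus_proj E M (F C) = f (torus_proj E L C)"
    unfolding torus_hom_def by blast
  from f(2) obtain \<phi> where \<phi>: "internal_fun E \<phi>" "\<phi> \<in> hom (hyper_group E) (hyper_group E)"
    "\<phi> ` nearstandard E \<subseteq> nearstandard E"
    "\<forall>r\<in>nearstandard E. \<forall>x\<in>hyper_coset E L r. hyper_coset E M (\<phi> x) = hyper_coset E M (\<phi> r)"
    "\<forall>x\<in>nearstandard E. F (hyper_coset E L x) = hyper_coset E M (\<phi> x)"
    unfolding hyper_torus_hom_def by (elim CollectE conjE exE) (rule that; assumption)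
  have add: "\<phi> (x \<oplus>\<^sub>h y) = \<phi> x \<oplus>\<^sub>h \<phi> y" for x y
    using \<phi>(2) unfolding hom_def hyper_group_def by simp
  obtain c where c: "\<And>x r. near E x r \<Longrightarrow> near E (\<phi> x) (c * r)"
    using internal_additive_standard_part[OF \<phi>(1) _ add] \<phi>(3) by blast
  have "\<phi> (hyp 0) \<oplus>\<^sub>h \<phi> (hyp 0) = \<phi> (hyp 0) \<oplus>\<^sub>h hyp 0"
    using add[of "hyp 0" "hyp 0"] by simp
  then have \<phi>0: "\<phi> (hyp 0) = hyp 0"
    using H.l_cancel[of "\<phi> (hyp 0)" "\<phi> (hyp 0)" "hyp 0"] by (simp add: hyper_group_def)
  have nst: "hyp r \<in> nearstandard E" for r
    using near_hyp unfolding nearstandard_def by blast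
  have "c * l \<in> M" if "l \<in> L" for l
  proof -
    \<comment> \<open>Compatibility at 0 gives more than nearness: \<phi> sends \<open>hyp l\<close>
      exactly to some \<open>hyp m\<close> with m in M. This value is also near c l, so c l =
      m.\<close>
    have "hyp l \<in> hyper_coset E L (hyp 0)"
      unfolding hyper_coset_eq using that by simp
    from \<phi>(4)[rule_format, OF nst this] have "\<phi> (hyp l) \<in> hyper_coset E M (hyp 0)"
      using hyper_coset_self[OF M] \<phi>0 by metis
    then obtain m where "m \<in> M" "\<phi> (hyp l) = hyp m"
      unfolding hyper_coset_eq by auto
    then show ?thesis
      using near_unique[OF c[OF near_hyp] ] near_hyp[of m] by metis
  qed
  moreover have "f (L +>\<^bsub>real_ring\<^esub> x) = M +>\<^bsub>real_ring\<^esub> (c * x)" for x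
    using f(3)[of "hyper_coset E L (hyp x)"] \<phi>(5)[rule_format, OF nst] nst
      torus_proj_hyper_coset[OF L near_hyp] torus_proj_hyper_coset[OF M c[OF near_hyp]]
    unfolding hyper_torus_def by auto
  ultimately show "f \<in> extensional (quantum_torus L) \<and>
    (\<exists>c. (\<forall>l\<in>L. c * l \<in> M) \<and> (\<forall>x. f (L +>\<^bsub>real_ring\<^esub> x) = M +>\<^bsub>real_ring\<^esub> (c * x)))"
    using f(1) by (auto simp: PiE_def)
next
  assume "f \<in> extensional (quantum_torus L) \<and>
    (\<exists>c. (\<forall>l\<in>L. c * l \<in> M) \<and> (\<forall>x. f (L +>\<^bsub>real_ring\<^esub> x) = M +>\<^bsub>real_ring\<^esub> (c * x)))"
  then obtain c where f: "f \<in> extensional (quantum_torus L)" and c: "\<And>l. l \<in> L \<Longrightarrow> c * l \<in> M"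
    and fc: "\<And>x. f (L +>\<^bsub>real_ring\<^esub> x) = M +>\<^bsub>real_ring\<^esub> (c * x)" by blast
  \<comment> \<open>Continuity of multiplication by c makes its extension respect nearness, as
    preimages of neighbourhoods are open.\<close>
  define \<phi> where "\<phi> = star_fun ((*) c)"
  have near: "near E (\<phi> x) (c * r)" if "near E x r" for x r
    unfolding near_def
  proof (intro allI impI)
    fix U :: "real set" assume U: "open U" "c * r \<in> U"
    have "open ((*) c -` U)"
      by (intro open_vimage U continuous_intros)
    then have "x \<in> star_set E ((*) c -` U)"
      using that U unfolding near_def by simp
    then show "\<phi> x \<in> star_set E U"
      unfolding \<phi>_def by (rule star_fun_image[rotated]) simp
  qed
  have add: "\<phi> (x \<oplus>\<^sub>h y) = \<phi> x \<oplus>\<^sub>h \<phi> y" for x y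
    unfolding \<phi>_def by (rule star_fun_additive) (simp add: distrib_left)
  have coset: "hyper_coset E M (\<phi> x) = hyper_coset E M (\<phi> r)" if x: "x \<in> hyper_coset E L r" for x r
  proof -
    obtain l where "l \<in> L" "x = hyp l \<oplus>\<^sub>h r" using x unfolding hyper_coset_eq by auto
    then show ?thesis
      using hyper_coset_shift[OF M c] by (simp add: add) (simp add: \<phi>_def star_fun_hyp)
  qed
  \<comment> \<open>The representative chosen here is immaterial by \<open>coset\<close>.\<close>
  define F where "F = (\<lambda>C\<in>hyper_torus E L. hyper_coset E M (\<phi> (SOME x. x \<in> nearstandard E \<and> C = hyper_coset E L x)))"
  have F: "F (hyper_coset E L x) = hyper_coset E M (\<phi> x)" if "x \<in> nearstandard E" for x
  proof -
    define y where "y = (SOME y. y \<in> nearstandard E \<and> hyper_coset E L x = hyper_coset E L y)"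
    have "y \<in> nearstandard E \<and> hyper_coset E L x = hyper_coset E L y"
      unfolding y_def by (rule someI[of _ x]) (use that in simp)
    then have "x \<in> hyper_coset E L y" using hyper_coset_self[OF L] by metis
    from coset[OF this] show ?thesis
      using that unfolding F_def hyper_torus_def y_def by simp
  qed
  have "F \<in> hyper_torus_hom E L M"
    unfolding hyper_torus_hom_def
  proof (intro CollectI conjI exI[of _ \<phi>])
    show "F \<in> extensional (hyper_torus E L)" by (simp add: F_def)
    show "internal_fun E \<phi>" unfolding \<phi>_def by (rule internal_star_fun)
    show "\<phi> \<in> hom (hyper_group E) (hyper_group E)"
      by (simp add: hom_def hyper_group_def add)
    show "\<phi> ` nearstandard E \<subseteq> nearstandard E"
      using near unfolding nearstandard_def by blast
  qed (use coset F in auto)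
  moreover have "torus_proj E M (F C) = f (torus_proj E L C)" if C: "C \<in> hyper_torus E L" for C
  proof -
    obtain x r where x: "near E x r" "C = hyper_coset E L x"
      using C unfolding hyper_torus_def nearstandard_def by blast
    then have "x \<in> nearstandard E" unfolding nearstandard_def by blast
    then show ?thesis
      using x torus_proj_hyper_coset[OF L x(1)] torus_proj_hyper_coset[OF M near[OF x(1)]] F fc by simp
  qed
  moreover have "f \<in> quantum_torus L \<rightarrow>\<^sub>E quantum_torus M"
    using f fc unfolding quantum_torus_eq by (auto simp: PiE_def)
  ultimately show "f \<in> torus_hom E L M"
    unfolding torus_hom_def by blast
qed

end


section \<open>Products of subgroups\<close>

definition scale :: "real \<Rightarrow> real set \<Rightarrow> real set" where
  "scale c A = (*) c ` A"

abbreviation mod_prod :: "real set \<Rightarrow> real set \<Rightarrow> real set" where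
  "mod_prod \<equiv> ideal_prod real_ring"

lemma mod_prod_mult: "x \<in> A \<Longrightarrow> y \<in> B \<Longrightarrow> x * y \<in> mod_prod A B"
  using ideal_prod.prod[of x A y B real_ring] by (simp add: ring_of_type_algebra_def)

lemma mod_prod_add: "x \<in> mod_prod A B \<Longrightarrow> y \<in> mod_prod A B \<Longrightarrow> x + y \<in> mod_prod A B"
  using ideal_prod.sum[of x real_ring A B y] by (simp add: ring_of_type_algebra_def)

lemma mod_prod_induct [consumes 1, case_names mult add]:
  assumes "x \<in> mod_prod A B"
    and "\<And>a b. a \<in> A \<Longrightarrow> b \<in> B \<Longrightarrow> P (a * b)"
    and "\<And>s t. P s \<Longrightarrow> P t \<Longrightarrow> P (s + t)"
  shows "P x"
  using assms(1) by induction (auto simp: ring_of_type_algebra_def intro: assms(2,3))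

lemma mod_prod_least:
  assumes "zmodule C" "\<And>x y. x \<in> A \<Longrightarrow> y \<in> B \<Longrightarrow> x * y \<in> C"
  shows "mod_prod A B \<subseteq> C"
proof
  fix x assume "x \<in> mod_prod A B"
  then show "x \<in> C" by (induction rule: mod_prod_induct) (auto intro: assms zmodule_add)
qed

text \<open>\<open>ideal_prod\<close> is generated by sums only; negatives arise by moving the sign
  into the left factor.\<close>

lemma zmodule_mod_prod:
  assumes "zmodule A" "zmodule B" shows "zmodule (mod_prod A B)"
proof -
  have neg: "- x \<in> mod_prod A B" if "x \<in> mod_prod A B" for x
    using that
  proof (induction rule: mod_prod_induct)
    case (mult a b)
    then show ?case using mod_prod_mult[of "- a" A b B] zmodule_uminus[OF assms(1)] by simp
  next
    case (add s t)
    then show ?case using mod_prod_add[of "- s" A B "- t"] by simp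
  qed
  have "0 \<in> mod_prod A B"
    using mod_prod_mult[of 0 A 0 B] assms zmodule_0 by simp
  then show ?thesis
    unfolding zmodule_def using neg mod_prod_add[of _ A B "- y" for y] by force
qed

lemma mod_prod_commute: "mod_prod A B = mod_prod B A"
proof -
  have "mod_prod A B \<subseteq> mod_prod B A" for A B
  proof
    fix x assume "x \<in> mod_prod A B"
    then show "x \<in> mod_prod B A"
      by (induction rule: mod_prod_induct) (metis mult.commute mod_prod_mult, rule mod_prod_add)
  qed
  then show ?thesis by blast
qed

text \<open>One inclusion for all triples suffices: commutativity turns the other into the same
  inclusion for the triple C, B, A.\<close>

lemma mod_prod_assoc:
  assumes "zmodule A" "zmodule B" "zmodule C"
  shows "mod_prod (mod_prod A B) C = mod_prod A (mod_prod B C)"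
proof -
  have le: "mod_prod (mod_prod A B) C \<subseteq> mod_prod A (mod_prod B C)"
    if "zmodule A" "zmodule B" "zmodule C" for A B C
  proof (rule mod_prod_least)
    show "zmodule (mod_prod A (mod_prod B C))" using that by (intro zmodule_mod_prod)
    fix s c assume "s \<in> mod_prod A B" "c \<in> C"
    then show "s * c \<in> mod_prod A (mod_prod B C)"
      by (induction rule: mod_prod_induct)
        (auto simp: mult.assoc distrib_right intro: mod_prod_mult mod_prod_add)
  qed
  have "mod_prod A (mod_prod B C) = mod_prod (mod_prod C B) A"
    by (metis mod_prod_commute)
  also have "\<dots> \<subseteq> mod_prod C (mod_prod B A)" using assms by (intro le)
  also have "\<dots> = mod_prod (mod_prod A B) C" by (metis mod_prod_commute)
  finally show ?thesis using le[OF assms] by blast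
qed

lemma zmodule_scale: "zmodule A \<Longrightarrow> zmodule (scale c A)"
  unfolding zmodule_def scale_def by (auto simp: right_diff_distrib[symmetric])

lemma scale_scale [simp]: "scale c (scale d A) = scale (c * d) A"
  unfolding scale_def by (simp add: image_image mult.assoc)

lemma scale_1 [simp]: "scale 1 A = A"
  unfolding scale_def by simp

text \<open>The scalar may be any real. Products of an ideal with a homothetic copy of another ideal
  thereby reduce to products of ideals.\<close>

lemma mod_prod_scale:
  assumes "zmodule A" "zmodule B"
  shows "mod_prod (scale c A) B = scale c (mod_prod A B)"
proof
  show "mod_prod (scale c A) B \<subseteq> scale c (mod_prod A B)"
  proof (rule mod_prod_least)
    show "zmodule (scale c (mod_prod A B))" using assms by (intro zmodule_scale zmodule_mod_prod)
    show "x * y \<in> scale c (mod_prod A B)" if "x \<in> scale c A" "y \<in> B" for x y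
      using that unfolding scale_def by (force simp: mult.assoc intro: mod_prod_mult)
  qed
  have "c * x \<in> mod_prod (scale c A) B" if "x \<in> mod_prod A B" for x
    using that
  proof (induction rule: mod_prod_induct)
    case (mult a b)
    then have "c * a \<in> scale c A" unfolding scale_def by (intro imageI)
    from mod_prod_mult[OF this mult(2)] show ?case by (simp add: mult.assoc)
  next
    case (add s t)
    then show ?case by (simp add: distrib_left mod_prod_add)
  qed
  then show "scale c (mod_prod A B) \<subseteq> mod_prod (scale c A) B"
    unfolding scale_def by blast
qed


section \<open>Lattices of rank two\<close>

definition lattice2 :: "real \<Rightarrow> real \<Rightarrow> real set" where
  "lattice2 a b = {of_int m * a + of_int n * b | m n. True}"

lemma lattice2I: "of_int m * a + of_int n * b \<in> lattice2 a b"
  unfolding lattice2_def by blast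

lemma lattice2E:
  assumes "x \<in> lattice2 a b" obtains m n where "x = of_int m * a + of_int n * b"
  using assms unfolding lattice2_def by blast

lemma lattice2_basis [simp]: "a \<in> lattice2 a b" "b \<in> lattice2 a b"
  using lattice2I[of 1 a 0 b] lattice2I[of 0 a 1 b] by simp_all

lemma zmodule_lattice2 [simp]: "zmodule (lattice2 a b)"
  unfolding zmodule_def
proof (intro conjI ballI)
  show "0 \<in> lattice2 a b" using lattice2I[of 0 a 0 b] by simp
  fix x y assume "x \<in> lattice2 a b" "y \<in> lattice2 a b"
  then obtain m n m' n' where "x = of_int m * a + of_int n * b" "y = of_int m' * a + of_int n' * b"
    by (metis lattice2E)
  then have "x - y = of_int (m - m') * a + of_int (n - n') * b" by (simp add: algebra_simps)
  then show "x - y \<in> lattice2 a b" by (metis lattice2I)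
qed

lemma lattice2_least:
  assumes "zmodule C" "a \<in> C" "b \<in> C" shows "lattice2 a b \<subseteq> C"
  using assms unfolding lattice2_def by (auto intro!: zmodule_add zmodule_of_int_mult)

lemma scale_lattice2: "scale c (lattice2 a b) = lattice2 (c * a) (c * b)"
proof
  show "scale c (lattice2 a b) \<subseteq> lattice2 (c * a) (c * b)"
  proof
    fix x assume "x \<in> scale c (lattice2 a b)"
    then obtain m n where "x = c * (of_int m * a + of_int n * b)"
      unfolding scale_def lattice2_def by blast
    then have "x = of_int m * (c * a) + of_int n * (c * b)" by (simp add: algebra_simps)
    then show "x \<in> lattice2 (c * a) (c * b)" by (metis lattice2I)
  qed
  show "lattice2 (c * a) (c * b) \<subseteq> scale c (lattice2 a b)"
    by (rule lattice2_least) (auto simp: zmodule_scale, auto simp: scale_def)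
qed

section \<open>Bases of sublattices and density in rank two\<close>

lemma int_subgroup_cyclic:
  fixes S :: "int set"
  assumes "0 \<in> S" and diff: "\<And>x y. x \<in> S \<Longrightarrow> y \<in> S \<Longrightarrow> x - y \<in> S"
  obtains g where "S = range ((*) g)"
proof -
  have neg: "- x \<in> S" if "x \<in> S" for x using diff[OF assms(1) that] by simp
  have add: "x + y \<in> S" if "x \<in> S" "y \<in> S" for x y using diff[OF that(1) neg[OF that(2)]] by simp
  have natmult: "int n * x \<in> S" if "x \<in> S" for n x
    by (induction n) (auto simp: distrib_right assms(1) that intro: add)
  have mult: "x * k \<in> S" if "x \<in> S" for x k
    using natmult[OF that, of "nat \<bar>k\<bar>"] neg[of "int (nat \<bar>k\<bar>) * x"]
    by (cases "k \<ge> 0") (auto simp: mult.commute)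
  show thesis
  proof (cases "\<exists>n. n > 0 \<and> int n \<in> S")
    case False
    have "x = 0" if "x \<in> S" for x
    proof (rule ccontr)
      assume "x \<noteq> 0"
      moreover have "int (nat \<bar>x\<bar>) \<in> S" using that neg[OF that] by (simp add: abs_if)
      ultimately show False using False by (metis nat_0_iff abs_le_zero_iff not_gr_zero)
    qed
    then have "S = range ((*) 0)" using assms(1) by auto
    then show thesis by (rule that)
  next
    case True
    define g where "g = (LEAST n. n > 0 \<and> int n \<in> S)"
    have g: "g > 0" "int g \<in> S" using LeastI_ex[OF True] unfolding g_def by auto
    have "S = range ((*) (int g))"
    proof
      show "range ((*) (int g)) \<subseteq> S" using mult[OF g(2)] by auto
      show "S \<subseteq> range ((*) (int g))"
      proof
        fix x assume "x \<in> S"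
        define r where "r = x mod int g"
        have "r = x - int g * (x div int g)" unfolding r_def by (simp add: minus_mult_div_eq_mod)
        then have "r \<in> S" using diff[OF \<open>x \<in> S\<close> mult[OF g(2)]] by simp
        moreover have r: "0 \<le> r" "r < int g" unfolding r_def using g(1) by auto
        ultimately have "\<not> nat r > 0"
          using not_less_Least[of "nat r" "\<lambda>n. n > 0 \<and> int n \<in> S", folded g_def] by auto
        with r have "r = 0" by simp
        then show "x \<in> range ((*) (int g))"
          unfolding r_def by (metis mod_0_imp_dvd dvdE rangeI)
      qed
    qed
    then show thesis by (rule that)
  qed
qed

lemma lattice2_coords_unique:
  assumes "a \<noteq> 0" "b / a \<notin> \<rat>" "of_int m * a + of_int n * b = of_int m' * a + of_int n' * b"
  shows "m = m' \<and> n = n'"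
proof -
  have eq: "of_int (n - n') * (b / a) = of_int (m' - m)"
    using assms(1,3) by (simp add: field_simps)
  have "n = n'"
  proof (rule ccontr)
    assume "n \<noteq> n'"
    with eq have "b / a = of_int (m' - m) / of_int (n - n')" by (simp add: field_simps)
    with assms(2) show False by (metis Rats_divide Rats_of_int)
  qed
  with eq show ?thesis by simp
qed

text \<open>A triangular basis: S holds the coefficients of b that occur in H, T those of the
  multiples of a in H, and both are cyclic. An element of H above the generator of S spans H
  together with the multiple of a given by the generator of T; h and k guarantee rank two.\<close>

lemma sublattice_is_lattice2:
  assumes H: "zmodule H" "H \<subseteq> lattice2 a b" "h \<in> H" "k \<in> H" "h \<noteq> 0" "k / h \<notin> \<rat>"
  obtains c d where "c \<noteq> 0" "d / c \<notin> \<rat>" "H = lattice2 c d"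
proof -
  define S where "S = {n. \<exists>m. of_int m * a + of_int n * b \<in> H}"
  define T where "T = {m. of_int m * a \<in> H}"
  obtain g where g: "S = range ((*) g)"
  proof (rule int_subgroup_cyclic[of S])
    show "0 \<in> S" unfolding S_def using zmodule_0[OF H(1)] by (auto intro: exI[of _ 0])
    fix x y assume "x \<in> S" "y \<in> S"
    then obtain m m' where "of_int m * a + of_int x * b \<in> H" "of_int m' * a + of_int y * b \<in> H"
      unfolding S_def by blast
    from zmodule_diff[OF H(1) this] have "of_int (m - m') * a + of_int (x - y) * b \<in> H"
      by (simp add: algebra_simps)
    then show "x - y \<in> S" unfolding S_def by blast
  qed
  obtain t where t: "T = range ((*) t)"
  proof (rule int_subgroup_cyclic[of T])
    show "0 \<in> T" unfolding T_def using zmodule_0[OF H(1)] by simp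
    fix x y assume "x \<in> T" "y \<in> T"
    then show "x - y \<in> T" unfolding T_def using zmodule_diff[OF H(1)] by (simp add: left_diff_distrib)
  qed
  have "g \<in> S" unfolding g using rangeI[of "(*) g" 1] by simp
  then obtain m0 where d: "of_int m0 * a + of_int g * b \<in> H" unfolding S_def by blast
  define c where "c = of_int t * a"
  define d where "d = of_int m0 * a + of_int g * b"
  have "t \<in> T" unfolding t using rangeI[of "(*) t" 1] by simp
  then have c: "c \<in> H" unfolding T_def c_def by simp
  have Heq: "H = lattice2 c d"
  proof
    show "lattice2 c d \<subseteq> H" using H(1) c d unfolding d_def by (intro lattice2_least)
    show "H \<subseteq> lattice2 c d"
    proof
      fix x assume x: "x \<in> H"
      then obtain m n where mn: "x = of_int m * a + of_int n * b" using H(2) by (blast elim: lattice2E)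
      with x have "n \<in> S" unfolding S_def by blast
      then obtain j where j: "n = g * j" unfolding g by blast
      have "x - of_int j * d \<in> H"
        using zmodule_diff[OF H(1) x zmodule_of_int_mult[OF H(1)]] d unfolding d_def by blast
      moreover have xj: "x - of_int j * d = of_int (m - j * m0) * a"
        unfolding mn j d_def by (simp add: algebra_simps)
      ultimately have "m - j * m0 \<in> T" unfolding T_def by simp
      then obtain i where "m - j * m0 = t * i" unfolding t by blast
      with xj have "x = of_int i * c + of_int j * d" unfolding c_def by (simp add: algebra_simps)
      then show "x \<in> lattice2 c d" by (metis lattice2I)
    qed
  qed
  \<comment> \<open>The form in which h and k enter: H lies on no rational line, whereas c = 0 or a
    rational ratio d / c would place it on one.\<close>
  have no: "\<not> (\<exists>e. \<forall>x\<in>H. \<exists>q\<in>\<rat>. x = q * e)"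
  proof
    assume "\<exists>e. \<forall>x\<in>H. \<exists>q\<in>\<rat>. x = q * e"
    then obtain e p q where "h = p * e" "k = q * e" "p \<in> \<rat>" "q \<in> \<rat>" using H(3,4) by metis
    then have "k / h = q / p" using H(5) by simp
    with \<open>p \<in> \<rat>\<close> \<open>q \<in> \<rat>\<close> H(6) show False by simp
  qed
  have "c \<noteq> 0"
  proof
    assume "c = 0"
    then have "\<forall>x\<in>H. \<exists>q\<in>\<rat>. x = q * d"
      unfolding Heq by (auto elim!: lattice2E)
    with no show False by blast
  qed
  moreover have "d / c \<notin> \<rat>"
  proof
    assume q: "d / c \<in> \<rat>"
    have "\<exists>q\<in>\<rat>. x = q * c" if xH: "x \<in> H" for x
    proof -
      obtain i j where x: "x = of_int i * c + of_int j * d" using xH[unfolded Heq] by (rule lattice2E)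
      have "x = (of_int i + of_int j * (d / c)) * c"
        unfolding x distrib_right using \<open>c \<noteq> 0\<close> by simp
      moreover have "of_int i + of_int j * (d / c) \<in> \<rat>" using q by (intro Rats_add Rats_mult Rats_of_int)
      ultimately show ?thesis by blast
    qed
    with no show False by blast
  qed
  ultimately show thesis using Heq by (rule that)
qed

text \<open>Dirichlet approximation to b / a produces non-zero lattice elements of arbitrarily small
  size, and the multiples of one of them come close to every real.\<close>

lemma lattice2_dense:
  assumes "a \<noteq> 0" "b / a \<notin> \<rat>" shows "closure (lattice2 a b) = UNIV"
proof -
  have small: "\<exists>x\<in>lattice2 a b. 0 < x \<and> x < e" if e: "e > 0" for e
  proof -
    \<comment> \<open>Dirichlet bounds the error at b / a by 1 / N; after multiplication by a it has
      to fall below e.\<close>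
    obtain N :: nat where N: "\<bar>a\<bar> / e < N" using reals_Archimedean2 by blast
    with e assms(1) have "N > 0" by (metis divide_pos_pos less_trans of_nat_0_less_iff zero_less_abs_iff)
    obtain h k where hk: "0 < k" "\<bar>of_int k * (b / a) - of_int h\<bar> < 1 / N"
      using Dirichlet_approx[OF \<open>N > 0\<close>] by blast
    define x where "x = of_int (- h) * a + of_int k * b"
    have x: "x = a * (of_int k * (b / a) - of_int h)" unfolding x_def using assms(1) by (simp add: field_simps)
    have "x \<noteq> 0"
      using lattice2_coords_unique[OF assms, of "- h" k 0 0] hk(1) unfolding x_def by auto
    have "\<bar>x\<bar> < \<bar>a\<bar> * (1 / N)"
      unfolding x abs_mult using hk(2) assms(1) by (intro mult_strict_left_mono) auto
    also have "\<bar>a\<bar> * (1 / N) < e" using N e \<open>N > 0\<close> by (simp add: field_simps)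
    finally have "\<bar>x\<bar> < e" .
    moreover have "\<bar>x\<bar> \<in> lattice2 a b"
      using lattice2I[of "- h" a k b] zmodule_uminus[OF zmodule_lattice2]
      unfolding x_def[symmetric] by (auto simp: abs_if)
    ultimately show ?thesis using \<open>x \<noteq> 0\<close> by (intro bexI[of _ "\<bar>x\<bar>"]) auto
  qed
  have "y \<in> closure (lattice2 a b)" for y
    unfolding closure_approachable
  proof (intro allI impI)
    fix e :: real assume "e > 0"
    then obtain x where x: "x \<in> lattice2 a b" "0 < x" "x < e" using small by blast
    define n where "n = \<lfloor>y / x\<rfloor>"
    have "of_int n \<le> y / x" "y / x < of_int n + 1" unfolding n_def by linarith+
    then have "of_int n * x \<le> y" "y < of_int n * x + x" using x(2) by (simp_all add: field_simps)
    then have "dist (of_int n * x) y < e" using x(3) unfolding dist_real_def by linarith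
    moreover have "of_int n * x \<in> lattice2 a b" using x(1) by (intro zmodule_of_int_mult) auto
    ultimately show "\<exists>z\<in>lattice2 a b. dist z y < e" by blast
  qed
  then show ?thesis by blast
qed

text \<open>Independence of the basis over the integers is irrationality of the ratio, by clearing
  denominators; \<open>lattice2_dense\<close> supplies the closure condition.\<close>

lemma pseudolattice_iff: "pseudolattice L \<longleftrightarrow> (\<exists>a b. a \<noteq> 0 \<and> b / a \<notin> \<rat> \<and> L = lattice2 a b)"
proof
  assume "pseudolattice L"
  then obtain a b where ab: "\<And>m n :: int. of_int m * a + of_int n * b = 0 \<Longrightarrow> m = 0 \<and> n = 0"
    "L = lattice2 a b"
    unfolding pseudolattice_def lattice2_def by blast
  have "a \<noteq> 0" using ab(1)[of 1 0] by auto
  moreover have "b / a \<notin> \<rat>"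
  proof
    assume "b / a \<in> \<rat>"
    then obtain p q :: int where "q > 0" "b / a = of_int p / of_int q" by (auto elim: Rats_cases')
    then have "of_int (- p) * a + of_int q * b = 0" using \<open>a \<noteq> 0\<close> by (simp add: field_simps)
    from ab(1)[OF this] \<open>q > 0\<close> show False by simp
  qed
  ultimately show "\<exists>a b. a \<noteq> 0 \<and> b / a \<notin> \<rat> \<and> L = lattice2 a b" using ab(2) by blast
next
  assume "\<exists>a b. a \<noteq> 0 \<and> b / a \<notin> \<rat> \<and> L = lattice2 a b"
  then obtain a b where ab: "a \<noteq> 0" "b / a \<notin> \<rat>" "L = lattice2 a b" by blast
  have "m = 0 \<and> n = 0" if "of_int m * a + of_int n * b = 0" for m n :: int
    using lattice2_coords_unique[OF ab(1,2), of m n 0 0] that by simp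
  then show "pseudolattice L"
    unfolding pseudolattice_def using lattice2_dense[OF ab(1,2)] ab(3) unfolding lattice2_def by blast
qed

lemma zmodule_pseudolattice: "pseudolattice L \<Longrightarrow> zmodule L"
  unfolding pseudolattice_iff by auto

lemma pseudolattice_scale: "pseudolattice L \<Longrightarrow> c \<noteq> 0 \<Longrightarrow> pseudolattice (scale c L)"
  unfolding pseudolattice_iff
proof (elim exE conjE)
  fix a b assume "a \<noteq> 0" "b / a \<notin> \<rat>" "L = lattice2 a b" "c \<noteq> 0"
  then show "\<exists>a b. a \<noteq> 0 \<and> b / a \<notin> \<rat> \<and> scale c L = lattice2 a b"
    by (intro exI[of _ "c * a"] exI[of _ "c * b"]) (simp add: scale_lattice2)
qed


section \<open>Quadratic algebraic integers\<close>

lemma rational_linear_unique: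
  assumes "x \<notin> \<rat>" "p \<in> \<rat>" "q \<in> \<rat>" "p' \<in> \<rat>" "q' \<in> \<rat>" "p + q * x = p' + q' * (x :: real)"
  shows "p = p' \<and> q = q'"
proof -
  have "q = q'"
  proof (rule ccontr)
    assume "q \<noteq> q'"
    then have "x = (p' - p) / (q - q')" using assms(6) by (simp add: field_simps)
    with assms show False by simp
  qed
  with assms(6) show ?thesis by simp
qed

text \<open>t and n play the roles of trace and norm. The equation is multiplied by the denominators
  and divided by the gcd of its coefficients; keeping t and n as quotients by a lets their
  integrality be read off once a is known to be a unit.\<close>

lemma primitive_quadratic:
  assumes "t \<in> \<rat>" "n \<in> \<rat>" "x ^ 2 = t * x - (n :: real)"
  obtains a b c :: int where "a \<noteq> 0" "gcd a (gcd b c) = 1"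
    "of_int a * x ^ 2 + of_int b * x + of_int c = 0" "t = - of_int b / of_int a" "n = of_int c / of_int a"
proof -
  obtain p q where t: "q > 0" "t = of_int p / of_int q" using assms(1) by (auto elim: Rats_cases')
  obtain r s where n: "s > 0" "n = of_int r / of_int s" using assms(2) by (auto elim: Rats_cases')
  define A B C where "A = q * s" and "B = - (p * s)" and "C = r * q"
  define g where "g = gcd A (gcd B C)"
  have "A \<noteq> 0" unfolding A_def using t n by simp
  then have "g \<noteq> 0" unfolding g_def by simp
  moreover have "g \<ge> 0" unfolding g_def by simp
  ultimately have "g > 0" by simp
  obtain a b c where abc: "A = g * a" "B = g * b" "C = g * c"
    unfolding g_def by (metis dvdE gcd_dvd1 gcd_dvd2 dvd_trans)
  show thesis
  proof (rule that)
    show "a \<noteq> 0" using abc(1) \<open>A \<noteq> 0\<close> by auto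
    have "g = gcd (g * a) (gcd (g * b) (g * c))" using g_def abc by simp
    also have "\<dots> = g * gcd a (gcd b c)"
      using \<open>g > 0\<close> by (simp add: gcd_mult_left abs_mult)
    finally show "gcd a (gcd b c) = 1" using \<open>g > 0\<close> by simp
    show t': "t = - of_int b / of_int a"
    proof -
      have "t = - of_int B / of_int A" unfolding t A_def B_def using t n by (simp add: field_simps)
      then show ?thesis unfolding abc using \<open>g \<noteq> 0\<close> by simp
    qed
    show n': "n = of_int c / of_int a"
    proof -
      have "n = of_int C / of_int A" unfolding n A_def C_def using t n by (simp add: field_simps)
      then show ?thesis unfolding abc using \<open>g \<noteq> 0\<close> by simp
    qed
    show "of_int a * x ^ 2 + of_int b * x + of_int c = 0"
      unfolding assms(3) t' n' using \<open>a \<noteq> 0\<close> by (simp add: field_simps)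
  qed
qed

lemma primitive_bezout:
  assumes "gcd a (gcd b c) = (1 :: int)" obtains x y z where "a * x + b * y + c * z = 1"
proof -
  obtain u v where uv: "u * a + v * gcd b c = 1" using bezout_int[of a "gcd b c"] assms by auto
  obtain y z where yz: "y * b + z * c = gcd b c" using bezout_int by blast
  have "a * u + b * (v * y) + c * (v * z) = 1"
    using uv unfolding yz[symmetric] by (simp add: algebra_simps)
  then show thesis by (rule that)
qed

lemma poly_map_poly_of_int:
  fixes x :: real
  shows "poly (map_poly of_int (p + q)) x = poly (map_poly of_int p) x + poly (map_poly of_int q) x"
    and "poly (map_poly of_int (smult c p)) x = of_int c * poly (map_poly of_int p) x"
    and "poly (map_poly of_int (p * q)) x = poly (map_poly of_int p) x * poly (map_poly of_int q) x"
proof -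
  show add: "poly (map_poly of_int (p + q)) x = poly (map_poly of_int p) x + poly (map_poly of_int q) x" for p q
    by (induction p q rule: poly_induct2) (simp_all add: map_poly_pCons algebra_simps)
  show smult: "poly (map_poly of_int (smult c p)) x = of_int c * poly (map_poly of_int p) x" for c p
    by (induction p) (simp_all add: map_poly_pCons algebra_simps)
  show "poly (map_poly of_int (p * q)) x = poly (map_poly of_int p) x * poly (map_poly of_int q) x"
    by (induction p) (simp_all add: map_poly_pCons add smult algebra_simps)
qed

text \<open>Gauss' lemma: the primitive quadratic divides a multiple of the monic polynomial, hence the
  monic polynomial itself.\<close>

lemma quadratic_algebraic_int_leading:
  fixes x :: real
  assumes "algebraic_int x" "x \<notin> \<rat>" "a \<noteq> 0" "gcd a (gcd b c) = 1"
    "of_int a * x ^ 2 + of_int b * x + of_int c = 0"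
  shows "\<bar>a\<bar> = (1 :: int)"
proof -
  obtain P :: "int poly" where P: "poly (map_poly of_int P) x = 0" "lead_coeff P = 1"
    using assms(1) unfolding algebraic_int_altdef_ipoly by blast
  define G where "G = [:c, b, a:]"
  have G: "G \<noteq> 0" "degree G = 2" "lead_coeff G = a" unfolding G_def using assms(3) by auto
  have rootG: "poly (map_poly of_int G) x = 0"
    using assms(5) unfolding G_def by (simp add: map_poly_pCons power2_eq_square algebra_simps)
  have "Polynomial.content G = gcd c (gcd b a)"
    using assms(3) unfolding G_def Polynomial.content_def by (simp add: cCons_def)
  also have "\<dots> = 1" using assms(4) by (simp add: gcd.commute gcd.left_commute)
  finally have cG: "Polynomial.content G = 1" .
  \<comment> \<open>Pseudo-division stays within integer polynomials at the price of the factor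
    \<open>a ^ k\<close>. The remainder has degree below 2 and vanishes at the irrational x, so it
    is 0.\<close>
  obtain Q R where QR: "pseudo_divmod P G = (Q, R)" by fastforce
  define k where "k = Suc (degree P) - degree G"
  have eq: "smult (a ^ k) P = G * Q + R"
    using pseudo_divmod(1)[OF G(1) QR] unfolding k_def G(3) by simp
  have degR: "R = 0 \<or> degree R < 2" using pseudo_divmod(2)[OF G(1) QR] G(2) by simp
  have "poly (map_poly real_of_int R) x = 0"
    using arg_cong[OF eq, of "\<lambda>U. poly (map_poly real_of_int U) x"] P(1) rootG
    by (simp add: poly_map_poly_of_int)
  moreover obtain r0 r1 where R: "R = [:r0, r1:]"
  proof (rule that)
    show "R = [:coeff R 0, coeff R 1:]"
      using degR by (intro poly_eqI) (auto simp: coeff_pCons split: nat.splits intro!: coeff_eq_0)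
  qed
  ultimately have "of_int r0 + of_int r1 * x = 0 + 0 * x" by (simp add: map_poly_pCons mult.commute)
  from rational_linear_unique[OF assms(2) _ _ _ _ this] have "R = 0" unfolding R by simp
  with eq have eq: "smult (a ^ k) P = G * Q" by simp
  \<comment> \<open>Comparing contents shows that \<open>a ^ k\<close> divides all coefficients of
    Q; cancelling it leaves a factorisation of P itself.\<close>
  have "Polynomial.content P = 1"
    using content_dvd_coeff[of P "degree P"] P(2) by (metis is_unit_content_iff)
  then have "\<bar>a ^ k\<bar> = Polynomial.content Q"
    using arg_cong[OF eq, of Polynomial.content] cG by (simp add: content_mult)
  then have "a ^ k dvd Polynomial.content Q" by (metis abs_dvd_iff dvd_refl dvd_abs_iff)
  then obtain Q' where Q': "Q = smult (a ^ k) Q'"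
    unfolding const_poly_dvd_iff_dvd_content[symmetric] by (auto elim!: dvdE)
  have "smult (a ^ k) P = smult (a ^ k) (G * Q')" using eq Q' by simp
  then have "P = G * Q'" using assms(3) smult_cancel[of "a ^ k"] by simp
  then have "1 = a * lead_coeff Q'" using P(2) G(3) by (metis lead_coeff_mult)
  then show ?thesis using zmult_eq_1_iff by (metis abs_1 abs_minus_cancel)
qed


section \<open>Real quadratic fields\<close>

text \<open>D may have square factors, so the integers are not given by the familiar congruences
  modulo 4; they are characterised by trace and norm instead.\<close>

locale quadratic_field =
  fixes F :: "real set" and D :: int and \<delta> :: real
  assumes delta_sq: "\<delta> ^ 2 = of_int D" and delta_irrational: "\<delta> \<notin> \<rat>"
    and F_eq: "F = {u + v * \<delta> | u v. u \<in> \<rat> \<and> v \<in> \<rat>}"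

text \<open>Dimension two gives a basis v1, v2 that need not contain 1. If v1 is rational, then v2
  generates; otherwise the expression of 1 in the basis is solved for v2, and v1 generates.\<close>

lemma real_quadratic_field_generator:
  assumes "real_quadratic_field F"
  obtains \<theta> where "\<theta> \<notin> \<rat>" "\<theta> ^ 2 \<in> F" "F = {u + v * \<theta> | u v. u \<in> \<rat> \<and> v \<in> \<rat>}"
proof -
  interpret R: Ring.field real_ring by (rule field_from_type_algebra)
  have sub: "subring F real_ring" and dim: "R.dimension 2 \<rat> F"
    using assms subfieldE(1) unfolding real_quadratic_field_def by auto
  have one: "1 \<in> F" using subringE(3)[OF sub] by (simp add: ring_of_type_algebra_def)
  have sq: "x ^ 2 \<in> F" if "x \<in> F" for x
    using subringE(6)[OF sub that that] by (simp add: ring_of_type_algebra_def power2_eq_square)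
  have ext: "R.line_extension \<rat> v E = {q * v + e | q e. q \<in> \<rat> \<and> e \<in> E}" for v E
    unfolding R.line_extension_def
    by (auto simp: set_add_def set_mult_def r_coset_def ring_of_type_algebra_def; blast)
  obtain v1 E1 where E1: "v1 \<notin> E1" "R.dimension 1 \<rat> E1" "F = {q * v1 + e | q e. q \<in> \<rat> \<and> e \<in> E1}"
    using dim by (cases rule: R.dimension.cases) (auto simp: ext numeral_2_eq_2)
  obtain v2 E0 where v2': "v2 \<notin> E0" "R.dimension 0 \<rat> E0" "E1 = {q * v2 + e | q e. q \<in> \<rat> \<and> e \<in> E0}"
    using E1(2) by (cases rule: R.dimension.cases) (auto simp: ext)
  have "E0 = {\<zero>\<^bsub>real_ring\<^esub>}" using v2'(2) by (cases rule: R.dimension.cases) auto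
  then have "E0 = {0}" by (simp add: ring_of_type_algebra_def)
  with v2' have v2: "v2 \<noteq> 0" "E1 = {q * v2 | q. q \<in> \<rat>}" by auto
  have F: "F = {x * v1 + y * v2 | x y. x \<in> \<rat> \<and> y \<in> \<rat>}"
    unfolding E1(3) v2(2) by blast
  show thesis
  proof (cases "v1 \<in> \<rat>")
    case True
    have "v1 \<noteq> 0" using E1(1) unfolding v2(2) by (auto intro: exI[of _ 0])
    have irr: "v2 \<notin> \<rat>"
    proof
      assume "v2 \<in> \<rat>"
      then have "v1 = v1 / v2 * v2" "v1 / v2 \<in> \<rat>" using True v2(1) by auto
      then have "v1 \<in> E1" unfolding v2(2) by (intro CollectI exI conjI)
      with E1(1) show False ..
    qed
    have "F = {u + v * v2 | u v. u \<in> \<rat> \<and> v \<in> \<rat>}"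
    proof
      have "x * v1 \<in> \<rat>" if "x \<in> \<rat>" for x using that True by simp
      then show "F \<subseteq> {u + v * v2 | u v. u \<in> \<rat> \<and> v \<in> \<rat>}" unfolding F by blast
      have "u + v * v2 = u / v1 * v1 + v * v2" for u v using \<open>v1 \<noteq> 0\<close> by simp
      moreover have "u / v1 \<in> \<rat>" if "u \<in> \<rat>" for u using that True by simp
      ultimately show "{u + v * v2 | u v. u \<in> \<rat> \<and> v \<in> \<rat>} \<subseteq> F"
        unfolding F by blast
    qed
    moreover from this have "v2 ^ 2 \<in> F"
      by (intro sq) (force intro: exI[of _ 0] exI[of _ 1])
    ultimately show thesis using irr that by blast
  next
    case False
    obtain p q where pq: "1 = p * v1 + q * v2" "p \<in> \<rat>" "q \<in> \<rat>" using one unfolding F by blast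
    have "q \<noteq> 0"
    proof
      assume "q = 0"
      with pq(1) have "p * v1 = 1" by simp
      then have "v1 = inverse p" using inverse_unique[of p v1] by simp
      with False pq(2) show False by simp
    qed
    with pq(1) have v2': "v2 = (1 - p * v1) / q" by (simp add: field_simps)
    have "F = {u + v * v1 | u v. u \<in> \<rat> \<and> v \<in> \<rat>}"
    proof
      have "x * v1 + y * v2 = y / q + (x - y * p / q) * v1" for x y
        unfolding v2' using \<open>q \<noteq> 0\<close> by (simp add: field_simps)
      moreover have "y / q \<in> \<rat>" "x - y * p / q \<in> \<rat>" if "x \<in> \<rat>" "y \<in> \<rat>" for x y
        using that pq(2,3) by simp_all
      ultimately show "F \<subseteq> {u + v * v1 | u v. u \<in> \<rat> \<and> v \<in> \<rat>}"
        unfolding F by blast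
      have "u + v * v1 = (u * p + v) * v1 + (u * q) * v2" for u v
        using arg_cong[OF pq(1), of "(*) u"] by (simp add: algebra_simps)
      moreover have "u * p + v \<in> \<rat>" "u * q \<in> \<rat>" if "u \<in> \<rat>" "v \<in> \<rat>" for u v
        using that pq(2,3) by simp_all
      ultimately show "{u + v * v1 | u v. u \<in> \<rat> \<and> v \<in> \<rat>} \<subseteq> F"
        unfolding F by blast
    qed
    moreover from this have "v1 ^ 2 \<in> F"
      by (intro sq) (force intro: exI[of _ 0] exI[of _ 1])
    ultimately show thesis using False that by blast
  qed
qed

lemma real_quadratic_field_imp_quadratic_field:
  assumes "real_quadratic_field F"
  obtains D \<delta> where "quadratic_field F D \<delta>"
proof -
  obtain \<theta> where \<theta>: "\<theta> \<notin> \<rat>" "\<theta> ^ 2 \<in> F" "F = {u + v * \<theta> | u v. u \<in> \<rat> \<and> v \<in> \<rat>}"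
    by (rule real_quadratic_field_generator[OF assms])
  then obtain A B where AB: "\<theta> ^ 2 = A + B * \<theta>" "A \<in> \<rat>" "B \<in> \<rat>" by blast
  \<comment> \<open>Completing the square: \<open>\<theta> - B / 2\<close> has the rational square p
    / q, and the factor q in \<delta> turns it into the integer p q.\<close>
  have "A + B ^ 2 / 4 \<in> \<rat>" using AB by simp
  then obtain p q where pq: "q > 0" "A + B ^ 2 / 4 = of_int p / of_int q" by (auto elim: Rats_cases')
  define \<delta> where "\<delta> = of_int q * (\<theta> - B / 2)"
  have "quadratic_field F (p * q) \<delta>"
  proof
    have "(\<theta> - B / 2) ^ 2 = A + B ^ 2 / 4"
      unfolding power2_diff AB(1) by (simp add: power_divide mult.commute)
    then show "\<delta> ^ 2 = of_int (p * q)"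
      unfolding \<delta>_def power_mult_distrib pq(2) using pq(1) by (simp add: power2_eq_square)
    have \<theta>': "\<theta> = \<delta> / of_int q + B / 2" unfolding \<delta>_def using pq(1) by simp
    show "\<delta> \<notin> \<rat>"
    proof
      assume "\<delta> \<in> \<rat>"
      then have "\<theta> \<in> \<rat>" unfolding \<theta>' using AB(3) by simp
      with \<theta>(1) show False ..
    qed
    show "F = {u + v * \<delta> | u v. u \<in> \<rat> \<and> v \<in> \<rat>}"
    proof
      have "u + v * \<theta> = (u + v * (B / 2)) + (v / of_int q) * \<delta>" for u v
        unfolding \<theta>' by (simp add: algebra_simps)
      moreover have "u + v * (B / 2) \<in> \<rat>" "v / of_int q \<in> \<rat>" if "u \<in> \<rat>" "v \<in> \<rat>" for u v
        using that AB(3) by simp_all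
      ultimately show "F \<subseteq> {u + v * \<delta> | u v. u \<in> \<rat> \<and> v \<in> \<rat>}"
        unfolding \<theta>(3) by blast
      have "u + v * \<delta> = (u - v * of_int q * (B / 2)) + (v * of_int q) * \<theta>" for u v
        unfolding \<delta>_def by (simp add: algebra_simps)
      moreover have "u - v * of_int q * (B / 2) \<in> \<rat>" "v * of_int q \<in> \<rat>" if "u \<in> \<rat>" "v \<in> \<rat>" for u v
        using that AB(3) by simp_all
      ultimately show "{u + v * \<delta> | u v. u \<in> \<rat> \<and> v \<in> \<rat>} \<subseteq> F"
        unfolding \<theta>(3) by blast
    qed
  qed
  then show thesis by (rule that)
qed

text \<open>Such a q is a rational root of a monic integer polynomial.\<close>

lemma rational_square_Ints:
  assumes "q \<in> \<rat>" "q ^ 2 \<in> \<int>" shows "q \<in> (\<int> :: real set)"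
proof (rule rational_algebraic_int_is_int[OF _ assms(1)])
  show "algebraic_int q"
    using assms(2) by (intro algebraic_int.intros[of "[:- (q ^ 2), 0, 1:]"])
      (auto simp: coeff_pCons power2_eq_square split: nat.splits)
qed

context quadratic_field
begin

section \<open>Arithmetic of the field in coordinates\<close>

lemma F_I: "u \<in> \<rat> \<Longrightarrow> v \<in> \<rat> \<Longrightarrow> u + v * \<delta> \<in> F"
  unfolding F_eq by blast

lemma F_E:
  assumes "x \<in> F" obtains u v where "u \<in> \<rat>" "v \<in> \<rat>" "x = u + v * \<delta>"
  using assms unfolding F_eq by blast

lemma F_Rats: "q \<in> \<rat> \<Longrightarrow> q \<in> F"
  using F_I[of q 0] by simp

lemma delta_mult: "\<delta> * \<delta> = of_int D"
  using delta_sq by (simp add: power2_eq_square)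

lemma D_nonzero: "D \<noteq> 0"
  using delta_sq delta_irrational by auto

lemma F_add: "x \<in> F \<Longrightarrow> y \<in> F \<Longrightarrow> x + y \<in> F"
proof (elim F_E)
  fix u v u' v' assume "u \<in> \<rat>" "v \<in> \<rat>" "x = u + v * \<delta>" "u' \<in> \<rat>" "v' \<in> \<rat>" "y = u' + v' * \<delta>"
  then show "x + y \<in> F" using F_I[of "u + u'" "v + v'"] by (simp add: algebra_simps)
qed

lemma F_mult: "x \<in> F \<Longrightarrow> y \<in> F \<Longrightarrow> x * y \<in> F"
proof (elim F_E)
  fix u v u' v' assume *: "u \<in> \<rat>" "v \<in> \<rat>" "x = u + v * \<delta>" "u' \<in> \<rat>" "v' \<in> \<rat>" "y = u' + v' * \<delta>"
  have "x * y = u * u' + v * v' * (\<delta> * \<delta>) + (u * v' + u' * v) * \<delta>"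
    unfolding * by (simp add: algebra_simps)
  then show "x * y \<in> F" using F_I[of "u * u' + v * v' * of_int D" "u * v' + u' * v"] * by (simp add: delta_mult)
qed

lemma F_uminus: "x \<in> F \<Longrightarrow> - x \<in> F"
  using F_mult[OF F_Rats[of "-1"]] by simp

lemma F_diff: "x \<in> F \<Longrightarrow> y \<in> F \<Longrightarrow> x - y \<in> F"
  using F_add[of x "- y"] F_uminus[of y] by simp

lemma F_inverse: "x \<in> F \<Longrightarrow> 1 / x \<in> F"
proof (elim F_E)
  fix u v assume uv: "u \<in> \<rat>" "v \<in> \<rat>" "x = u + v * \<delta>"
  show "1 / x \<in> F"
  proof (cases "x = 0")
    case True then show ?thesis by (simp add: F_Rats)
  next
    case False
    define n where "n = u ^ 2 - of_int D * v ^ 2"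
    have n: "x * (u - v * \<delta>) = n"
      unfolding n_def uv by (simp add: algebra_simps power2_eq_square delta_mult)
    have "u - v * \<delta> \<noteq> 0"
    proof
      assume "u - v * \<delta> = 0"
      then have "u + (- v) * \<delta> = 0 + 0 * \<delta>" by simp
      then have "u = 0 \<and> - v = 0"
        by (rule rational_linear_unique[OF delta_irrational, rotated -1]) (use uv in auto)
      then show False using False uv by simp
    qed
    with n False have "1 / x = (u - v * \<delta>) / n" by (auto simp: field_simps)
    also have "\<dots> = u / n + (- v / n) * \<delta>" by (simp add: diff_divide_distrib)
    also have "\<dots> \<in> F" using uv by (intro F_I) (auto simp: n_def)
    finally show ?thesis .
  qed
qed

lemma F_divide: "x \<in> F \<Longrightarrow> y \<in> F \<Longrightarrow> x / y \<in> F"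
  using F_mult[OF _ F_inverse, of x y] by simp

lemma quadratic_equation:
  "(u + v * \<delta>) ^ 2 = 2 * u * (u + v * \<delta>) - (u ^ 2 - of_int D * v ^ 2)"
  by (simp add: power2_eq_square algebra_simps delta_mult)

lemma irrational_coord: "u \<in> \<rat> \<Longrightarrow> v \<in> \<rat> \<Longrightarrow> v \<noteq> 0 \<Longrightarrow> u + v * \<delta> \<notin> \<rat>"
proof
  assume "u \<in> \<rat>" "v \<in> \<rat>" "v \<noteq> 0" "u + v * \<delta> \<in> \<rat>"
  moreover from this have "\<delta> = ((u + v * \<delta>) - u) / v" by simp
  ultimately show False using delta_irrational by (metis Rats_diff Rats_divide)
qed

text \<open>The two numbers are trace and norm. For v \<noteq> 0 the element is irrational, so
  Gauss' lemma forces the primitive form of its quadratic equation to be monic up to sign. For v = 0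
  that equation is not minimal, and the integrality of rational algebraic integers is used
  instead.\<close>

lemma algebraic_int_iff:
  assumes uv: "u \<in> \<rat>" "v \<in> \<rat>"
  shows "algebraic_int (u + v * \<delta>) \<longleftrightarrow> 2 * u \<in> \<int> \<and> u ^ 2 - of_int D * v ^ 2 \<in> \<int>"
proof
  assume x: "algebraic_int (u + v * \<delta>)"
  show "2 * u \<in> \<int> \<and> u ^ 2 - of_int D * v ^ 2 \<in> \<int>"
  proof (cases "v = 0")
    case True
    then have "u \<in> \<int>" using x uv by (simp add: rational_algebraic_int_is_int)
    then show ?thesis using True by simp
  next
    case False
    obtain a b c where abc: "a \<noteq> 0" "gcd a (gcd b c) = 1"
      "of_int a * (u + v * \<delta>) ^ 2 + of_int b * (u + v * \<delta>) + of_int c = 0"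
      "2 * u = - of_int b / of_int a" "u ^ 2 - of_int D * v ^ 2 = of_int c / of_int a"
      by (rule primitive_quadratic[OF _ _ quadratic_equation[of u v]]) (use uv in auto)
    have "\<bar>a\<bar> = 1"
      by (rule quadratic_algebraic_int_leading[OF x irrational_coord[OF uv False] abc(1-3)])
    then have "a = 1 \<or> a = -1" by linarith
    then show ?thesis unfolding abc(4,5) by auto
  qed
next
  assume i: "2 * u \<in> \<int> \<and> u ^ 2 - of_int D * v ^ 2 \<in> \<int>"
  show "algebraic_int (u + v * \<delta>)"
  proof (rule algebraic_int.intros[of "[:u ^ 2 - of_int D * v ^ 2, - (2 * u), 1:]"])
    show "\<forall>i. coeff [:u ^ 2 - of_int D * v ^ 2, - (2 * u), 1:] i \<in> \<int>"
      using i by (auto simp: coeff_pCons split: nat.splits)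
  qed (simp_all add: algebra_simps power2_eq_square delta_mult)
qed

section \<open>The ring of integers through traces and norms\<close>

abbreviation \<O> :: "real set" where "\<O> \<equiv> integers_of F"

lemma integers_E:
  assumes "x \<in> \<O>"
  obtains u v s n where "u \<in> \<rat>" "v \<in> \<rat>" "x = u + v * \<delta>" "2 * u = of_int s" "u ^ 2 - of_int D * v ^ 2 = of_int n"
proof -
  obtain u v where uv: "u \<in> \<rat>" "v \<in> \<rat>" "x = u + v * \<delta>" "algebraic_int (u + v * \<delta>)"
    using assms unfolding integers_of_def by (auto elim: F_E)
  then have "2 * u \<in> \<int>" "u ^ 2 - of_int D * v ^ 2 \<in> \<int>" using algebraic_int_iff by auto
  with uv that show thesis by (metis Ints_cases)
qed

lemma integers_I:
  assumes "u \<in> \<rat>" "v \<in> \<rat>" "2 * u \<in> \<int>" "u ^ 2 - of_int D * v ^ 2 \<in> \<int>" "x = u + v * \<delta>"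
  shows "x \<in> \<O>"
  unfolding integers_of_def using assms algebraic_int_iff[of u v] F_I[of u v] by simp

text \<open>With \<open>s, s'\<close> the traces, \<open>w = 4 D v v'\<close> satisfies \<open>w\<^sup>2 = (s\<^sup>2 - 4 n)(s'\<^sup>2 - 4 n')\<close>, so that
  \<open>w\<close> is an integer with the parity of \<open>s s'\<close>.\<close>

lemma integers_mixed_trace:
  fixes u v u' v' :: real
  assumes "u \<in> \<rat>" "v \<in> \<rat>" "2 * u = of_int s" "u ^ 2 - of_int D * v ^ 2 = of_int n"
    and "u' \<in> \<rat>" "v' \<in> \<rat>" "2 * u' = of_int s'" "u' ^ 2 - of_int D * v' ^ 2 = of_int n'"
  shows "2 * (u * u' + of_int D * v * v') \<in> \<int>" "2 * (u * u' - of_int D * v * v') \<in> \<int>"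
proof -
  define w where "w = 4 * of_int D * v * v'"
  have V: "4 * of_int D * v ^ 2 = of_int (s ^ 2 - 4 * n)"
    using assms(4) by (simp add: assms(3)[symmetric] power_mult_distrib)
  have V': "4 * of_int D * v' ^ 2 = of_int (s' ^ 2 - 4 * n')"
    using assms(8) by (simp add: assms(7)[symmetric] power_mult_distrib)
  have "w ^ 2 = (4 * of_int D * v ^ 2) * (4 * of_int D * v' ^ 2)"
    unfolding w_def by (simp add: power2_eq_square algebra_simps)
  then have w2: "w ^ 2 = of_int ((s ^ 2 - 4 * n) * (s' ^ 2 - 4 * n'))" unfolding V V' by simp
  have "w \<in> \<rat>" unfolding w_def using assms(2,6) by simp
  then have "w \<in> \<int>" by (rule rational_square_Ints) (simp only: w2 Ints_of_int)
  then obtain w0 where w0: "w = of_int w0" by (metis Ints_cases)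
  with w2 have "w0 ^ 2 = (s ^ 2 - 4 * n) * (s' ^ 2 - 4 * n')" by (metis of_int_eq_iff of_int_power)
  then have "even (w0 ^ 2) \<longleftrightarrow> even ((s ^ 2 - 4 * n) * (s' ^ 2 - 4 * n'))" by simp
  then have par: "even w0 \<longleftrightarrow> even (s * s')" by simp
  then obtain k where k: "s * s' + w0 = 2 * k" by (metis dvdE even_add)
  from par obtain l where l: "s * s' - w0 = 2 * l" by (metis dvdE even_diff even_add)
  have ss: "4 * u * u' = of_int (s * s')" using assms(3,7) by (simp flip: assms(3,7))
  have "2 * (2 * (u * u' + of_int D * v * v')) = 4 * u * u' + w" unfolding w_def by (simp add: algebra_simps)
  also have "\<dots> = of_int (2 * k)" unfolding ss w0 k[symmetric] by simp
  finally have "2 * (u * u' + of_int D * v * v') = of_int k" by simp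
  then show "2 * (u * u' + of_int D * v * v') \<in> \<int>" by simp
  have "2 * (2 * (u * u' - of_int D * v * v')) = 4 * u * u' - w" unfolding w_def by (simp add: algebra_simps)
  also have "\<dots> = of_int (2 * l)" unfolding ss w0 l[symmetric] by simp
  finally have "2 * (u * u' - of_int D * v * v') = of_int l" by simp
  then show "2 * (u * u' - of_int D * v * v') \<in> \<int>" by simp
qed

lemma integers_uminus: "x \<in> \<O> \<Longrightarrow> - x \<in> \<O>"
  unfolding integers_of_def using F_uminus by simp

text \<open>The norm of a sum exceeds the sum of the norms by
  \<open>2 * (u * u' - of_int D * v * v')\<close>, the trace of x times the conjugate of y.\<close>

lemma integers_add:
  assumes "x \<in> \<O>" "y \<in> \<O>" shows "x + y \<in> \<O>"
proof -
  obtain u v s n where x: "u \<in> \<rat>" "v \<in> \<rat>" "x = u + v * \<delta>" "2 * u = of_int s" "u ^ 2 - of_int D * v ^ 2 = of_int n"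
    by (rule integers_E[OF assms(1)])
  obtain u' v' s' n' where y: "u' \<in> \<rat>" "v' \<in> \<rat>" "y = u' + v' * \<delta>" "2 * u' = of_int s'" "u' ^ 2 - of_int D * v' ^ 2 = of_int n'"
    by (rule integers_E[OF assms(2)])
  show ?thesis
  proof (rule integers_I)
    show "u + u' \<in> \<rat>" "v + v' \<in> \<rat>" using x y by auto
    show "2 * (u + u') \<in> \<int>" unfolding distrib_left x(4) y(4) by simp
    have "(u + u') ^ 2 - of_int D * (v + v') ^ 2 =
      of_int n + of_int n' + 2 * (u * u' - of_int D * v * v')"
      unfolding x(5)[symmetric] y(5)[symmetric] by (simp add: power2_eq_square algebra_simps)
    then show "(u + u') ^ 2 - of_int D * (v + v') ^ 2 \<in> \<int>"
      using integers_mixed_trace(2)[OF x(1,2,4,5) y(1,2,4,5)] by (metis Ints_add Ints_of_int)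
    show "x + y = u + u' + (v + v') * \<delta>" unfolding x y by (simp add: algebra_simps)
  qed
qed

text \<open>The norm is multiplicative, and the trace of the product is the first of the two
  quantities in \<open>integers_mixed_trace\<close>.\<close>

lemma integers_mult:
  assumes "x \<in> \<O>" "y \<in> \<O>" shows "x * y \<in> \<O>"
proof -
  obtain u v s n where x: "u \<in> \<rat>" "v \<in> \<rat>" "x = u + v * \<delta>" "2 * u = of_int s" "u ^ 2 - of_int D * v ^ 2 = of_int n"
    by (rule integers_E[OF assms(1)])
  obtain u' v' s' n' where y: "u' \<in> \<rat>" "v' \<in> \<rat>" "y = u' + v' * \<delta>" "2 * u' = of_int s'" "u' ^ 2 - of_int D * v' ^ 2 = of_int n'"
    by (rule integers_E[OF assms(2)])
  show ?thesis
  proof (rule integers_I)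
    show "u * u' + of_int D * v * v' \<in> \<rat>" "u * v' + u' * v \<in> \<rat>" using x y by auto
    show "2 * (u * u' + of_int D * v * v') \<in> \<int>"
      by (rule integers_mixed_trace(1)[OF x(1,2,4,5) y(1,2,4,5)])
    have "(u * u' + of_int D * v * v') ^ 2 - of_int D * (u * v' + u' * v) ^ 2 = of_int n * of_int n'"
      unfolding x(5)[symmetric] y(5)[symmetric] by (simp add: power2_eq_square algebra_simps)
    then show "(u * u' + of_int D * v * v') ^ 2 - of_int D * (u * v' + u' * v) ^ 2 \<in> \<int>" by simp
    show "x * y = u * u' + of_int D * v * v' + (u * v' + u' * v) * \<delta>"
      unfolding x y by (simp add: algebra_simps delta_mult)
  qed
qed

lemma integers_of_int [simp]: "of_int k \<in> \<O>"
  unfolding integers_of_def using F_Rats by (simp add: int_imp_algebraic_int)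

lemma integers_0 [simp]: "0 \<in> \<O>" and integers_1 [simp]: "1 \<in> \<O>"
  using integers_of_int[of 0] integers_of_int[of 1] by simp_all

lemma zmodule_integers: "zmodule \<O>"
  unfolding zmodule_def using integers_add[of x "- y" for x y] integers_uminus by force

lemma delta_integer: "\<delta> \<in> \<O>"
  by (rule integers_I[of 0 1]) auto

lemma integers_subset_F: "\<O> \<subseteq> F"
  unfolding integers_of_def by blast

text \<open>A rank-two bound on the integers, from which bases of ideals are derived. The norm
  condition makes \<open>(2 * of_int D * v) ^ 2\<close> an integer, which is the origin of the
  denominator 2 D.\<close>

lemma integers_subset_lattice2: "\<O> \<subseteq> lattice2 (1 / 2) (\<delta> / (2 * of_int D))"
proof
  fix x assume "x \<in> \<O>"
  then obtain u v s n where x: "u \<in> \<rat>" "v \<in> \<rat>" "x = u + v * \<delta>" "2 * u = of_int s" "u ^ 2 - of_int D * v ^ 2 = of_int n"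
    by (rule integers_E)
  have "(2 * of_int D * v) ^ 2 = of_int D * ((2 * u) ^ 2 - 4 * of_int n)"
    unfolding x(5)[symmetric] by (simp add: power2_eq_square algebra_simps)
  also have "\<dots> \<in> \<int>" unfolding x(4) by simp
  finally have "2 * of_int D * v \<in> \<int>"
    by (rule rational_square_Ints[rotated]) (intro Rats_mult Rats_of_int x(2), simp)
  then obtain k where "2 * of_int D * v = of_int k" by (metis Ints_cases)
  then have "x = of_int s * (1 / 2) + of_int k * (\<delta> / (2 * of_int D))"
    unfolding x(3) using x(4) D_nonzero by (simp add: field_simps)
  then show "x \<in> lattice2 (1 / 2) (\<delta> / (2 * of_int D))" by (metis lattice2I)
qed

lemma integer_multiple:
  assumes "x \<in> F" obtains k :: int where "k \<noteq> 0" "of_int k * x \<in> \<O>"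
proof -
  obtain u v where uv: "u \<in> \<rat>" "v \<in> \<rat>" "x = u + v * \<delta>" using assms by (rule F_E)
  obtain p q where pq: "q > 0" "u = of_int p / of_int q" using uv(1) by (auto elim: Rats_cases')
  obtain r s where rs: "s > 0" "v = of_int r / of_int s" using uv(2) by (auto elim: Rats_cases')
  have "of_int (q * s) * x = of_int (p * s) + of_int (r * q) * \<delta>"
    unfolding uv pq rs using pq(1) rs(1) by (simp add: field_simps)
  also have "\<dots> \<in> \<O>" by (intro integers_add integers_mult delta_integer integers_of_int)
  finally show thesis using that[of "q * s"] pq(1) rs(1) by simp
qed

end


section \<open>Multiplier rings\<close>

definition multipliers :: "real set \<Rightarrow> real set" where
  "multipliers L = {c. \<forall>l\<in>L. c * l \<in> L}"

lemma multipliersD: "c \<in> multipliers L \<Longrightarrow> l \<in> L \<Longrightarrow> c * l \<in> L"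
  unfolding multipliers_def by blast

lemma zmodule_multipliers: "zmodule L \<Longrightarrow> zmodule (multipliers L)"
  unfolding zmodule_def multipliers_def by (auto simp: left_diff_distrib)

lemma multipliers_scale: "c \<noteq> 0 \<Longrightarrow> multipliers (scale c L) = multipliers L"
  unfolding multipliers_def scale_def by (auto simp: image_iff)

text \<open>For a multiplier x = m + n \<tau>, comparing coordinates in a x \<tau> shows that a
  divides n b and n c. It divides n a in any case, so primitivity makes it divide n.\<close>

lemma multipliers_lattice2:
  assumes "\<tau> \<notin> \<rat>" "gcd a (gcd b c) = 1" "of_int a * \<tau> ^ 2 + of_int b * \<tau> + of_int c = 0"
  shows "multipliers (lattice2 1 \<tau>) = lattice2 1 (of_int a * \<tau>)"
proof
  have sq: "of_int a * \<tau> * \<tau> = - of_int b * \<tau> - of_int c"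
    using assms(3) by (simp add: power2_eq_square)
  show "lattice2 1 (of_int a * \<tau>) \<subseteq> multipliers (lattice2 1 \<tau>)"
  proof (rule lattice2_least)
    show "zmodule (multipliers (lattice2 1 \<tau>))" by (intro zmodule_multipliers zmodule_lattice2)
    show "1 \<in> multipliers (lattice2 1 \<tau>)" by (simp add: multipliers_def)
    have "of_int a * \<tau> * (of_int m * 1 + of_int n * \<tau>) \<in> lattice2 1 \<tau>" for m n
    proof -
      have "of_int a * \<tau> * (of_int m * 1 + of_int n * \<tau>) = of_int (a * m) * \<tau> + of_int n * (of_int a * \<tau> * \<tau>)"
        by (simp add: algebra_simps)
      also have "\<dots> = of_int (- n * c) * 1 + of_int (a * m - n * b) * \<tau>"
        unfolding sq by (simp add: algebra_simps)
      finally show ?thesis by (metis lattice2I)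
    qed
    then show "of_int a * \<tau> \<in> multipliers (lattice2 1 \<tau>)"
      unfolding multipliers_def by (auto elim!: lattice2E)
  qed
  show "multipliers (lattice2 1 \<tau>) \<subseteq> lattice2 1 (of_int a * \<tau>)"
  proof
    fix x assume x: "x \<in> multipliers (lattice2 1 \<tau>)"
    have "x * 1 \<in> lattice2 1 \<tau>" "x * \<tau> \<in> lattice2 1 \<tau>"
      by (rule multipliersD[OF x lattice2_basis(1)], rule multipliersD[OF x lattice2_basis(2)])
    then obtain m n p q where mn: "x = of_int m + of_int n * \<tau>" and pq: "x * \<tau> = of_int p + of_int q * \<tau>"
      by (auto elim!: lattice2E)
    have "of_int (- n * c) + of_int (a * m - n * b) * \<tau> = of_int (a * m) * \<tau> + of_int n * (of_int a * \<tau> * \<tau>)"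
      unfolding sq by (simp add: algebra_simps)
    also have "\<dots> = of_int a * (x * \<tau>)"
      unfolding mn by (simp add: algebra_simps)
    also have "\<dots> = of_int (a * p) + of_int (a * q) * \<tau>"
      unfolding pq by (simp add: algebra_simps)
    finally have "of_int (- n * c) + of_int (a * m - n * b) * \<tau> = of_int (a * p) + of_int (a * q) * \<tau>" .
    from rational_linear_unique[OF assms(1) _ _ _ _ this]
    have "- n * c = a * p" "a * m - n * b = a * q"
      by (simp_all only: Rats_of_int of_int_eq_iff)
    then have nc: "n * c = a * (- p)" and nb: "n * b = a * (m - q)"
      by (simp_all add: algebra_simps)
    obtain u v w where "a * u + b * v + c * w = 1" by (rule primitive_bezout[OF assms(2)])
    then have "n = n * (a * u + b * v + c * w)" by simp
    also have "\<dots> = n * a * u + n * b * v + n * c * w" by (simp add: distrib_left mult.assoc)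
    also have "\<dots> = (n * u + (m - q) * v - p * w) * a" unfolding nb nc by (simp add: algebra_simps)
    finally obtain k where "n = k * a" by blast
    then have "x = of_int m * 1 + of_int k * (of_int a * \<tau>)" unfolding mn by simp
    then show "x \<in> lattice2 1 (of_int a * \<tau>)" by (metis lattice2I)
  qed
qed

text \<open>The products of generators are a, a \<tau>, a \<tau>' and a \<tau> \<tau>' = c, while a
  \<tau> + a \<tau>' = - b. So the product contains a, b and c, hence 1 by primitivity. The factor a
  in the second lattice keeps all of them inside the right-hand side.\<close>

lemma mod_prod_conjugate_lattice2:
  assumes "gcd a (gcd b c) = 1" "of_int a * \<tau> ^ 2 + of_int b * \<tau> + of_int c = 0"
    and \<tau>': "of_int a * \<tau>' = - of_int b - of_int a * \<tau>"
  shows "mod_prod (lattice2 1 \<tau>) (lattice2 (of_int a) (of_int a * \<tau>')) = lattice2 1 (of_int a * \<tau>)"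
    (is "?P = ?O")
proof
  have prod: "of_int a * \<tau>' * \<tau> = of_int c"
    unfolding \<tau>' using assms(2) by (simp add: power2_eq_square algebra_simps)
  show "?P \<subseteq> ?O"
  proof (rule mod_prod_least)
    fix x y assume "x \<in> lattice2 1 \<tau>" "y \<in> lattice2 (of_int a) (of_int a * \<tau>')"
    then obtain m n p q where "x = of_int m * 1 + of_int n * \<tau>" "y = of_int p * of_int a + of_int q * (of_int a * \<tau>')"
      by (metis lattice2E)
    then have "x * y = of_int (m * p * a) + of_int (m * q) * (of_int a * \<tau>') + of_int (n * p) * (of_int a * \<tau>)
        + of_int (n * q) * (of_int a * \<tau>' * \<tau>)"
      by (simp add: algebra_simps)
    also have "\<dots> = of_int (m * p * a - m * q * b + n * q * c) * 1 + of_int (n * p - m * q) * (of_int a * \<tau>)"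
      unfolding prod unfolding \<tau>' by (simp add: algebra_simps)
    finally show "x * y \<in> ?O" by (metis lattice2I)
  qed simp
  have zP: "zmodule ?P" by (intro zmodule_mod_prod zmodule_lattice2)
  have 1: "1 * of_int a \<in> ?P" "\<tau> * of_int a \<in> ?P" "1 * (of_int a * \<tau>') \<in> ?P" "\<tau> * (of_int a * \<tau>') \<in> ?P"
    by (intro mod_prod_mult lattice2_basis)+
  have a: "of_int a \<in> ?P" "of_int a * \<tau> \<in> ?P" "of_int c \<in> ?P"
    using 1(1,2,4) prod by (simp_all add: mult.commute mult.left_commute)
  have "- (of_int a * \<tau>' + of_int a * \<tau>) \<in> ?P"
    using 1(3) a(2) by (intro zmodule_uminus zmodule_add zP) simp_all
  then have b: "of_int b \<in> ?P" unfolding \<tau>' by simp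
  obtain u v w where "a * u + b * v + c * w = 1" by (rule primitive_bezout[OF assms(1)])
  then have "1 = of_int u * of_int a + of_int v * of_int b + (of_int w * of_int c :: real)"
    by (simp flip: of_int_mult of_int_add add: mult.commute)
  also have "\<dots> \<in> ?P" by (intro zmodule_add zP zmodule_of_int_mult a b)
  finally show "?O \<subseteq> ?P" using a(2) by (intro lattice2_least zP)
qed


section \<open>Fractional ideals\<close>

lemma subgroup_iff_zmodule: "subgroup I (add_monoid real_ring) \<longleftrightarrow> zmodule I"
proof -
  interpret R: Ring.field real_ring by (rule field_from_type_algebra)
  have inv: "inv\<^bsub>add_monoid real_ring\<^esub> x = - x" for x :: real
    unfolding a_inv_def[symmetric] by (rule R.minus_equality) (simp_all add: ring_of_type_algebra_def)
  have ops: "carrier (add_monoid real_ring) = (UNIV :: real set)"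
    "x \<otimes>\<^bsub>add_monoid real_ring\<^esub> y = x + y" "\<one>\<^bsub>add_monoid real_ring\<^esub> = (0 :: real)" for x y :: real
    by (simp_all add: ring_of_type_algebra_def)
  show ?thesis
  proof
    assume "subgroup I (add_monoid real_ring)"
    then have "0 \<in> I" "\<And>x y. x \<in> I \<Longrightarrow> y \<in> I \<Longrightarrow> x + y \<in> I" "\<And>x. x \<in> I \<Longrightarrow> - x \<in> I"
      unfolding subgroup_def inv ops by auto
    then show "zmodule I" unfolding zmodule_def by (metis diff_conv_add_uminus)
  next
    assume "zmodule I"
    then show "subgroup I (add_monoid real_ring)"
      unfolding subgroup_def inv ops by (auto intro: zmodule_0 zmodule_add zmodule_uminus)
  qed
qed

context quadratic_field
begin

lemma F_of_int: "of_int k \<in> F"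
  by (rule F_Rats) simp

lemma fractional_ideal_iff:
  "fractional_ideal F I \<longleftrightarrow> zmodule I \<and> I \<subseteq> F \<and> I \<noteq> {0} \<and> \<O> \<subseteq> multipliers I \<and>
     (\<exists>d\<in>\<O> - {0}. \<forall>x\<in>I. d * x \<in> \<O>)"
  unfolding fractional_ideal_def subgroup_iff_zmodule multipliers_def by blast

lemma primitive_equation:
  assumes "\<tau> \<in> F"
  obtains a b c where "a \<noteq> 0" "gcd a (gcd b c) = 1" "of_int a * \<tau> ^ 2 + of_int b * \<tau> + of_int c = 0"
proof -
  obtain u v where uv: "u \<in> \<rat>" "v \<in> \<rat>" "\<tau> = u + v * \<delta>" using assms by (rule F_E)
  show thesis
    by (rule primitive_quadratic[OF _ _ quadratic_equation[of u v]]) (use uv that in auto)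
qed

text \<open>Multiplying the equation by a gives a monic equation for a \<tau>, with constant term a
  c.\<close>

lemma leading_coeff_mult_integer:
  assumes "\<tau> \<in> F" "of_int a * \<tau> ^ 2 + of_int b * \<tau> + of_int c = 0"
  shows "of_int a * \<tau> \<in> \<O>"
proof -
  have "of_int a * (of_int a * \<tau> ^ 2 + of_int b * \<tau> + of_int c) = 0" using assms(2) by simp
  then have "poly [:of_int (a * c), of_int b, 1:] (of_int a * \<tau>) = 0"
    by (simp add: power2_eq_square algebra_simps)
  then have "algebraic_int (of_int a * \<tau>)"
    by (intro algebraic_int.intros[of "[:of_int (a * c), of_int b, 1:]"])
      (auto simp: coeff_pCons split: nat.splits)
  then show ?thesis
    unfolding integers_of_def using F_mult[OF F_Rats[OF Rats_of_int] assms(1)] by simp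
qed

text \<open>A squeeze: stability puts \<O> inside the multiplier ring, which is spanned by 1 and a
  \<tau>, and both of these are algebraic integers of F.\<close>

lemma integers_eq_lattice2:
  assumes "\<tau> \<in> F" "\<tau> \<notin> \<rat>" "\<O> \<subseteq> multipliers (lattice2 1 \<tau>)"
    "gcd a (gcd b c) = 1" "of_int a * \<tau> ^ 2 + of_int b * \<tau> + of_int c = 0"
  shows "\<O> = lattice2 1 (of_int a * \<tau>)"
  using assms(3) multipliers_lattice2[OF assms(2,4,5)]
    lattice2_least[OF zmodule_integers integers_1 leading_coeff_mult_integer[OF assms(1,5)]]
  by blast

text \<open>Multiplied by its denominator d, the ideal lands in the rank-two lattice that contains
  \<O>. Together with x it contains the irrational multiple \<delta> x, so it has full rank.\<close>

lemma fractional_ideal_lattice2: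
  assumes I: "fractional_ideal F I"
  obtains \<alpha> \<tau> where "\<alpha> \<in> F" "\<alpha> \<noteq> 0" "\<tau> \<in> F" "\<tau> \<notin> \<rat>" "I = scale \<alpha> (lattice2 1 \<tau>)"
    "\<O> \<subseteq> multipliers (lattice2 1 \<tau>)"
proof -
  from I obtain d where zI: "zmodule I" "I \<subseteq> F" "I \<noteq> {0}" "\<O> \<subseteq> multipliers I"
    and d: "d \<noteq> 0" "\<And>x. x \<in> I \<Longrightarrow> d * x \<in> \<O>"
    unfolding fractional_ideal_iff by blast
  obtain x where x: "x \<in> I" "x \<noteq> 0" using zI(3) zmodule_0[OF zI(1)] by blast
  obtain c e where ce: "c \<noteq> 0" "e / c \<notin> \<rat>" "scale d I = lattice2 c e"
  proof (rule sublattice_is_lattice2)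
    show "zmodule (scale d I)" using zI(1) by (rule zmodule_scale)
    show "scale d I \<subseteq> lattice2 (1 / 2) (\<delta> / (2 * of_int D))"
      unfolding scale_def using d(2) integers_subset_lattice2 by blast
    show "d * x \<in> scale d I" unfolding scale_def using x by blast
    have "\<delta> * x \<in> I" using zI(4) delta_integer x(1) by (blast intro: multipliersD)
    then show "d * (\<delta> * x) \<in> scale d I" unfolding scale_def by blast
    show "d * x \<noteq> 0" using d x by simp
    then show "d * (\<delta> * x) / (d * x) \<notin> \<rat>" using delta_irrational by simp
  qed
  have "I = scale (1 / d) (scale d I)" using d(1) by simp
  also have "\<dots> = scale (c / d) (lattice2 1 (e / c))"
    unfolding ce(3) scale_lattice2 using ce(1) d(1) by simp
  finally have Ieq: "I = scale (c / d) (lattice2 1 (e / c))" .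
  have "c / d * 1 \<in> I" "c / d * (e / c) \<in> I"
    unfolding Ieq scale_def by (intro imageI lattice2_basis)+
  then have F: "c / d \<in> F" "c / d * (e / c) \<in> F" using zI(2) by auto
  have cd: "c / d \<noteq> 0" using ce(1) d(1) by simp
  have "(c / d * (e / c)) / (c / d) = e / c" using ce(1) d(1) by simp
  then have "e / c \<in> F" using F_divide[OF F(2,1)] by (simp only:)
  moreover have "\<O> \<subseteq> multipliers (lattice2 1 (e / c))"
    using zI(4) Ieq multipliers_scale[OF cd] by metis
  ultimately show thesis using that F(1) cd ce(2) Ieq by blast
qed

lemma fractional_idealI:
  assumes "\<alpha> \<in> F" "\<alpha> \<noteq> 0" "\<tau> \<in> F" "\<tau> \<notin> \<rat>" "\<O> \<subseteq> multipliers (lattice2 1 \<tau>)"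
  shows "fractional_ideal F (scale \<alpha> (lattice2 1 \<tau>))"
  unfolding fractional_ideal_iff
proof (intro conjI)
  show "zmodule (scale \<alpha> (lattice2 1 \<tau>))" by (simp add: zmodule_scale)
  show "scale \<alpha> (lattice2 1 \<tau>) \<subseteq> F"
    unfolding scale_def using F_of_int[of 1] by (auto elim!: lattice2E intro!: F_mult F_add F_of_int assms(1,3))
  have "\<alpha> * 1 \<in> scale \<alpha> (lattice2 1 \<tau>)" unfolding scale_def by (intro imageI lattice2_basis)
  then show "scale \<alpha> (lattice2 1 \<tau>) \<noteq> {0}" using assms(2) by auto
  show "\<O> \<subseteq> multipliers (scale \<alpha> (lattice2 1 \<tau>))" unfolding multipliers_scale[OF assms(2)] by (rule assms(5))
  obtain a b c where abc: "a \<noteq> 0" "gcd a (gcd b c) = 1" "of_int a * \<tau> ^ 2 + of_int b * \<tau> + of_int c = 0"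
    by (rule primitive_equation[OF assms(3)])
  \<comment> \<open>A common denominator is k a: k makes \<alpha> integral and a makes \<tau>
    integral.\<close>
  obtain k :: int where k: "k \<noteq> 0" "of_int k * \<alpha> \<in> \<O>" by (rule integer_multiple[OF assms(1)])
  have a\<tau>: "of_int a * \<tau> \<in> \<O>" by (rule leading_coeff_mult_integer[OF assms(3) abc(3)])
  have "of_int (k * a) * x \<in> \<O>" if "x \<in> scale \<alpha> (lattice2 1 \<tau>)" for x
  proof -
    from that obtain y where "y \<in> lattice2 1 \<tau>" "x = \<alpha> * y" unfolding scale_def by blast
    moreover from this(1) obtain m n where "y = of_int m * 1 + of_int n * \<tau>" by (rule lattice2E)
    ultimately have "of_int (k * a) * x = (of_int k * \<alpha>) * (of_int (a * m) + of_int n * (of_int a * \<tau>))"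
      by (simp add: algebra_simps)
    also have "\<dots> \<in> \<O>" by (intro integers_mult integers_add integers_of_int a\<tau> k)
    finally show ?thesis .
  qed
  then show "\<exists>d\<in>\<O> - {0}. \<forall>x\<in>scale \<alpha> (lattice2 1 \<tau>). d * x \<in> \<O>"
    using k(1) abc(1) integers_of_int[of "k * a"] by (intro bexI[of _ "of_int (k * a)"]) auto
qed

lemma fractional_ideal_integers: "fractional_ideal F \<O>"
  unfolding fractional_ideal_iff
proof (intro conjI)
  show "\<O> \<noteq> {0}" using integers_1 by force
  show "\<O> \<subseteq> multipliers \<O>" unfolding multipliers_def using integers_mult by blast
  show "\<exists>d\<in>\<O> - {0}. \<forall>x\<in>\<O>. d * x \<in> \<O>" by (rule bexI[of _ 1]) auto
qed (rule zmodule_integers integers_subset_F)+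

lemma fractional_ideal_mod_prod:
  assumes I: "fractional_ideal F I" and J: "fractional_ideal F J"
  shows "fractional_ideal F (mod_prod I J)"
proof -
  from I obtain d where zI: "zmodule I" "I \<subseteq> F" "I \<noteq> {0}" "\<O> \<subseteq> multipliers I"
    and d: "d \<in> \<O>" "d \<noteq> 0" "\<And>x. x \<in> I \<Longrightarrow> d * x \<in> \<O>"
    unfolding fractional_ideal_iff by blast
  from J obtain e where zJ: "zmodule J" "J \<subseteq> F" "J \<noteq> {0}" "\<O> \<subseteq> multipliers J"
    and e: "e \<in> \<O>" "e \<noteq> 0" "\<And>x. x \<in> J \<Longrightarrow> e * x \<in> \<O>"
    unfolding fractional_ideal_iff by blast
  show ?thesis
    unfolding fractional_ideal_iff
  proof (intro conjI)
    show z: "zmodule (mod_prod I J)" using zI(1) zJ(1) by (rule zmodule_mod_prod)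
    show "mod_prod I J \<subseteq> F"
    proof
      fix x assume "x \<in> mod_prod I J"
      then show "x \<in> F"
        using zI(2) zJ(2) by (induction rule: mod_prod_induct) (auto intro: F_mult F_add)
    qed
    obtain x y where "x \<in> I" "x \<noteq> 0" "y \<in> J" "y \<noteq> 0"
      using zI(3) zJ(3) zmodule_0[OF zI(1)] zmodule_0[OF zJ(1)] by blast
    then have "x * y \<in> mod_prod I J" "x * y \<noteq> 0" by (auto intro: mod_prod_mult)
    then show "mod_prod I J \<noteq> {0}" by blast
    show "\<O> \<subseteq> multipliers (mod_prod I J)"
    proof
      fix c assume c: "c \<in> \<O>"
      have "c * x \<in> mod_prod I J" if "x \<in> mod_prod I J" for x
        using that
      proof (induction rule: mod_prod_induct)
        case (mult a b)
        then have "c * a \<in> I" using zI(4) c by (blast intro: multipliersD)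
        from mod_prod_mult[OF this mult(2)] show ?case by (simp add: mult.assoc)
      next
        case (add s t)
        then show ?case by (simp add: distrib_left mod_prod_add)
      qed
      then show "c \<in> multipliers (mod_prod I J)" unfolding multipliers_def by blast
    qed
    have "d * e * x \<in> \<O>" if "x \<in> mod_prod I J" for x
      using that
    proof (induction rule: mod_prod_induct)
      case (mult a b)
      have "d * e * (a * b) = (d * a) * (e * b)" by simp
      also have "\<dots> \<in> \<O>" by (rule integers_mult[OF d(3)[OF mult(1)] e(3)[OF mult(2)]])
      finally show ?case .
    next
      case (add s t)
      then show ?case by (simp add: distrib_left integers_add)
    qed
    then show "\<exists>d\<in>\<O> - {0}. \<forall>x\<in>mod_prod I J. d * x \<in> \<O>"
      using d e integers_mult by (intro bexI[of _ "d * e"]) auto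
  qed
qed

text \<open>The inverse is the conjugate lattice rescaled: 1 / \<alpha> cancels the factor of I, and
  a is the factor in \<open>mod_prod_conjugate_lattice2\<close>.\<close>

lemma fractional_ideal_inverse:
  assumes I: "fractional_ideal F I"
  obtains J where "fractional_ideal F J" "mod_prod J I = \<O>"
proof -
  obtain \<alpha> \<tau> where \<alpha>: "\<alpha> \<in> F" "\<alpha> \<noteq> 0" "\<tau> \<in> F" "\<tau> \<notin> \<rat>" "I = scale \<alpha> (lattice2 1 \<tau>)"
    "\<O> \<subseteq> multipliers (lattice2 1 \<tau>)" by (rule fractional_ideal_lattice2[OF I])
  obtain a b c where abc: "a \<noteq> 0" "gcd a (gcd b c) = 1" "of_int a * \<tau> ^ 2 + of_int b * \<tau> + of_int c = 0"
    by (rule primitive_equation[OF \<alpha>(3)])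
  \<comment> \<open>The conjugate of \<tau>, obtained from the sum - b / a of the two roots rather
    than from an automorphism of F.\<close>
  define \<tau>' where "\<tau>' = - (of_int b / of_int a) - \<tau>"
  have a\<tau>': "of_int a * \<tau>' = - of_int b - of_int a * \<tau>"
    unfolding \<tau>'_def using abc(1) by (simp add: field_simps)
  have \<tau>'F: "\<tau>' \<in> F" unfolding \<tau>'_def by (intro F_diff F_uminus F_Rats \<alpha>(3)) simp
  have \<tau>'irr: "\<tau>' \<notin> \<rat>"
  proof
    assume "\<tau>' \<in> \<rat>"
    moreover have "\<tau> = - (of_int b / of_int a) - \<tau>'" unfolding \<tau>'_def by simp
    ultimately have "\<tau> \<in> \<rat>" by simp
    with \<alpha>(4) show False ..
  qed
  have O: "\<O> = lattice2 1 (of_int a * \<tau>)" by (rule integers_eq_lattice2[OF \<alpha>(3,4,6) abc(2,3)])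
  have "of_int a * \<tau>' ^ 2 + of_int b * \<tau>' + of_int c = (of_int a * \<tau>' + of_int b) * \<tau>' + of_int c"
    by (simp add: power2_eq_square algebra_simps)
  also have "\<dots> = - \<tau> * (of_int a * \<tau>') + of_int c"
  proof -
    have "of_int a * \<tau>' + of_int b = - (of_int a * \<tau>)" using a\<tau>' by simp
    then show ?thesis by (simp add: mult.commute mult.left_commute)
  qed
  also have "\<dots> = of_int a * \<tau> ^ 2 + of_int b * \<tau> + of_int c"
    unfolding a\<tau>' by (simp add: power2_eq_square algebra_simps)
  finally have eq': "of_int a * \<tau>' ^ 2 + of_int b * \<tau>' + of_int c = 0" using abc(3) by simp
  \<comment> \<open>Both roots generate the same order, since a \<tau> and a \<tau>' add up to the
    integer - b.\<close>
  have stable: "\<O> \<subseteq> multipliers (lattice2 1 \<tau>')"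
    unfolding multipliers_lattice2[OF \<tau>'irr abc(2) eq'] O
  proof (rule lattice2_least)
    have "of_int a * \<tau> = of_int (- b) * 1 + of_int (- 1) * (of_int a * \<tau>')"
      unfolding a\<tau>' by simp
    then show "of_int a * \<tau> \<in> lattice2 1 (of_int a * \<tau>')" by (metis lattice2I)
  qed simp_all
  let ?J = "scale (of_int a / \<alpha>) (lattice2 1 \<tau>')"
  have "fractional_ideal F ?J"
    using abc(1) \<alpha>(1,2) by (intro fractional_idealI F_divide F_of_int \<tau>'F \<tau>'irr stable) auto
  moreover have "mod_prod ?J I = \<O>"
  proof -
    have "mod_prod ?J I = scale (of_int a / \<alpha>) (mod_prod (lattice2 1 \<tau>') I)"
      unfolding \<alpha>(5) by (intro mod_prod_scale zmodule_scale zmodule_lattice2)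
    also have "\<dots> = scale (of_int a / \<alpha>) (mod_prod I (lattice2 1 \<tau>'))"
      by (subst mod_prod_commute) simp
    also have "\<dots> = scale (of_int a) (mod_prod (lattice2 1 \<tau>) (lattice2 1 \<tau>'))"
      unfolding \<alpha>(5) using \<alpha>(2) by (subst mod_prod_scale) simp_all
    also have "\<dots> = mod_prod (scale (of_int a) (lattice2 1 \<tau>')) (lattice2 1 \<tau>)"
      by (subst mod_prod_scale) (simp_all add: mod_prod_commute)
    also have "\<dots> = mod_prod (lattice2 1 \<tau>) (lattice2 (of_int a) (of_int a * \<tau>'))"
      unfolding scale_lattice2 by (subst mod_prod_commute) simp
    also have "\<dots> = \<O>" unfolding O by (rule mod_prod_conjugate_lattice2[OF abc(2,3) a\<tau>'])
    finally show ?thesis .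
  qed
  ultimately show thesis by (rule that)
qed

lemma mod_prod_integers:
  assumes "zmodule L" "\<O> \<subseteq> multipliers L" shows "mod_prod \<O> L = L"
proof
  show "mod_prod \<O> L \<subseteq> L"
    using assms by (intro mod_prod_least) (auto simp: multipliers_def)
  show "L \<subseteq> mod_prod \<O> L"
    using mod_prod_mult[OF integers_1, of _ L] by auto
qed

text \<open>The ideal is a multiple of a lattice with basis 1, \<tau>, whose multipliers are spanned
  by 1 and a \<tau>; \<open>integers_eq_lattice2\<close> identifies this span with \<O>.\<close>

lemma multipliers_fractional_ideal:
  assumes I: "fractional_ideal F I" shows "multipliers I = \<O>"
proof -
  obtain \<alpha> \<tau> where \<alpha>: "\<alpha> \<in> F" "\<alpha> \<noteq> 0" "\<tau> \<in> F" "\<tau> \<notin> \<rat>" "I = scale \<alpha> (lattice2 1 \<tau>)"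
    "\<O> \<subseteq> multipliers (lattice2 1 \<tau>)" by (rule fractional_ideal_lattice2[OF I])
  obtain a b c where abc: "a \<noteq> 0" "gcd a (gcd b c) = 1" "of_int a * \<tau> ^ 2 + of_int b * \<tau> + of_int c = 0"
    by (rule primitive_equation[OF \<alpha>(3)])
  show ?thesis
    unfolding \<alpha>(5) multipliers_scale[OF \<alpha>(2)] multipliers_lattice2[OF \<alpha>(4) abc(2,3)]
    by (rule integers_eq_lattice2[OF \<alpha>(3,4,6) abc(2,3), symmetric])
qed

lemma fractional_ideal_pseudolattice:
  assumes I: "fractional_ideal F I" and "l \<noteq> 0" shows "pseudolattice (scale l I)"
proof -
  obtain \<alpha> \<tau> where \<alpha>: "\<alpha> \<noteq> 0" "\<tau> \<notin> \<rat>" "I = scale \<alpha> (lattice2 1 \<tau>)"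
    using fractional_ideal_lattice2[OF I] by metis
  then have "scale l I = lattice2 (l * \<alpha>) (l * \<alpha> * \<tau>)" by (simp add: scale_lattice2 mult.assoc)
  then show ?thesis
    unfolding pseudolattice_iff using \<alpha>(1,2) assms(2)
    by (intro exI[of _ "l * \<alpha>"] exI[of _ "l * \<alpha> * \<tau>"]) simp
qed

text \<open>Normalise L to the basis 1, \<tau>. As \<delta> is a multiplier, it lies in the lattice
  itself, and solving \<delta> = m + n \<tau> puts \<tau> into F.\<close>

lemma pseudolattice_with_multipliers:
  assumes "pseudolattice L" "multipliers L = \<O>"
  obtains l I where "l \<noteq> 0" "fractional_ideal F I" "L = scale l I"
proof -
  obtain p q where pq: "p \<noteq> 0" "q / p \<notin> \<rat>" "L = lattice2 p q"
    using assms(1) unfolding pseudolattice_iff by blast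
  define \<tau> where "\<tau> = q / p"
  have L: "L = scale p (lattice2 1 \<tau>)" unfolding scale_lattice2 \<tau>_def pq(3) using pq(1) by simp
  have O: "\<O> = multipliers (lattice2 1 \<tau>)" using assms(2) unfolding L multipliers_scale[OF pq(1)] by simp
  then have "\<delta> * 1 \<in> lattice2 1 \<tau>"
    using delta_integer by (blast intro: multipliersD lattice2_basis)
  then obtain m n where mn: "\<delta> = of_int m + of_int n * \<tau>" by (auto elim!: lattice2E)
  have "n \<noteq> 0"
  proof
    assume "n = 0"
    then have "\<delta> \<in> \<rat>" unfolding mn by simp
    with delta_irrational show False ..
  qed
  then have "\<tau> = (\<delta> - of_int m) / of_int n" unfolding mn by simp
  also have "\<dots> \<in> F"
    using delta_integer integers_subset_F by (intro F_divide F_diff F_of_int) auto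
  finally have "fractional_ideal F (scale 1 (lattice2 1 \<tau>))"
    using pq(2) O unfolding \<tau>_def by (intro fractional_idealI) (auto simp: F_Rats)
  then show thesis using that[OF pq(1)] L by simp
qed

text \<open>A root of \<open>X\<^sup>2 + b X + c\<close> is \<open>\<omega>\<close> or \<open>- b - \<omega>\<close>, and both generate the same order.\<close>

lemma integers_ring_hom_image:
  assumes one: "\<sigma> 1 = 1" and add: "\<And>x y. x \<in> \<O> \<Longrightarrow> y \<in> \<O> \<Longrightarrow> \<sigma> (x + y) = \<sigma> x + \<sigma> y"
    and mult: "\<And>x y. x \<in> \<O> \<Longrightarrow> y \<in> \<O> \<Longrightarrow> \<sigma> (x * y) = \<sigma> x * (\<sigma> y :: real)"
  shows "\<sigma> ` \<O> = \<O>"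
proof -
  obtain \<alpha> \<tau> where \<alpha>: "\<tau> \<in> F" "\<tau> \<notin> \<rat>" "\<O> \<subseteq> multipliers (lattice2 1 \<tau>)"
    using fractional_ideal_lattice2[OF fractional_ideal_integers] by metis
  obtain a b c where abc: "a \<noteq> 0" "gcd a (gcd b c) = 1" "of_int a * \<tau> ^ 2 + of_int b * \<tau> + of_int c = 0"
    by (rule primitive_equation[OF \<alpha>(1)])
  define \<omega> where "\<omega> = of_int a * \<tau>"
  have O: "\<O> = lattice2 1 \<omega>" unfolding \<omega>_def by (rule integers_eq_lattice2[OF \<alpha> abc(2,3)])
  then have \<omega>: "\<omega> \<in> \<O>" by simp
  have "of_int a * (of_int a * \<tau> ^ 2 + of_int b * \<tau> + of_int c) = 0" using abc(3) by simp
  then have eq: "\<omega> * \<omega> + of_int b * \<omega> + of_int (a * c) = 0"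
    unfolding \<omega>_def by (simp add: power2_eq_square algebra_simps)
  have \<sigma>0: "\<sigma> 0 = 0" using add[of 0 0] by simp
  have neg: "\<sigma> (- x) = - \<sigma> x" if "x \<in> \<O>" for x
    using add[of x "- x"] that \<sigma>0 integers_uminus by simp
  have nat: "\<sigma> (of_nat k) = of_nat k" for k
  proof (induction k)
    case (Suc k)
    have "of_nat k \<in> \<O>" using integers_of_int[of "int k"] by simp
    then show ?case using add[of 1 "of_nat k"] Suc one by simp
  qed (simp add: \<sigma>0)
  have int: "\<sigma> (of_int k) = of_int k" for k
    using nat neg[of "of_nat n" for n] integers_of_int[of "int n" for n]
    by (cases k rule: int_cases2) (auto simp: of_int_of_nat_eq)
  have img: "\<sigma> (of_int m * 1 + of_int n * \<omega>) = of_int m * 1 + of_int n * \<sigma> \<omega>" for m n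
    using add[of "of_int m" "of_int n * \<omega>"] mult[of "of_int n" \<omega>] \<omega> integers_mult[OF integers_of_int \<omega>, of n]
    by (simp add: int)
  have "\<sigma> (\<omega> * \<omega> + of_int b * \<omega> + of_int (a * c)) = \<sigma> \<omega> * \<sigma> \<omega> + of_int b * \<sigma> \<omega> + of_int (a * c)"
    using add mult \<omega> by (simp only: integers_add integers_mult integers_of_int int)
  then have "\<sigma> \<omega> * \<sigma> \<omega> + of_int b * \<sigma> \<omega> + of_int (a * c) = 0" unfolding eq by (simp add: \<sigma>0)
  with eq have "(\<sigma> \<omega> - \<omega>) * (\<sigma> \<omega> + of_int b + \<omega>) = 0" by (simp add: algebra_simps)
  then consider "\<sigma> \<omega> = \<omega>" | "\<sigma> \<omega> = - of_int b - \<omega>" by force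
  then have gen: "\<sigma> \<omega> \<in> lattice2 1 \<omega> \<and> \<omega> \<in> lattice2 1 (\<sigma> \<omega>)"
  proof cases
    case 2
    then have "\<sigma> \<omega> = of_int (- b) * 1 + of_int (- 1) * \<omega>" "\<omega> = of_int (- b) * 1 + of_int (- 1) * \<sigma> \<omega>" by simp_all
    then show ?thesis by (metis lattice2I)
  qed simp_all
  have "\<sigma> ` \<O> = lattice2 1 (\<sigma> \<omega>)"
  proof
    show "\<sigma> ` \<O> \<subseteq> lattice2 1 (\<sigma> \<omega>)"
    proof
      fix y assume "y \<in> \<sigma> ` \<O>"
      then obtain x where "x \<in> lattice2 1 \<omega>" "y = \<sigma> x" unfolding O by blast
      moreover from this(1) obtain m n where "x = of_int m * 1 + of_int n * \<omega>" by (rule lattice2E)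
      ultimately show "y \<in> lattice2 1 (\<sigma> \<omega>)" by (simp only: img lattice2I)
    qed
    show "lattice2 1 (\<sigma> \<omega>) \<subseteq> \<sigma> ` \<O>"
    proof
      fix y assume "y \<in> lattice2 1 (\<sigma> \<omega>)"
      then obtain m n where "y = of_int m * 1 + of_int n * \<sigma> \<omega>" by (rule lattice2E)
      then have "y = \<sigma> (of_int m * 1 + of_int n * \<omega>)" by (simp only: img)
      moreover have "of_int m * 1 + of_int n * \<omega> \<in> \<O>" unfolding O by (rule lattice2I)
      ultimately show "y \<in> \<sigma> ` \<O>" by blast
    qed
  qed
  also have "\<dots> = lattice2 1 \<omega>"
    using gen by (intro equalityI lattice2_least) simp_all
  finally show ?thesis using O by simp
qed

end


section \<open>The ideal class group\<close>

context quadratic_field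
begin

lemma fractional_ideal_zmodule: "fractional_ideal F I \<Longrightarrow> zmodule I"
  by (simp add: fractional_ideal_iff)

lemma mod_prod_integers_fractional: "fractional_ideal F I \<Longrightarrow> mod_prod \<O> I = I"
  by (rule mod_prod_integers) (auto simp: fractional_ideal_iff)

text \<open>Multiplying by a principal ideal is scaling by its generator, so cosets of the principal
  ideals are orbits under scaling by non-zero elements of F.\<close>

lemma mod_prod_scale_integers:
  assumes "fractional_ideal F I" shows "mod_prod (scale x \<O>) I = scale x I"
  using assms mod_prod_scale[OF zmodule_integers fractional_ideal_zmodule]
  by (simp add: mod_prod_integers_fractional)

lemma fractional_ideal_scale:
  assumes I: "fractional_ideal F I" and x: "x \<in> F" "x \<noteq> 0"
  shows "fractional_ideal F (scale x I)"
proof -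
  obtain \<alpha> \<tau> where \<alpha>: "\<alpha> \<in> F" "\<alpha> \<noteq> 0" "\<tau> \<in> F" "\<tau> \<notin> \<rat>" "I = scale \<alpha> (lattice2 1 \<tau>)"
    "\<O> \<subseteq> multipliers (lattice2 1 \<tau>)" by (rule fractional_ideal_lattice2[OF I])
  show ?thesis
    unfolding \<alpha>(5) scale_scale using \<alpha> x by (intro fractional_idealI F_mult) auto
qed

lemma comm_group_ideal_group: "comm_group (ideal_group F)"
proof (rule comm_groupI)
  fix I assume I: "I \<in> carrier (ideal_group F)"
  then obtain J where "fractional_ideal F J" "mod_prod J I = \<O>"
    using fractional_ideal_inverse[of I] unfolding ideal_group_def by auto
  then show "\<exists>J\<in>carrier (ideal_group F). J \<otimes>\<^bsub>ideal_group F\<^esub> I = \<one>\<^bsub>ideal_group F\<^esub>"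
    unfolding ideal_group_def by auto
qed (simp_all add: ideal_group_def fractional_ideal_mod_prod fractional_ideal_integers
    mod_prod_integers_fractional mod_prod_assoc fractional_ideal_zmodule, rule mod_prod_commute)

sublocale ideals: comm_group "ideal_group F"
  by (rule comm_group_ideal_group)

lemma principal_ideal_eq: "principal_ideal F x = scale x \<O>"
  by (auto simp: principal_ideal_def l_coset_def scale_def ring_of_type_algebra_def)

lemma principal_ideals_eq: "principal_ideals F = {scale x \<O> | x. x \<in> F \<and> x \<noteq> 0}"
  by (auto simp: principal_ideals_def principal_ideal_eq)

lemma principal_ideals_normal: "principal_ideals F \<lhd> ideal_group F"
proof (rule ideals.subgroup_imp_normal, rule ideals.subgroupI)
  show sub: "principal_ideals F \<subseteq> carrier (ideal_group F)"
    unfolding principal_ideals_eq ideal_group_def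
    by (auto intro: fractional_ideal_scale fractional_ideal_integers)
  show "principal_ideals F \<noteq> {}"
    unfolding principal_ideals_eq using F_of_int[of 1] by (auto intro: exI[of _ 1])
  have mult: "scale x \<O> \<otimes>\<^bsub>ideal_group F\<^esub> scale y \<O> = scale (x * y) \<O>" if "y \<in> F" "y \<noteq> 0" for x y
    using mod_prod_scale_integers[OF fractional_ideal_scale[OF fractional_ideal_integers that]]
    by (simp add: ideal_group_def)
  fix I assume "I \<in> principal_ideals F"
  then obtain x where x: "x \<in> F" "x \<noteq> 0" "I = scale x \<O>" unfolding principal_ideals_eq by blast
  have x': "1 / x \<in> F" "1 / x \<noteq> 0" using x F_inverse by auto
  have "inv\<^bsub>ideal_group F\<^esub> I = scale (1 / x) \<O>"
  proof (rule ideals.inv_equality)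
    show "scale (1 / x) \<O> \<otimes>\<^bsub>ideal_group F\<^esub> I = \<one>\<^bsub>ideal_group F\<^esub>"
      unfolding x(3) mult[OF x(1,2)] using x(2) by (simp add: ideal_group_def)
    show "I \<in> carrier (ideal_group F)" "scale (1 / x) \<O> \<in> carrier (ideal_group F)"
      unfolding ideal_group_def x(3)
      using fractional_ideal_scale[OF fractional_ideal_integers] x(1,2) x' by auto
  qed
  then show "inv\<^bsub>ideal_group F\<^esub> I \<in> principal_ideals F"
    unfolding principal_ideals_eq using x' by blast
  fix J assume "J \<in> principal_ideals F"
  then obtain y where y: "y \<in> F" "y \<noteq> 0" "J = scale y \<O>" unfolding principal_ideals_eq by blast
  show "I \<otimes>\<^bsub>ideal_group F\<^esub> J \<in> principal_ideals F"
    unfolding x(3) y(3) mult[OF y(1,2)] principal_ideals_eq using x(1,2) y(1,2)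
    by (auto intro!: F_mult)
qed

sublocale principal: normal "principal_ideals F" "ideal_group F"
  by (rule principal_ideals_normal)

lemma group_class_group: "group (class_group F)"
  unfolding class_group_def by (rule principal.factorgroup_is_group)

lemma carrier_class_group: "carrier (class_group F) = {ideal_class F I | I. fractional_ideal F I}"
  by (auto simp: class_group_def FactGroup_def RCOSETS_def ideal_class_def ideal_group_def)

lemma mult_class_group:
  assumes "fractional_ideal F I" "fractional_ideal F J"
  shows "ideal_class F I \<otimes>\<^bsub>class_group F\<^esub> ideal_class F J = ideal_class F (mod_prod I J)"
  using principal.rcos_sum[of I J] assms
  by (simp add: class_group_def FactGroup_def ideal_class_def ideal_group_def)

lemma ideal_class_eq_iff:
  assumes I: "fractional_ideal F I" and J: "fractional_ideal F J"
  shows "ideal_class F I = ideal_class F J \<longleftrightarrow> (\<exists>x\<in>F. x \<noteq> 0 \<and> I = scale x J)"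
proof -
  have mem: "K \<in> ideal_class F J \<longleftrightarrow> (\<exists>x\<in>F. x \<noteq> 0 \<and> K = scale x J)" for K
    unfolding ideal_class_def r_coset_def principal_ideals_eq
    by (auto simp: ideal_group_def mod_prod_scale_integers[OF J])
  show ?thesis
  proof
    assume "ideal_class F I = ideal_class F J"
    moreover have "I \<in> ideal_class F I"
      unfolding ideal_class_def using I by (intro ideals.rcos_self principal.subgroup_axioms) (simp add: ideal_group_def)
    ultimately show "\<exists>x\<in>F. x \<noteq> 0 \<and> I = scale x J" using mem by simp
  next
    assume "\<exists>x\<in>F. x \<noteq> 0 \<and> I = scale x J"
    then have "I \<in> principal_ideals F #>\<^bsub>ideal_group F\<^esub> J" using mem unfolding ideal_class_def by simp
    from ideals.repr_independence[OF this _ principal.subgroup_axioms] J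
    show "ideal_class F I = ideal_class F J"
      unfolding ideal_class_def by (simp add: ideal_group_def)
  qed
qed

end


section \<open>Isomorphisms and endomorphisms of quantum tori\<close>

text \<open>Applied to the difference of two scalars that induce the same map on tori, this makes
  them equal. It holds because half of a basis vector is not in the lattice.\<close>

lemma pseudolattice_no_line:
  assumes "pseudolattice M" "\<And>x. d * x \<in> M" shows "d = 0"
proof (rule ccontr)
  assume "d \<noteq> 0"
  obtain a b where ab: "a \<noteq> 0" "b / a \<notin> \<rat>" "M = lattice2 a b"
    using assms(1) unfolding pseudolattice_iff by blast
  have "a / 2 \<in> M" using assms(2)[of "a / 2 / d"] \<open>d \<noteq> 0\<close> by simp
  then obtain m n where "a / 2 = of_int m * a + of_int n * b" unfolding ab(3) by (rule lattice2E)
  then have "of_int (2 * m) * a + of_int (2 * n) * b = of_int 1 * a + of_int 0 * b" by simp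
  from lattice2_coords_unique[OF ab(1,2) this] show False by presburger
qed

text \<open>The lattice is the only coset that contains 0. Isomorphism classes consist of sets of
  cosets, and this recovery allows them to be described by lattices.\<close>

lemma quantum_torus_inject:
  assumes "zmodule L" "zmodule M" "quantum_torus L = quantum_torus M" shows "L = M"
proof -
  have "L +>\<^bsub>real_ring\<^esub> 0 \<in> quantum_torus L" unfolding quantum_torus_eq by blast
  then have "L \<in> quantum_torus M" unfolding assms(3) unfolding real_coset by simp
  then obtain x where x: "L = M +>\<^bsub>real_ring\<^esub> x" unfolding quantum_torus_eq by blast
  then obtain m where "m \<in> M" "0 = m + x" using zmodule_0[OF assms(1)] unfolding real_coset by blast
  then have "- m \<in> M" "- m = x" using zmodule_uminus[OF assms(2)] by auto
  then have "x - 0 \<in> M" by simp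
  then have "L = M +>\<^bsub>real_ring\<^esub> 0" unfolding x real_coset_eq_iff[OF assms(2)] .
  then show ?thesis unfolding real_coset by simp
qed

lemma real_coset_in_quantum_torus: "L +>\<^bsub>real_ring\<^esub> x \<in> quantum_torus L"
  unfolding quantum_torus_eq by blast

lemma real_coset_add:
  assumes "zmodule L"
  shows "(L +>\<^bsub>real_ring\<^esub> x) <+>\<^bsub>real_ring\<^esub> (L +>\<^bsub>real_ring\<^esub> y) = L +>\<^bsub>real_ring\<^esub> (x + y)"
proof -
  have "(L +>\<^bsub>real_ring\<^esub> x) <+>\<^bsub>real_ring\<^esub> (L +>\<^bsub>real_ring\<^esub> y) = {(l + x) + (m + y) | l m. l \<in> L \<and> m \<in> L}"
    unfolding real_coset by (auto simp: set_add_def set_mult_def ring_of_type_algebra_def)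
  also have "\<dots> = (\<lambda>l. l + (x + y)) ` L"
  proof
    have "(l + x) + (m + y) = (l + m) + (x + y)" for l m by simp
    then show "{(l + x) + (m + y) | l m. l \<in> L \<and> m \<in> L} \<subseteq> (\<lambda>l. l + (x + y)) ` L"
      using zmodule_add[OF assms] by blast
    have "l + (x + y) = (l + x) + (0 + y)" for l by simp
    then show "(\<lambda>l. l + (x + y)) ` L \<subseteq> {(l + x) + (m + y) | l m. l \<in> L \<and> m \<in> L}"
      using zmodule_0[OF assms] by blast
  qed
  finally show ?thesis unfolding real_coset .
qed

text \<open>The union avoids choosing a representative: when c maps L into M, all the cosets being
  united are equal.\<close>

definition torus_mult :: "real set \<Rightarrow> real set \<Rightarrow> real \<Rightarrow> real set \<Rightarrow> real set" where
  "torus_mult L M c = (\<lambda>Z\<in>quantum_torus L. \<Union>z\<in>Z. M +>\<^bsub>real_ring\<^esub> (c * z))"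

lemma torus_mult_extensional: "torus_mult L M c \<in> extensional (quantum_torus L)"
  by (simp add: torus_mult_def)

lemma torus_mult_coset:
  assumes "zmodule L" "zmodule M" "\<And>l. l \<in> L \<Longrightarrow> c * l \<in> M"
  shows "torus_mult L M c (L +>\<^bsub>real_ring\<^esub> x) = M +>\<^bsub>real_ring\<^esub> (c * x)"
proof -
  have "M +>\<^bsub>real_ring\<^esub> (c * z) = M +>\<^bsub>real_ring\<^esub> (c * x)" if z: "z \<in> L +>\<^bsub>real_ring\<^esub> x" for z
  proof -
    obtain l where "l \<in> L" "z = l + x" using z unfolding real_coset by blast
    then show ?thesis
      unfolding real_coset_eq_iff[OF assms(2)] using assms(3) by (simp add: distrib_left)
  qed
  moreover have "x \<in> L +>\<^bsub>real_ring\<^esub> x" unfolding real_coset using zmodule_0[OF assms(1)] by force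
  ultimately have "(\<Union>z\<in>L +>\<^bsub>real_ring\<^esub> x. M +>\<^bsub>real_ring\<^esub> (c * z)) = M +>\<^bsub>real_ring\<^esub> (c * x)" by blast
  then show ?thesis by (simp add: torus_mult_def real_coset_in_quantum_torus)
qed

lemma torus_map_eqI:
  assumes "f \<in> extensional (quantum_torus L)" "g \<in> extensional (quantum_torus L)"
    "\<And>x. f (L +>\<^bsub>real_ring\<^esub> x) = g (L +>\<^bsub>real_ring\<^esub> x)"
  shows "f = g"
  using assms unfolding quantum_torus_eq by (intro extensionalityI) auto

lemma multipliers_mult: "c \<in> multipliers L \<Longrightarrow> d \<in> multipliers L \<Longrightarrow> c * d \<in> multipliers L"
  unfolding multipliers_def by (simp add: mult.assoc)

context nonstandard_model_locale
begin

text \<open>The nonstandard model enters the later arguments only through this parametrisation of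
  morphisms by real numbers.\<close>

lemma torus_hom_eq:
  assumes "zmodule L" "zmodule M"
  shows "torus_hom E L M = torus_mult L M ` {c. \<forall>l\<in>L. c * l \<in> M}"
proof (intro Set.set_eqI iffI)
  fix f assume "f \<in> torus_hom E L M"
  then obtain c where c: "f \<in> extensional (quantum_torus L)" "\<forall>l\<in>L. c * l \<in> M"
    "\<And>x. f (L +>\<^bsub>real_ring\<^esub> x) = M +>\<^bsub>real_ring\<^esub> (c * x)"
    unfolding torus_hom_iff[OF assms] by blast
  have "f = torus_mult L M c"
  proof (rule torus_map_eqI[OF c(1) torus_mult_extensional])
    show "f (L +>\<^bsub>real_ring\<^esub> x) = torus_mult L M c (L +>\<^bsub>real_ring\<^esub> x)" for x
      unfolding c(3) using torus_mult_coset[OF assms, of c x] c(2) by simp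
  qed
  with c(2) show "f \<in> torus_mult L M ` {c. \<forall>l\<in>L. c * l \<in> M}" by blast
next
  fix f assume "f \<in> torus_mult L M ` {c. \<forall>l\<in>L. c * l \<in> M}"
  then obtain c where "f = torus_mult L M c" "\<forall>l\<in>L. c * l \<in> M" by blast
  then show "f \<in> torus_hom E L M"
    unfolding torus_hom_iff[OF assms] using torus_mult_coset[OF assms, of c] torus_mult_extensional by blast
qed

lemma torus_isomorphic_iff:
  assumes L: "pseudolattice L" and M: "pseudolattice M"
  shows "torus_isomorphic E L M \<longleftrightarrow> (\<exists>c. c \<noteq> 0 \<and> M = scale c L)"
proof
  note z = zmodule_pseudolattice[OF L] zmodule_pseudolattice[OF M]
  assume "torus_isomorphic E L M"
  then obtain c d where c: "\<forall>l\<in>L. c * l \<in> M" and d: "\<forall>m\<in>M. d * m \<in> L"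
    and inv: "\<forall>Z\<in>quantum_torus L. torus_mult M L d (torus_mult L M c Z) = Z"
    unfolding torus_isomorphic_def torus_hom_eq[OF z] torus_hom_eq[OF z(2,1)] by blast
  \<comment> \<open>The composite is the identity only modulo L, but the congruence holds for every
    real x; this is what forces d c = 1.\<close>
  have "(d * c - 1) * x \<in> L" for x
  proof -
    have "L +>\<^bsub>real_ring\<^esub> (d * (c * x)) = L +>\<^bsub>real_ring\<^esub> x"
      using inv[rule_format, OF real_coset_in_quantum_torus, of x] torus_mult_coset[OF z, of c x]
        torus_mult_coset[OF z(2,1), of d "c * x"] c d by simp
    then show ?thesis
      unfolding real_coset_eq_iff[OF z(1)] by (simp add: left_diff_distrib mult.assoc)
  qed
  from pseudolattice_no_line[OF L this] have dc: "d * c = 1" by simp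
  then have "c \<noteq> 0" by auto
  have "M = scale c L"
  proof
    show "scale c L \<subseteq> M" using c unfolding scale_def by blast
    have "m = c * (d * m)" for m using dc by (metis mult.assoc mult.commute mult_1)
    then show "M \<subseteq> scale c L" using d unfolding scale_def by blast
  qed
  with \<open>c \<noteq> 0\<close> show "\<exists>c. c \<noteq> 0 \<and> M = scale c L" by blast
next
  note z = zmodule_pseudolattice[OF L] zmodule_pseudolattice[OF M]
  assume "\<exists>c. c \<noteq> 0 \<and> M = scale c L"
  then obtain c where c: "c \<noteq> 0" "M = scale c L" by blast
  have cL: "c * l \<in> M" if "l \<in> L" for l using that unfolding c(2) scale_def by blast
  have cM: "1 / c * m \<in> L" if "m \<in> M" for m using that c unfolding scale_def by auto
  show "torus_isomorphic E L M"
    unfolding torus_isomorphic_def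
  proof (intro bexI conjI ballI)
    show "torus_mult L M c \<in> torus_hom E L M" "torus_mult M L (1 / c) \<in> torus_hom E M L"
      unfolding torus_hom_eq[OF z] torus_hom_eq[OF z(2,1)] using cL cM by blast+
    show "torus_mult M L (1 / c) (torus_mult L M c Z) = Z" if "Z \<in> quantum_torus L" for Z
      using that c(1) unfolding quantum_torus_eq
      by (auto simp: torus_mult_coset[OF z cL] torus_mult_coset[OF z(2,1) cM])
    show "torus_mult L M c (torus_mult M L (1 / c) Z) = Z" if "Z \<in> quantum_torus M" for Z
      using that c(1) unfolding quantum_torus_eq
      by (auto simp: torus_mult_coset[OF z cL] torus_mult_coset[OF z(2,1) cM])
  qed
qed

lemma torus_class_eq:
  assumes L: "pseudolattice L"
  shows "torus_class E (quantum_torus L) = {quantum_torus (scale c L) | c. c \<noteq> 0}"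
proof (intro Set.set_eqI iffI)
  fix Z assume "Z \<in> torus_class E (quantum_torus L)"
  then obtain L' M where M: "quantum_torus L' = quantum_torus L" "Z = quantum_torus M"
    "pseudolattice L'" "pseudolattice M" "torus_isomorphic E L' M"
    unfolding torus_class_def torus_iso_rel_def by blast
  have "L' = L" by (rule quantum_torus_inject[OF _ _ M(1)]) (simp_all add: zmodule_pseudolattice L M(3))
  with M show "Z \<in> {quantum_torus (scale c L) | c. c \<noteq> 0}" using torus_isomorphic_iff[OF L, of M] by blast
next
  fix Z assume "Z \<in> {quantum_torus (scale c L) | c. c \<noteq> 0}"
  then obtain c where c: "c \<noteq> 0" "Z = quantum_torus (scale c L)" by blast
  then show "Z \<in> torus_class E (quantum_torus L)"
    unfolding torus_class_def torus_iso_rel_def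
    using L pseudolattice_scale[OF L c(1)] torus_isomorphic_iff[OF L pseudolattice_scale[OF L c(1)]] by blast
qed

lemma torus_class_eq_iff:
  assumes L: "pseudolattice L" and M: "pseudolattice M"
  shows "torus_class E (quantum_torus L) = torus_class E (quantum_torus M) \<longleftrightarrow> (\<exists>c. c \<noteq> 0 \<and> M = scale c L)"
proof
  assume "torus_class E (quantum_torus L) = torus_class E (quantum_torus M)"
  moreover have "quantum_torus M \<in> torus_class E (quantum_torus M)"
    unfolding torus_class_eq[OF M] by (auto intro!: exI[of _ 1])
  ultimately obtain c where c: "c \<noteq> 0" "quantum_torus M = quantum_torus (scale c L)"
    unfolding torus_class_eq[OF L] by auto
  have "M = scale c L"
    by (rule quantum_torus_inject[OF _ _ c(2)]) (simp_all add: zmodule_scale zmodule_pseudolattice L M)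
  with c(1) show "\<exists>c. c \<noteq> 0 \<and> M = scale c L" by blast
next
  assume "\<exists>c. c \<noteq> 0 \<and> M = scale c L"
  then obtain c where c: "c \<noteq> 0" "M = scale c L" by blast
  show "torus_class E (quantum_torus L) = torus_class E (quantum_torus M)"
    unfolding torus_class_eq[OF L] torus_class_eq[OF M]
  proof (intro Set.set_eqI iffI)
    fix Z assume "Z \<in> {quantum_torus (scale d L) | d. d \<noteq> 0}"
    then obtain d where "d \<noteq> 0" "Z = quantum_torus (scale d L)" by blast
    then show "Z \<in> {quantum_torus (scale d M) | d. d \<noteq> 0}"
      using c by (intro CollectI exI[of _ "d / c"]) simp
  next
    fix Z assume "Z \<in> {quantum_torus (scale d M) | d. d \<noteq> 0}"
    then obtain d where "d \<noteq> 0" "Z = quantum_torus (scale d M)" by blast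
    then show "Z \<in> {quantum_torus (scale d L) | d. d \<noteq> 0}"
      using c by (intro CollectI exI[of _ "d * c"]) simp
  qed
qed

lemma torus_End_bij:
  assumes L: "pseudolattice L"
  shows "bij_betw (torus_mult L L) (multipliers L) (carrier (torus_End E L))"
proof -
  note z = zmodule_pseudolattice[OF L]
  have "inj_on (torus_mult L L) (multipliers L)"
  proof (rule inj_onI)
    fix c d assume cd: "c \<in> multipliers L" "d \<in> multipliers L" "torus_mult L L c = torus_mult L L d"
    have "(c - d) * x \<in> L" for x
      using arg_cong[OF cd(3), of "\<lambda>f. f (L +>\<^bsub>real_ring\<^esub> x)"]
        torus_mult_coset[OF z z multipliersD[OF cd(1)]] torus_mult_coset[OF z z multipliersD[OF cd(2)]]
        real_coset_eq_iff[OF z, of "c * x" "d * x"] by (simp add: left_diff_distrib)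
    from pseudolattice_no_line[OF L this] show "c = d" by simp
  qed
  then show ?thesis
    unfolding bij_betw_def torus_End_def using torus_hom_eq[OF z z] by (simp add: multipliers_def)
qed

lemma torus_End_ops:
  assumes L: "pseudolattice L" and c: "c \<in> multipliers L" and d: "d \<in> multipliers L"
  shows "torus_mult L L c \<otimes>\<^bsub>torus_End E L\<^esub> torus_mult L L d = torus_mult L L (c * d)"
    and "torus_mult L L c \<oplus>\<^bsub>torus_End E L\<^esub> torus_mult L L d = torus_mult L L (c + d)"
    and "\<one>\<^bsub>torus_End E L\<^esub> = torus_mult L L 1"
proof -
  note z = zmodule_pseudolattice[OF L]
  have one: "1 \<in> multipliers L" by (simp add: multipliers_def)
  have m: "torus_mult L L e (L +>\<^bsub>real_ring\<^esub> x) = L +>\<^bsub>real_ring\<^esub> (e * x)" if "e \<in> multipliers L" for e x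
    by (rule torus_mult_coset[OF z z multipliersD[OF that]])
  note cosets = m[OF c] m[OF d] m[OF one] m[OF multipliers_mult[OF c d]]
    m[OF zmodule_add[OF zmodule_multipliers[OF z] c d]]
  show "torus_mult L L c \<otimes>\<^bsub>torus_End E L\<^esub> torus_mult L L d = torus_mult L L (c * d)"
  proof (rule torus_map_eqI[OF _ torus_mult_extensional])
    show "torus_mult L L c \<otimes>\<^bsub>torus_End E L\<^esub> torus_mult L L d \<in> extensional (quantum_torus L)"
      by (simp add: torus_End_def compose_def)
    show "(torus_mult L L c \<otimes>\<^bsub>torus_End E L\<^esub> torus_mult L L d) (L +>\<^bsub>real_ring\<^esub> x)
      = torus_mult L L (c * d) (L +>\<^bsub>real_ring\<^esub> x)" for x
      by (simp add: torus_End_def compose_def real_coset_in_quantum_torus cosets mult.assoc)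
  qed
  show "torus_mult L L c \<oplus>\<^bsub>torus_End E L\<^esub> torus_mult L L d = torus_mult L L (c + d)"
  proof (rule torus_map_eqI[OF _ torus_mult_extensional])
    show "torus_mult L L c \<oplus>\<^bsub>torus_End E L\<^esub> torus_mult L L d \<in> extensional (quantum_torus L)"
      by (simp add: torus_End_def)
    show "(torus_mult L L c \<oplus>\<^bsub>torus_End E L\<^esub> torus_mult L L d) (L +>\<^bsub>real_ring\<^esub> x)
      = torus_mult L L (c + d) (L +>\<^bsub>real_ring\<^esub> x)" for x
      by (simp add: torus_End_def real_coset_in_quantum_torus real_coset_add[OF z] cosets distrib_right)
  qed
  show "\<one>\<^bsub>torus_End E L\<^esub> = torus_mult L L 1"
  proof (rule torus_map_eqI[OF _ torus_mult_extensional])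
    show "\<one>\<^bsub>torus_End E L\<^esub> \<in> extensional (quantum_torus L)"
      by (simp add: torus_End_def)
    show "\<one>\<^bsub>torus_End E L\<^esub> (L +>\<^bsub>real_ring\<^esub> x) = torus_mult L L 1 (L +>\<^bsub>real_ring\<^esub> x)" for x
      by (simp add: torus_End_def real_coset_in_quantum_torus cosets)
  qed
qed

end

locale quantum_tori = nonstandard_model_locale E N + quadratic_field F D \<delta>
  for E :: "('v, 'h, 'w) extension" and N F D \<delta>
begin

text \<open>Endomorphisms are the multipliers of L, so an isomorphism, read backwards, is a ring map
  \<sigma> from \<O> into the reals with image \<open>multipliers L\<close>. An abstract isomorphism
  becomes an equality because such a map can only permute \<O>.\<close>

lemma torus_End_iso_iff:
  assumes L: "pseudolattice L"
  shows "torus_End E L \<simeq> integer_ring F \<longleftrightarrow> multipliers L = \<O>"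
proof
  note bij = torus_End_bij[OF L]
  note ops = torus_End_ops[OF L]
  have one: "1 \<in> multipliers L" by (simp add: multipliers_def)
  have R: "carrier (integer_ring F) = \<O>" "x \<otimes>\<^bsub>integer_ring F\<^esub> y = x * y"
    "x \<oplus>\<^bsub>integer_ring F\<^esub> y = x + y" "\<one>\<^bsub>integer_ring F\<^esub> = 1" for x y
    by (simp_all add: integer_ring_def ring_of_type_algebra_def)
  {
    assume "torus_End E L \<simeq> integer_ring F"
    then obtain h where h: "h \<in> ring_hom (torus_End E L) (integer_ring F)"
      "bij_betw h (carrier (torus_End E L)) \<O>"
      unfolding is_ring_iso_def ring_iso_def by (auto simp: R)
    define k where "k = h \<circ> torus_mult L L"
    have k: "bij_betw k (multipliers L) \<O>"
      unfolding k_def using bij h(2) by (rule bij_betw_trans)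
    have mem: "torus_mult L L c \<in> carrier (torus_End E L)" if "c \<in> multipliers L" for c
      using bij that by (rule bij_betwE[THEN bspec])
    have k_mult: "k (c * d) = k c * k d" and k_add: "k (c + d) = k c + k d"
      if "c \<in> multipliers L" "d \<in> multipliers L" for c d
      using ring_hom_mult[OF h(1) mem[OF that(1)] mem[OF that(2)]]
        ring_hom_add[OF h(1) mem[OF that(1)] mem[OF that(2)]]
      unfolding ops(1,2)[OF that] R by (simp_all add: k_def)
    have k_one: "k 1 = 1"
      using ring_hom_one[OF h(1)] ops(3)[OF one one] by (simp add: k_def R)
    define \<sigma> where "\<sigma> = inv_into (multipliers L) k"
    have \<sigma>: "bij_betw \<sigma> \<O> (multipliers L)" unfolding \<sigma>_def using k by (rule bij_betw_inv_into)
    have \<sigma>k: "\<sigma> (k c) = c" if "c \<in> multipliers L" for c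
      unfolding \<sigma>_def using k that by (simp add: bij_betw_inv_into_left)
    have k\<sigma>: "k (\<sigma> x) = x" "\<sigma> x \<in> multipliers L" if "x \<in> \<O>" for x
      using bij_betw_inv_into_right[OF k that] bij_betwE[OF \<sigma>] that unfolding \<sigma>_def by auto
    have "\<sigma> ` \<O> = \<O>"
    proof (rule integers_ring_hom_image)
      show "\<sigma> 1 = 1" using \<sigma>k[OF one] k_one by simp
      fix x y assume xy: "x \<in> \<O>" "y \<in> \<O>"
      note \<sigma>xy = k\<sigma>(2)[OF xy(1)] k\<sigma>(2)[OF xy(2)]
      show "\<sigma> (x + y) = \<sigma> x + \<sigma> y"
        using \<sigma>k[OF zmodule_add[OF zmodule_multipliers[OF zmodule_pseudolattice[OF L]] \<sigma>xy]] k_add[OF \<sigma>xy] k\<sigma>(1) xy by simp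
      show "\<sigma> (x * y) = \<sigma> x * \<sigma> y"
        using \<sigma>k[OF multipliers_mult[OF \<sigma>xy]] k_mult[OF \<sigma>xy] k\<sigma>(1) xy by simp
    qed
    then show "multipliers L = \<O>" using \<sigma> by (simp add: bij_betw_def)
  next
    assume O: "multipliers L = \<O>"
    note bij = bij[unfolded O] and ops = ops[unfolded O]
    define h where "h = inv_into \<O> (torus_mult L L)"
    have ht: "h (torus_mult L L c) = c" if "c \<in> \<O>" for c
      unfolding h_def using bij that by (simp add: bij_betw_inv_into_left)
    have h: "bij_betw h (carrier (torus_End E L)) \<O>" unfolding h_def using bij by (rule bij_betw_inv_into)
    have "h \<in> ring_iso (torus_End E L) (integer_ring F)"
    proof (rule ring_iso_memI)
      show "h f \<in> carrier (integer_ring F)" if "f \<in> carrier (torus_End E L)" for f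
        unfolding R using bij_betwE[OF h] that by blast
      fix f g assume "f \<in> carrier (torus_End E L)" "g \<in> carrier (torus_End E L)"
      then obtain c d where cd: "c \<in> \<O>" "d \<in> \<O>" "f = torus_mult L L c" "g = torus_mult L L d"
        using bij unfolding bij_betw_def by blast
      show "h (f \<otimes>\<^bsub>torus_End E L\<^esub> g) = h f \<otimes>\<^bsub>integer_ring F\<^esub> h g"
        unfolding cd(3,4) ops(1)[OF cd(1,2)] R using ht cd integers_mult by simp
      show "h (f \<oplus>\<^bsub>torus_End E L\<^esub> g) = h f \<oplus>\<^bsub>integer_ring F\<^esub> h g"
        unfolding cd(3,4) ops(2)[OF cd(1,2)] R using ht cd integers_add by simp
    next
      show "h \<one>\<^bsub>torus_End E L\<^esub> = \<one>\<^bsub>integer_ring F\<^esub>"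
        unfolding ops(3)[OF integers_1 integers_1] R by (rule ht) simp
      show "bij_betw h (carrier (torus_End E L)) (carrier (integer_ring F))" unfolding R by (rule h)
    qed
    then show "torus_End E L \<simeq> integer_ring F" unfolding is_ring_iso_def by blast
  }
qed

text \<open>The real factor l stays because the multiplier ring does not change when L is
  scaled.\<close>

lemma has_mult_by_iff: "has_mult_by E F L \<longleftrightarrow> (\<exists>l I. l \<noteq> 0 \<and> fractional_ideal F I \<and> L = scale l I)"
proof
  assume "has_mult_by E F L"
  then have "pseudolattice L" "multipliers L = \<O>"
    unfolding has_mult_by_def using torus_End_iso_iff by auto
  then show "\<exists>l I. l \<noteq> 0 \<and> fractional_ideal F I \<and> L = scale l I"
    by (metis pseudolattice_with_multipliers)
next
  assume "\<exists>l I. l \<noteq> 0 \<and> fractional_ideal F I \<and> L = scale l I"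
  then obtain l I where "l \<noteq> 0" "fractional_ideal F I" "L = scale l I" by blast
  then show "has_mult_by E F L"
    unfolding has_mult_by_def
    using fractional_ideal_pseudolattice[of I l] torus_End_iso_iff[of L] multipliers_scale[of l I]
      multipliers_fractional_ideal[of I] by simp
qed

lemma QT_eq: "QT E F = {torus_class E (quantum_torus L) | L. has_mult_by E F L}"
  unfolding QT_def quotient_def torus_class_def by blast


section \<open>The action of the class group\<close>

lemma has_mult_by_pseudolattice: "has_mult_by E F L \<Longrightarrow> pseudolattice L"
  unfolding has_mult_by_def by blast

lemma has_mult_by_mod_prod:
  assumes I: "fractional_ideal F I" and L: "has_mult_by E F L"
  shows "has_mult_by E F (mod_prod I L)"
proof -
  obtain l J where J: "l \<noteq> 0" "fractional_ideal F J" "L = scale l J"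
    using L unfolding has_mult_by_iff by blast
  have "mod_prod I L = scale l (mod_prod I J)"
    unfolding J(3) using I J(2) mod_prod_scale[of J I l] fractional_ideal_zmodule
    by (simp add: mod_prod_commute[of I])
  then show ?thesis
    unfolding has_mult_by_iff using J(1) fractional_ideal_mod_prod[OF I J(2)] by blast
qed

text \<open>Described through all representatives at once; the lemma \<open>class_act\<close> shows
  that the description is unambiguous. The restriction to \<open>QT E F\<close> makes the maps
  extensional, as \<open>Bij\<close> demands.\<close>

definition class_act :: "real set set \<Rightarrow> real set set set \<Rightarrow> real set set set" where
  "class_act g = (\<lambda>x\<in>QT E F. THE y. \<exists>I L. fractional_ideal F I \<and> has_mult_by E F L \<and>
     g = ideal_class F I \<and> x = torus_class E (quantum_torus L) \<and>
     y = torus_class E (quantum_torus (mod_prod I L)))"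

text \<open>Another representative of the ideal class is a multiple of I, and another lattice with
  the same torus class is homothetic to L. Both changes only rescale the product, which leaves its
  class alone.\<close>

lemma class_act:
  assumes I: "fractional_ideal F I" and L: "has_mult_by E F L"
  shows "class_act (ideal_class F I) (torus_class E (quantum_torus L)) = torus_class E (quantum_torus (mod_prod I L))"
proof -
  have unique: "torus_class E (quantum_torus (mod_prod I' L')) = torus_class E (quantum_torus (mod_prod I L))"
    if I': "fractional_ideal F I'" "ideal_class F I = ideal_class F I'"
      and L': "has_mult_by E F L'" "torus_class E (quantum_torus L) = torus_class E (quantum_torus L')"
    for I' L'
  proof -
    obtain x where x: "x \<noteq> 0" "I = scale x I'" using I' ideal_class_eq_iff[OF I I'(1)] by blast
    obtain c where c: "c \<noteq> 0" "L' = scale c L"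
      using L' torus_class_eq_iff[OF has_mult_by_pseudolattice[OF L] has_mult_by_pseudolattice[OF L'(1)]] by blast
    have z: "zmodule L" "zmodule I'"
      using L I'(1) has_mult_by_pseudolattice zmodule_pseudolattice fractional_ideal_zmodule by blast+
    have "mod_prod I L = scale x (mod_prod I' L)" unfolding x by (rule mod_prod_scale[OF z(2,1)])
    also have "mod_prod I' L = scale (1 / c) (mod_prod I' L')"
      unfolding c(2) mod_prod_commute[of I'] mod_prod_scale[OF z] using c(1) by simp
    finally have "mod_prod I L = scale (x / c) (mod_prod I' L')" by simp
    then show ?thesis
      using x(1) c(1) has_mult_by_pseudolattice[OF has_mult_by_mod_prod[OF I L]]
        has_mult_by_pseudolattice[OF has_mult_by_mod_prod[OF I'(1) L'(1)]]
      by (subst torus_class_eq_iff) (auto intro!: exI[of _ "x / c"])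
  qed
  have mem: "torus_class E (quantum_torus L) \<in> QT E F" unfolding QT_eq using L by blast
  show ?thesis
    unfolding class_act_def restrict_def if_P[OF mem]
  proof (rule the_equality)
    show "\<exists>I' L'. fractional_ideal F I' \<and> has_mult_by E F L' \<and> ideal_class F I = ideal_class F I' \<and>
      torus_class E (quantum_torus L) = torus_class E (quantum_torus L') \<and>
      torus_class E (quantum_torus (mod_prod I L)) = torus_class E (quantum_torus (mod_prod I' L'))"
      using I L by blast
  qed (elim exE conjE, simp only: unique)
qed

lemma class_act_closed:
  "g \<in> carrier (class_group F) \<Longrightarrow> x \<in> QT E F \<Longrightarrow> class_act g x \<in> QT E F"
  unfolding carrier_class_group QT_eq using class_act has_mult_by_mod_prod by blast

lemma class_act_mult:
  assumes "fractional_ideal F I" "fractional_ideal F J" "x \<in> QT E F"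
  shows "class_act (ideal_class F (mod_prod I J)) x = class_act (ideal_class F I) (class_act (ideal_class F J) x)"
proof -
  obtain L where L: "has_mult_by E F L" "x = torus_class E (quantum_torus L)"
    using assms(3) unfolding QT_eq by blast
  have "mod_prod (mod_prod I J) L = mod_prod I (mod_prod J L)"
    using assms(1,2) L(1) has_mult_by_pseudolattice zmodule_pseudolattice fractional_ideal_zmodule
    by (intro mod_prod_assoc) auto
  then show ?thesis
    unfolding L(2) using class_act assms(1,2) L(1) fractional_ideal_mod_prod has_mult_by_mod_prod by simp
qed

lemma class_act_one:
  assumes "x \<in> QT E F" shows "class_act (ideal_class F \<O>) x = x"
proof -
  obtain L where L: "has_mult_by E F L" "x = torus_class E (quantum_torus L)"
    using assms unfolding QT_eq by blast
  have "mod_prod \<O> L = L"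
    using L(1) torus_End_iso_iff[of L] zmodule_pseudolattice[of L] unfolding has_mult_by_def
    by (intro mod_prod_integers) auto
  then show ?thesis unfolding L(2) using class_act[OF fractional_ideal_integers L(1)] by simp
qed

lemma group_action_class_act: "group_action (class_group F) (QT E F) class_act"
proof -
  have Bij: "class_act g \<in> Bij (QT E F)" if g: "g \<in> carrier (class_group F)" for g
  proof -
    obtain I where I: "fractional_ideal F I" "g = ideal_class F I" using g unfolding carrier_class_group by blast
    obtain J where J: "fractional_ideal F J" "mod_prod J I = \<O>" by (rule fractional_ideal_inverse[OF I(1)])
    have J': "ideal_class F J \<in> carrier (class_group F)" unfolding carrier_class_group using J(1) by blast
    have "bij_betw (class_act g) (QT E F) (QT E F)"
    \<comment> \<open>The inverse map is the action of an inverse ideal.\<close>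
    proof (rule bij_betw_byWitness[where f' = "class_act (ideal_class F J)"])
      show "\<forall>x\<in>QT E F. class_act (ideal_class F J) (class_act g x) = x"
        unfolding I(2) using class_act_mult[OF J(1) I(1)] class_act_one unfolding J(2) by metis
      show "\<forall>x\<in>QT E F. class_act g (class_act (ideal_class F J) x) = x"
        unfolding I(2) using class_act_mult[OF I(1) J(1)] class_act_one J(2) mod_prod_commute by metis
    qed (use class_act_closed g J' in blast)+
    then show ?thesis unfolding Bij_def by (simp add: class_act_def)
  qed
  show ?thesis
    unfolding group_action_def group_hom_def group_hom_axioms_def
  proof (intro conjI group_class_group group_BijGroup)
    show "class_act \<in> hom (class_group F) (BijGroup (QT E F))"
      unfolding hom_def
    proof (intro CollectI conjI ballI funcsetI)
      show "class_act g \<in> carrier (BijGroup (QT E F))" if "g \<in> carrier (class_group F)" for g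
        using Bij[OF that] by (simp add: BijGroup_def)
      fix g h assume gh: "g \<in> carrier (class_group F)" "h \<in> carrier (class_group F)"
      then obtain I J where IJ: "fractional_ideal F I" "g = ideal_class F I" "fractional_ideal F J" "h = ideal_class F J"
        unfolding carrier_class_group by blast
      have "class_act (g \<otimes>\<^bsub>class_group F\<^esub> h) = compose (QT E F) (class_act g) (class_act h)"
        unfolding IJ mult_class_group[OF IJ(1,3)]
        using class_act_mult[OF IJ(1,3)] by (intro extensionalityI[of _ "QT E F"]) (auto simp: class_act_def compose_def)
      then show "class_act (g \<otimes>\<^bsub>class_group F\<^esub> h) = class_act g \<otimes>\<^bsub>BijGroup (QT E F)\<^esub> class_act h"
        using Bij[OF gh(1)] Bij[OF gh(2)] by (simp add: BijGroup_def)
    qed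
  qed
qed

text \<open>With L and M homothetic to ideals J and K, acting by I takes one class to the other
  exactly if I J is homothetic to K. Multiplication by an inverse J' of J gives the solution K J'
  and determines I up to a real factor c, which turns out to lie in F.\<close>

lemma class_act_simply_transitive: "simply_transitive_action (class_group F) (QT E F) class_act"
  unfolding simply_transitive_action_def
proof (intro conjI ballI group_action_class_act)
  have "has_mult_by E F (scale 1 \<O>)"
    unfolding has_mult_by_iff using fractional_ideal_integers by (intro exI[of _ 1] exI[of _ \<O>]) simp
  then show "QT E F \<noteq> {}" unfolding QT_eq by blast
  fix x y assume "x \<in> QT E F" "y \<in> QT E F"
  then obtain L M where LM: "has_mult_by E F L" "x = torus_class E (quantum_torus L)"
    "has_mult_by E F M" "y = torus_class E (quantum_torus M)"
    unfolding QT_eq by blast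
  obtain l J where J: "l \<noteq> 0" "fractional_ideal F J" "L = scale l J" using LM(1) unfolding has_mult_by_iff by blast
  obtain m K where K: "m \<noteq> 0" "fractional_ideal F K" "M = scale m K" using LM(3) unfolding has_mult_by_iff by blast
  obtain J' where J': "fractional_ideal F J'" "mod_prod J' J = \<O>" by (rule fractional_ideal_inverse[OF J(2)])
  note z = fractional_ideal_zmodule
  \<comment> \<open>The real factors l and m are absorbed into c, leaving a relation between ideals
    of F.\<close>
  have act: "class_act (ideal_class F I) x = y \<longleftrightarrow> (\<exists>c. c \<noteq> 0 \<and> K = scale c (mod_prod I J))"
    if I: "fractional_ideal F I" for I
  proof -
    have "mod_prod I L = scale l (mod_prod I J)"
      unfolding J(3) using mod_prod_scale[OF z[OF J(2)] z[OF I]] by (simp add: mod_prod_commute[of I])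
    then have "class_act (ideal_class F I) x = y \<longleftrightarrow> (\<exists>c. c \<noteq> 0 \<and> M = scale c (scale l (mod_prod I J)))"
      unfolding LM(2,4) class_act[OF I LM(1)]
      using torus_class_eq_iff[OF has_mult_by_pseudolattice[OF has_mult_by_mod_prod[OF I LM(1)]] has_mult_by_pseudolattice[OF LM(3)]]
      by simp
    also have "\<dots> \<longleftrightarrow> (\<exists>c. c \<noteq> 0 \<and> K = scale c (mod_prod I J))"
    proof
      assume "\<exists>c. c \<noteq> 0 \<and> M = scale c (scale l (mod_prod I J))"
      then obtain c where c: "c \<noteq> 0" "scale m K = scale (c * l) (mod_prod I J)" unfolding K(3) by auto
      have "K = scale (1 / m) (scale m K)" using K(1) by simp
      also have "\<dots> = scale (c * l / m) (mod_prod I J)" unfolding c(2) by simp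
      finally show "\<exists>c. c \<noteq> 0 \<and> K = scale c (mod_prod I J)" using c(1) J(1) K(1) by (intro exI[of _ "c * l / m"]) simp
    next
      assume "\<exists>c. c \<noteq> 0 \<and> K = scale c (mod_prod I J)"
      then obtain c where "c \<noteq> 0" "K = scale c (mod_prod I J)" by blast
      then show "\<exists>c. c \<noteq> 0 \<and> M = scale c (scale l (mod_prod I J))"
        unfolding K(3) using J(1) K(1) by (intro exI[of _ "m * c / l"]) simp
    qed
    finally show ?thesis .
  qed
  have cancel: "mod_prod (mod_prod I J) J' = I" if I: "fractional_ideal F I" for I
    using mod_prod_assoc[OF z[OF I] z[OF J(2)] z[OF J'(1)]] J'(2) mod_prod_integers_fractional[OF I]
    by (simp add: mod_prod_commute[of J J'] mod_prod_commute[of I \<O>])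
  let ?I = "mod_prod K J'"
  have I: "fractional_ideal F ?I" using K(2) J'(1) by (rule fractional_ideal_mod_prod)
  have "mod_prod ?I J = K"
    using mod_prod_assoc[OF z[OF K(2)] z[OF J'(1)] z[OF J(2)]] J'(2) mod_prod_integers_fractional[OF K(2)]
    by (simp add: mod_prod_commute[of K \<O>])
  then have IJ: "class_act (ideal_class F ?I) x = y"
    unfolding act[OF I] by (intro exI[of _ 1]) simp
  show "\<exists>!g. g \<in> carrier (class_group F) \<and> class_act g x = y"
  proof (rule ex1I)
    show "ideal_class F ?I \<in> carrier (class_group F) \<and> class_act (ideal_class F ?I) x = y"
      unfolding carrier_class_group using I IJ by blast
    fix g assume "g \<in> carrier (class_group F) \<and> class_act g x = y"
    then obtain I' where I': "fractional_ideal F I'" "g = ideal_class F I'" "class_act (ideal_class F I') x = y"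
      unfolding carrier_class_group by blast
    then obtain c where c: "c \<noteq> 0" "K = scale c (mod_prod I' J)" using act by blast
    have "?I = scale c (mod_prod (mod_prod I' J) J')"
      unfolding c(2) by (intro mod_prod_scale zmodule_mod_prod z I'(1) J(2) J'(1))
    then have eq: "?I = scale c I'" unfolding cancel[OF I'(1)] .
    \<comment> \<open>The scalar c is the quotient of c t and t, elements of two ideals of F. Hence
      it lies in F, and the ideals have the same class.\<close>
    obtain t where t: "t \<in> I'" "t \<noteq> 0" using I'(1) zmodule_0 unfolding fractional_ideal_iff by blast
    have "c * t \<in> ?I" unfolding eq scale_def using t(1) by blast
    then have "c * t \<in> F" "t \<in> F" using I I'(1) t(1) unfolding fractional_ideal_iff by blast+
    then have "c * t / t \<in> F" by (rule F_divide)
    then have "c \<in> F" using t(2) by simp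
    then show "g = ideal_class F ?I"
      unfolding I'(2) using ideal_class_eq_iff[OF I I'(1)] c(1) eq by blast
  qed
qed

end

text \<open>The second conjunct expresses well-definedness: the product formula holds for every
  choice of representatives I and L.\<close>

theorem mainTheorem11:
  fixes E :: "('v, 'h, 'w) extension" and N :: enat and F :: "real set"
  assumes "nonstandard_model N E" and "real_quadratic_field F"
  shows "\<exists>act. simply_transitive_action (class_group F) (QT E F) act \<and>
    (\<forall>I L. fractional_ideal F I \<longrightarrow> has_mult_by E F L \<longrightarrow>
       act (ideal_class F I) (torus_class E (quantum_torus L)) =
         torus_class E (quantum_torus (ideal_prod real_ring I L)))"
proof -
  obtain D \<delta> where "quadratic_field F D \<delta>"
    using assms(2) by (rule real_quadratic_field_imp_quadratic_field)
  then interpret quantum_tori E N F D \<delta>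
    using assms(1) by (simp add: quantum_tori_def nonstandard_model_locale_def)
  show ?thesis
    using class_act_simply_transitive class_act by blast
qed


end
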